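(* There exist absolute constants $\alpha>0$ and $\beta>0$ such that for every integer $d\ge 2$ and all distinct $j,k\in\{1,\ldots,d\}$, the second-order discrete Riesz transform $R_{\mathrm{dis}}^{(jk)}$ satisfies $$ c_d\left(\frac{2}{2^{d/2}}+\frac{\frac83(d-2)}{3^{d/2}}-\frac{\beta}{10^{d/2}}-\frac{\frac{48}{11}(d-2)}{11^{d/2}}\right)\le \|R_{\mathrm{dis}}^{(jk)}\|_{\ell^2(\mathbb Z^d)\to\ell^2(\mathbb Z^d)}\le c_d\left(\frac{2}{2^{d/2}}+\frac{\alpha d}{3^{d/2}}\right). $$ In particular, as $d\to\infty$, $$ \|R_{\mathrm{dis}}^{(jk)}\|_{\ell^2(\mathbb Z^d)\to\ell^2(\mathbb Z^d)}=c_d\left(\frac{2}{2^{d/2}}+\frac{\left(\frac83+o(1)\right)d}{3^{d/2}}\right). $$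
   Context: For an integer $d\ge2$ put $c_d=\Gamma\left(\frac{d+2}{2}\right)/\pi^{d/2}$, and let $|\cdot|$ be the Euclidean norm. For $j,k\in\{1,\ldots,d\}$ and $f:\mathbb Z^d\to\mathbb C$, the second-order discrete Riesz transform is $$R_{\mathrm{dis}}^{(jk)}f(n)=c_d\sum_{m\in\mathbb Z^d\setminus\{0\}}\frac{m_jm_k}{|m|^{d+2}}f(n-m),\qquad n\in\mathbb Z^d.$$ $\|T\|_{\ell^p(\mathbb Z^d)\to\ell^p(\mathbb Z^d)}$ denotes the operator norm. "Absolute constant" means a constant independent of $d$, $j$, $k$. $o(1)$ denotes a quantity tending to $0$ as $d\to\infty$. *)

theory Defs
  imports "HOL-Analysis.Analysis"
begin

text \<open>
  The dimension \<open>d\<close> is quantified inside the theorem, after the absolute constants, so it cannot be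
  a type. Lattice points are represented by functions on \<open>nat\<close> that vanish outside \<open>{1..d}\<close>.
\<close>

definition int_lattice :: "nat \<Rightarrow> (nat \<Rightarrow> int) set" where
  "int_lattice d = {m. \<forall>i. i \<notin> {1..d} \<longrightarrow> m i = 0}"

definition eucl_norm :: "nat \<Rightarrow> (nat \<Rightarrow> int) \<Rightarrow> real" where
  "eucl_norm d m = L2_set (\<lambda>i. real_of_int (m i)) {1..d}"

definition riesz_const :: "nat \<Rightarrow> real" where
  "riesz_const d = Gamma ((real d + 2) / 2) / pi powr (real d / 2)"

text \<open>
  For square-summable \<open>f\<close> the series below converges absolutely by Cauchy--Schwarz, since the kernel
  is \<open>O(|m| powr (-d))\<close>; the default value of \<^const>\<open>infsum\<close> for non-summable families
  therefore plays no role on \<open>\<ell>\<^sup>2\<close>.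
\<close>

definition discrete_riesz2 ::
    "nat \<Rightarrow> nat \<Rightarrow> nat \<Rightarrow> ((nat \<Rightarrow> int) \<Rightarrow> complex) \<Rightarrow> (nat \<Rightarrow> int) \<Rightarrow> complex" where
  "discrete_riesz2 d j k f n =
     complex_of_real (riesz_const d) *
     (\<Sum>\<^sub>\<infinity>m\<in>int_lattice d - {\<lambda>i. 0}.
        complex_of_real (real_of_int (m j * m k) / eucl_norm d m ^ (d + 2)) * f (\<lambda>i. n i - m i))"

text \<open>
  The \<open>\<ell>\<^sup>p\<close> norm over an index set \<open>A\<close> for \<open>1 \<le> p < \<infinity>\<close>, with value \<open>\<infinity>\<close> outside \<open>\<ell>\<^sup>p\<close>.
  An operator that is unbounded, or does not map \<open>\<ell>\<^sup>p\<close> into itself, thus has operator norm \<open>\<infinity>\<close>.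
\<close>

definition lp_norm :: "real \<Rightarrow> 'a set \<Rightarrow> ('a \<Rightarrow> complex) \<Rightarrow> ereal" where
  "lp_norm p A f =
     (if (\<lambda>x. norm (f x) powr p) summable_on A
      then ereal ((\<Sum>\<^sub>\<infinity>x\<in>A. norm (f x) powr p) powr (1 / p))
      else \<infinity>)"

definition lp_opnorm :: "real \<Rightarrow> 'a set \<Rightarrow> (('a \<Rightarrow> complex) \<Rightarrow> 'a \<Rightarrow> complex) \<Rightarrow> ereal" where
  "lp_opnorm p A T = (SUP f\<in>{f. lp_norm p A f \<le> 1}. lp_norm p A (T f))"

end

theory Submission
  imports Defs "HOL-Real_Asymp.Real_Asymp"
begin

text \<open>
  Write \<open>K(m) = m\<^sub>j m\<^sub>k / \<bar>m\<bar>\<^bsup>d+2\<^esup>\<close> for the kernel without the constant \<open>c\<^sub>d\<close>. The norm of the operator is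
  governed by the few lattice points of small norm at which \<open>K\<close> does not vanish. The near part of \<open>K\<close>, on
  \<open>\<bar>m\<bar>\<^sup>2 \<le> 4\<close>, is finitely supported, and there \<open>m\<^sub>j\<close> and \<open>m\<^sub>k\<close> are \<open>1\<close> or \<open>- 1\<close>. On the character
  \<open>n \<mapsto> \<i> powi (n j + n k)\<close> all its terms acquire the same phase, so the norm of convolution with the near
  part is exactly its \<open>\<ell>\<^sup>1\<close> norm \<open>S\<close> (\<open>near_kernel_form_bounded\<close>, \<open>near_kernel_character\<close>). Counting the points with
  \<open>\<bar>m\<bar>\<^sup>2\<close> equal to \<open>2\<close>, \<open>3\<close> and \<open>4\<close> gives
  \<open>S = 2 / 2\<^bsup>d/2\<^esup> + (8/3) (d - 2) / 3\<^bsup>d/2\<^esup> + r\<close>, where \<open>r\<close> is of smaller order than \<open>3\<^bsup>-d/2\<^esup>\<close> but at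
  least \<open>2\<^sup>-\<^sup>d / 4\<close> for \<open>d \<ge> 4\<close> (\<open>near_mass_expansion\<close>).

  It remains to see that convolution with the far part, on \<open>\<bar>m\<bar>\<^sup>2 \<ge> 5\<close>, has norm at most
  \<open>C (10/21)\<^sup>d\<close> (\<open>far_kernel_form_bounded\<close>). This part is not absolutely summable. Expand
  \<open>K(m) = 1 / \<Gamma>(d/2 + 1) \<integral> t\<^bsup>d/2\<^esup> m\<^sub>j m\<^sub>k exp (- t \<bar>m\<bar>\<^sup>2) dt\<close> and cut the integral at the time \<open>t = 5\<close>. The integral
  beyond the cutoff converges absolutely in \<open>\<ell>\<^sup>1\<close> and is of order \<open>((33/31) / sqrt 5)\<^sup>d\<close>. In the integral up
  to the cutoff the Gaussian kernel is a tensor product. The factors in the \<open>d - 2\<close> transverse coordinates have norm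
  \<open>O(1 / sqrt t)\<close>, which \<open>t\<^bsup>d/2 - 1\<^esup>\<close> absorbs at the cost of \<open>10\<^sup>d\<close>. The two remaining factors are discrete
  derivatives of Gaussians, \<open>G\<^sub>t\<close> in direction \<open>j\<close> and in direction \<open>k\<close>, and by the Cauchy--Schwarz
  inequality it suffices to bound \<open>\<integral> t \<parallel>G\<^sub>t f\<parallel>\<^sup>2 dt\<close> by a multiple of \<open>\<parallel>f\<parallel>\<^sup>2\<close>. This is a one-dimensional statement: after integration in \<open>t\<close>
  it concerns the kernel \<open>\<Sum>\<^sub>n p q / (p\<^sup>2 + q\<^sup>2)\<^sup>2\<close> with \<open>p = n - a\<close> and \<open>q = n - b\<close>, whose summands telescope up to an
  error that is summable in \<open>a - b\<close> (\<open>discrete_square_kernel_bound\<close>, \<open>gaussian_square_function_1d\<close>). The factor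
  \<open>1 / \<Gamma>(d/2 + 1)\<close> then makes this part superexponentially small.

  Hence the norm divided by \<open>c\<^sub>d\<close> differs from \<open>S\<close> by at most \<open>C (10/21)\<^sup>d\<close>
  (\<open>lp_opnorm_riesz_near_mass\<close>). Since \<open>10/21 < 1/2\<close>, the far part is eventually smaller than \<open>r\<close>, so for
  large \<open>d\<close> the two main terms bound the norm from below; for the remaining finitely many \<open>d\<close> a large
  \<open>\<beta>\<close> makes the lower bound nonpositive.
\<close>

section \<open>Summation over the integers\<close>

text \<open>
  Schur's test for the bilinear form with kernel \<open>k\<close>. The right-hand side is the arithmetic mean of
  the two squared norms; replacing \<open>h\<close> by \<open>c h\<close> and \<open>f\<close> by \<open>f / c\<close> turns it into the product of the
  norms, so nothing is lost, and in this form the estimates can be integrated in a parameter.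
\<close>

lemma schur_bound:
  fixes k :: "'a \<Rightarrow> 'b \<Rightarrow> real" and f :: "'b \<Rightarrow> real" and h :: "'a \<Rightarrow> real"
  assumes "finite X" "finite Y"
    and row: "\<And>x. x \<in> X \<Longrightarrow> (\<Sum>y\<in>Y. \<bar>k x y\<bar>) \<le> M"
    and col: "\<And>y. y \<in> Y \<Longrightarrow> (\<Sum>x\<in>X. \<bar>k x y\<bar>) \<le> M"
  shows "\<bar>\<Sum>x\<in>X. \<Sum>y\<in>Y. k x y * h x * f y\<bar> \<le> M / 2 * ((\<Sum>x\<in>X. (h x)\<^sup>2) + (\<Sum>y\<in>Y. (f y)\<^sup>2))"
proof -
  have amgm: "\<bar>k x y * h x * f y\<bar> \<le> \<bar>k x y\<bar> * (h x)\<^sup>2 / 2 + \<bar>k x y\<bar> * (f y)\<^sup>2 / 2" for x y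
  proof -
    have "0 \<le> (\<bar>h x\<bar> - \<bar>f y\<bar>)\<^sup>2" by simp
    then have "\<bar>h x\<bar> * \<bar>f y\<bar> \<le> ((h x)\<^sup>2 + (f y)\<^sup>2) / 2"
      by (simp add: power2_diff)
    then have "\<bar>k x y\<bar> * (\<bar>h x\<bar> * \<bar>f y\<bar>) \<le> \<bar>k x y\<bar> * (((h x)\<^sup>2 + (f y)\<^sup>2) / 2)"
      by (rule mult_left_mono) simp
    then show ?thesis by (simp add: abs_mult algebra_simps add_divide_distrib)
  qed
  have "\<bar>\<Sum>x\<in>X. \<Sum>y\<in>Y. k x y * h x * f y\<bar> \<le> (\<Sum>x\<in>X. \<Sum>y\<in>Y. \<bar>k x y * h x * f y\<bar>)"
    by (rule order_trans[OF sum_abs sum_mono[OF sum_abs]])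
  also have "\<dots> \<le> (\<Sum>x\<in>X. \<Sum>y\<in>Y. \<bar>k x y\<bar> * (h x)\<^sup>2 / 2 + \<bar>k x y\<bar> * (f y)\<^sup>2 / 2)"
    by (intro sum_mono amgm)
  also have "\<dots> = (\<Sum>x\<in>X. (\<Sum>y\<in>Y. \<bar>k x y\<bar>) * ((h x)\<^sup>2 / 2)) + (\<Sum>y\<in>Y. (\<Sum>x\<in>X. \<bar>k x y\<bar>) * ((f y)\<^sup>2 / 2))"
    unfolding sum.distrib
    by (subst (2) sum.swap) (simp add: sum_distrib_right sum_divide_distrib)
  also have "\<dots> \<le> (\<Sum>x\<in>X. M * ((h x)\<^sup>2 / 2)) + (\<Sum>y\<in>Y. M * ((f y)\<^sup>2 / 2))"
    by (intro add_mono sum_mono mult_right_mono row col) auto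
  also have "\<dots> = M / 2 * ((\<Sum>x\<in>X. (h x)\<^sup>2) + (\<Sum>y\<in>Y. (f y)\<^sup>2))"
    by (simp add: sum_distrib_left algebra_simps)
  finally show ?thesis .
qed

lemma even_int_sum_le:
  fixes f :: "int \<Rightarrow> real"
  assumes "finite A" "\<And>a. f (- a) = f a" "\<And>a. 0 \<le> f a"
  obtains N :: nat where "sum f A \<le> f 0 + 2 * (\<Sum>n<N. f (int n + 1))"
proof -
  obtain N where "\<forall>a\<in>A. nat \<bar>a\<bar> \<le> N"
    using finite_nat_set_iff_bounded_le[of "(\<lambda>a. nat \<bar>a\<bar>) ` A"] assms(1) by auto
  then have N: "A \<subseteq> {- int N..int N}" by (force simp: abs_le_iff nat_le_iff)
  have pos: "sum f {1..int N} = (\<Sum>n<N. f (int n + 1))"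
    by (rule sum.reindex_bij_witness[of _ "\<lambda>n. int n + 1" "\<lambda>a. nat a - 1"]) (auto simp: of_nat_diff)
  have neg: "sum f {-int N..-1} = sum f {1..int N}"
    by (rule sum.reindex_bij_witness[of _ uminus uminus]) (auto simp: assms(2))
  have split: "{- int N..int N} = insert 0 ({-int N..-1} \<union> {1..int N})" by auto
  have "sum f A \<le> sum f {- int N..int N}"
    using N assms by (intro sum_mono2) auto
  also have "\<dots> = f 0 + sum f ({-int N..-1} \<union> {1..int N})"
    unfolding split by (subst sum.insert) auto
  also have "sum f ({-int N..-1} \<union> {1..int N}) = sum f {-int N..-1} + sum f {1..int N}"
    by (intro sum.union_disjoint) auto
  finally show ?thesis by (intro that[of N]) (simp add: neg pos)
qed

lemma int_geometric_sum_le: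
  fixes r :: real
  assumes "finite A" "0 \<le> r" "r < 1"
  shows "(\<Sum>a\<in>A. r ^ nat \<bar>a::int\<bar>) \<le> 1 + 2 * r / (1 - r)"
proof -
  obtain N where N: "(\<Sum>a\<in>A. r ^ nat \<bar>a\<bar>) \<le> r ^ nat \<bar>0\<bar> + 2 * (\<Sum>n<N. r ^ nat \<bar>int n + 1\<bar>)"
    by (rule even_int_sum_le[of A "\<lambda>a. r ^ nat \<bar>a\<bar>"]) (use assms in auto)
  have "(\<Sum>n<N. r ^ n) \<le> (\<Sum>n. r ^ n)"
    using assms by (intro sum_le_suminf summable_geometric) auto
  also have "\<dots> = 1 / (1 - r)" using assms by (intro suminf_geometric) auto
  finally have "r * (\<Sum>n<N. r ^ n) \<le> r * (1 / (1 - r))"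
    using assms(2) by (rule mult_left_mono)
  then have "(\<Sum>n<N. r ^ nat \<bar>int n + 1\<bar>) \<le> r / (1 - r)"
    by (simp add: sum_distrib_left nat_add_distrib)
  then show ?thesis using N by simp
qed

lemma int_inverse_square_sum_bounded:
  obtains C :: real where "C \<ge> 0" "\<And>A. finite A \<Longrightarrow> (\<Sum>a\<in>A. 1 / (1 + (real_of_int a)\<^sup>2)) \<le> C"
proof -
  let ?g = "\<lambda>a. 1 / (1 + (real_of_int a)\<^sup>2)"
  let ?C = "\<Sum>n. 1 / real (Suc n) ^ 2"
  have sm: "summable (\<lambda>n. 1 / real (Suc n) ^ 2)"
    using inverse_power_summable[of 2, where ?'a = real] summable_Suc_iff[of "\<lambda>n. inverse (real n ^ 2)"]
    by (simp add: inverse_eq_divide)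
  have "(\<Sum>a\<in>A. ?g a) \<le> 1 + 2 * ?C" if "finite A" for A
  proof -
    obtain N where N: "sum ?g A \<le> ?g 0 + 2 * (\<Sum>n<N. ?g (int n + 1))"
      by (rule even_int_sum_le[of A ?g]) (use \<open>finite A\<close> in auto)
    have "(\<Sum>n<N. ?g (int n + 1)) \<le> (\<Sum>n<N. 1 / real (Suc n) ^ 2)"
      by (intro sum_mono divide_left_mono mult_pos_pos add_pos_pos) (auto simp: add.commute)
    also have "\<dots> \<le> ?C" by (intro sum_le_suminf sm) auto
    finally show ?thesis using N by simp
  qed
  moreover have "?C \<ge> 0" by (intro suminf_nonneg sm) auto
  ultimately show ?thesis by (intro that[of "1 + 2 * ?C"]) auto
qed

section \<open>A discrete square function\<close>

text \<open>
  With \<open>p = u - v\<close> and \<open>q = u + v\<close> the first summand is \<open>p q / (p\<^sup>2 + q\<^sup>2)\<^sup>2\<close>. Along the line of fixed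
  \<open>v\<close> it equals \<open>(u\<^sup>2 - v\<^sup>2) / (4 (u\<^sup>2 + v\<^sup>2)\<^sup>2)\<close>, which is \<open>- 1/4\<close> times the derivative of
  \<open>u / (u\<^sup>2 + v\<^sup>2)\<close>. Adding a quarter of the unit difference of that primitive therefore cancels the
  main term and leaves an error of order \<open>1 / (u\<^sup>2 + v\<^sup>2)\<^sup>2\<close>. For integers \<open>p\<close>
  and \<open>q\<close> the hypothesis holds, as \<open>u\<^sup>2 + v\<^sup>2 = (p\<^sup>2 + q\<^sup>2) / 2\<close>.
\<close>

lemma telescoped_kernel_remainder:
  fixes u v :: real
  assumes "u\<^sup>2 + v\<^sup>2 = 0 \<or> u\<^sup>2 + v\<^sup>2 \<ge> 1/2"
  shows "\<bar>(u\<^sup>2 - v\<^sup>2) / (4 * (u\<^sup>2 + v\<^sup>2)\<^sup>2)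
           + (1/4) * ((u + 1/2) / ((u + 1/2)\<^sup>2 + v\<^sup>2) - (u - 1/2) / ((u - 1/2)\<^sup>2 + v\<^sup>2))\<bar>
         \<le> 9 / ((1 + u\<^sup>2) * (1 + v\<^sup>2))"
  using assms
proof
  assume "u\<^sup>2 + v\<^sup>2 = 0"
  then have "u = 0" "v = 0" by (simp_all add: sum_power2_eq_zero_iff)
  then show ?thesis by (simp add: power2_eq_square)
next
  define X where "X = u\<^sup>2 + v\<^sup>2"
  define Y where "Y = u\<^sup>2 - v\<^sup>2"
  define Z where "Z = X\<^sup>2 - Y / 2 + 1/16"
  assume "u\<^sup>2 + v\<^sup>2 \<ge> 1/2"
  then have X: "X \<ge> 1/2" by (simp add: X_def)
  have Y: "\<bar>Y\<bar> \<le> X" by (simp add: X_def Y_def abs_le_iff)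
  have prodZ: "((u + 1/2)\<^sup>2 + v\<^sup>2) * ((u - 1/2)\<^sup>2 + v\<^sup>2) = Z"
    unfolding Z_def X_def Y_def by algebra
  have Z: "Z \<ge> X\<^sup>2 / 4"
  proof -
    have "(X / 2)\<^sup>2 \<le> (X - 1/4)\<^sup>2" using X by (intro power_mono) auto
    also have "\<dots> \<le> Z" using Y by (simp add: Z_def power2_eq_square algebra_simps abs_le_iff)
    finally show ?thesis by (simp add: power_divide)
  qed
  have X2: "X\<^sup>2 > 0" using X by simp
  have Zpos: "Z > 0" using Z X2 by linarith
  have nz: "(u + 1/2)\<^sup>2 + v\<^sup>2 \<noteq> 0" "(u - 1/2)\<^sup>2 + v\<^sup>2 \<noteq> 0"
    using Zpos prodZ by (metis less_irrefl mult_zero_left, metis less_irrefl mult_zero_right)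
  have "(u + 1/2) / ((u + 1/2)\<^sup>2 + v\<^sup>2) - (u - 1/2) / ((u - 1/2)\<^sup>2 + v\<^sup>2)
      = ((u + 1/2) * ((u - 1/2)\<^sup>2 + v\<^sup>2) - (u - 1/2) * ((u + 1/2)\<^sup>2 + v\<^sup>2)) / Z"
    unfolding diff_frac_eq[OF nz] prodZ ..
  also have "(u + 1/2) * ((u - 1/2)\<^sup>2 + v\<^sup>2) - (u - 1/2) * ((u + 1/2)\<^sup>2 + v\<^sup>2) = 1/4 - Y"
    unfolding Y_def by algebra
  finally have diff: "(u + 1/2) / ((u + 1/2)\<^sup>2 + v\<^sup>2) - (u - 1/2) / ((u - 1/2)\<^sup>2 + v\<^sup>2) = (1/4 - Y) / Z" .
  have eq: "Y / (4 * X\<^sup>2) + (1/4) * ((1/4 - Y) / Z) = (Y * Z + (1/4 - Y) * X\<^sup>2) / (4 * X\<^sup>2 * Z)"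
    using X2 Zpos by (simp add: field_simps)
  have num: "Y * Z + (1/4 - Y) * X\<^sup>2 = X\<^sup>2 / 4 - Y\<^sup>2 / 2 + Y / 16"
    unfolding Z_def by (simp add: algebra_simps power2_eq_square)
  have "\<bar>X\<^sup>2 / 4 - Y\<^sup>2 / 2 + Y / 16\<bar> \<le> X\<^sup>2"
  proof -
    have "Y\<^sup>2 \<le> X\<^sup>2" using Y X by (simp add: abs_le_square_iff[symmetric])
    moreover have "X / 2 \<le> X\<^sup>2" using X by (simp add: power2_eq_square mult_right_mono)
    moreover have "0 \<le> Y\<^sup>2" by simp
    ultimately show ?thesis using Y X unfolding abs_le_iff by linarith
  qed
  moreover have den: "4 * X\<^sup>2 * Z > 0" using X2 Zpos by simp
  ultimately have "\<bar>Y / (4 * X\<^sup>2) + (1/4) * ((1/4 - Y) / Z)\<bar> \<le> X\<^sup>2 / (4 * X\<^sup>2 * Z)"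
    unfolding eq num abs_divide abs_of_pos[OF den] using den by (intro divide_right_mono) auto
  also have "\<dots> = 1 / (4 * Z)" using X2 by simp
  also have "\<dots> \<le> 1 / X\<^sup>2" using Z X2 Zpos by (intro divide_left_mono mult_pos_pos) auto
  also have "\<dots> \<le> 9 / ((1 + u\<^sup>2) * (1 + v\<^sup>2))"
  proof -
    have "(1 + u\<^sup>2) * (1 + v\<^sup>2) \<le> (1 + X) * (1 + X)"
      unfolding X_def by (intro mult_mono) auto
    also have "\<dots> \<le> (3 * X) * (3 * X)" using X by (intro mult_mono) auto
    finally have "(1 + u\<^sup>2) * (1 + v\<^sup>2) \<le> 9 * X\<^sup>2" by (simp add: power2_eq_square)
    then show ?thesis using X2 by (simp add: divide_simps mult_pos_pos add_pos_nonneg)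
  qed
  finally show ?thesis unfolding diff X_def Y_def .
qed

lemma half_line_kernel_tendsto_0:
  fixes s c :: real
  shows "(\<lambda>M::nat. (real M + s) / ((real M + s)\<^sup>2 + c)) \<longlonglongrightarrow> 0"
  by real_asymp

text \<open>
  Summing over \<open>n\<close>, the telescoping part of the kernel contributes only boundary terms, which vanish
  as \<open>M\<close> grows; the remainder is dominated by a constant times \<open>1 / (1 + (a - b)\<^sup>2)\<close>, which is
  summable in \<open>b\<close>, so Schur's test applies. Without the cancellation the sum over \<open>n\<close> would only be
  of order \<open>1 / \<bar>a - b\<bar>\<close>, and Schur's test would fail.
\<close>

lemma discrete_square_kernel_bound:
  obtains C :: real where "C \<ge> 0"
    "\<And>(A :: int set) \<phi>. finite A \<Longrightarrow> \<exists>\<epsilon> :: nat \<Rightarrow> real. \<epsilon> \<longlonglongrightarrow> 0 \<and>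
       (\<forall>M. (\<Sum>a\<in>A. \<Sum>b\<in>A. \<phi> a * \<phi> b * (\<Sum>n\<in>{-int M..int M}.
          real_of_int ((n - a) * (n - b)) / (real_of_int ((n - a)\<^sup>2 + (n - b)\<^sup>2))\<^sup>2))
        \<le> C * (\<Sum>a\<in>A. (\<phi> a)\<^sup>2) + \<epsilon> M)"
proof -
  obtain C1 where C1: "C1 \<ge> 0" "\<And>A. finite A \<Longrightarrow> (\<Sum>a\<in>A. 1 / (1 + (real_of_int a)\<^sup>2)) \<le> C1"
    by (rule int_inverse_square_sum_bounded) blast
  define \<tau> where "\<tau> a b n = real_of_int ((n - a) * (n - b)) / (real_of_int ((n - a)\<^sup>2 + (n - b)\<^sup>2))\<^sup>2"
    for a b n :: int
  define F where "F a b x = (x - (a + b) / 2) / ((x - (a + b) / 2)\<^sup>2 + ((a - b) / 2)\<^sup>2)"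
    for a b x :: real
  define E where "E z = 144 * C1 / (1 + (real_of_int z)\<^sup>2)" for z :: int
  have term_bound: "\<bar>\<tau> a b n + 1/4 * (F a b (n + 1/2) - F a b (n - 1/2))\<bar>
      \<le> 144 / (1 + (real_of_int (2 * n - a - b))\<^sup>2) * (1 / (1 + (real_of_int (a - b))\<^sup>2))" for a b n :: int
  proof -
    define u v where "u = real_of_int n - (real_of_int a + real_of_int b) / 2"
      and "v = (real_of_int a - real_of_int b) / 2"
    have X: "u\<^sup>2 + v\<^sup>2 = real_of_int ((n - a)\<^sup>2 + (n - b)\<^sup>2) / 2"
      unfolding u_def v_def by (simp add: power2_eq_square field_simps)
    have Y: "u\<^sup>2 - v\<^sup>2 = real_of_int ((n - a) * (n - b))"
      unfolding u_def v_def by (simp add: power2_eq_square field_simps)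
    have tau: "\<tau> a b n = (u\<^sup>2 - v\<^sup>2) / (4 * (u\<^sup>2 + v\<^sup>2)\<^sup>2)"
      unfolding \<tau>_def X Y by (simp add: power_divide)
    have "(n - a)\<^sup>2 + (n - b)\<^sup>2 = 0 \<or> (n - a)\<^sup>2 + (n - b)\<^sup>2 \<ge> 1"
      using zero_le_power2[of "n - a"] zero_le_power2[of "n - b"] by linarith
    then have "u\<^sup>2 + v\<^sup>2 = 0 \<or> u\<^sup>2 + v\<^sup>2 \<ge> 1/2"
      unfolding X by (metis div_0 divide_right_mono of_int_0 of_int_1 of_int_le_iff zero_le_numeral)
    note telescoped_kernel_remainder[OF this]
    moreover have "F a b (n + 1/2) = (u + 1/2) / ((u + 1/2)\<^sup>2 + v\<^sup>2)"
      "F a b (n - 1/2) = (u - 1/2) / ((u - 1/2)\<^sup>2 + v\<^sup>2)"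
      by (simp_all add: F_def u_def v_def algebra_simps)
    ultimately have "\<bar>\<tau> a b n + 1/4 * (F a b (n + 1/2) - F a b (n - 1/2))\<bar> \<le> 9 / ((1 + u\<^sup>2) * (1 + v\<^sup>2))"
      unfolding tau by simp
    also have "\<dots> \<le> 9 / ((1 + (2 * u)\<^sup>2) / 4 * ((1 + (2 * v)\<^sup>2) / 4))"
      by (intro divide_left_mono mult_mono mult_pos_pos add_pos_nonneg) (auto simp: power_mult_distrib add_pos_nonneg)
    also have "2 * u = real_of_int (2 * n - a - b)" by (simp add: u_def field_simps)
    also have "2 * v = real_of_int (a - b)" by (simp add: v_def)
    finally show ?thesis by simp
  qed
  have Dbound: "(\<Sum>n\<in>{-int M..int M}. \<bar>\<tau> a b n + 1/4 * (F a b (n + 1/2) - F a b (n - 1/2))\<bar>) \<le> E (a - b)"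
    for M and a b :: int
  proof -
    have "(\<Sum>n\<in>{-int M..int M}. \<bar>\<tau> a b n + 1/4 * (F a b (n + 1/2) - F a b (n - 1/2))\<bar>)
      \<le> (\<Sum>n\<in>{-int M..int M}. 144 / (1 + (real_of_int (2 * n - a - b))\<^sup>2) * (1 / (1 + (real_of_int (a - b))\<^sup>2)))"
      by (intro sum_mono term_bound)
    also have "\<dots> = 144 / (1 + (real_of_int (a - b))\<^sup>2) *
        (\<Sum>n\<in>{-int M..int M}. 1 / (1 + (real_of_int (2 * n - a - b))\<^sup>2))"
      by (simp add: sum_distrib_left mult.commute)
    also have "(\<Sum>n\<in>{-int M..int M}. 1 / (1 + (real_of_int (2 * n - a - b))\<^sup>2))
        = (\<Sum>w\<in>(\<lambda>n. 2 * n - a - b) ` {-int M..int M}. 1 / (1 + (real_of_int w)\<^sup>2))"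
      by (subst sum.reindex) (auto simp: inj_on_def)
    also have "\<dots> \<le> C1" by (rule C1) simp
    finally show ?thesis by (simp add: E_def mult_left_mono divide_right_mono)
  qed
  \<comment> \<open>The points \<open>n + 1/2\<close> and \<open>(n + 1) - 1/2\<close> coincide, so consecutive terms cancel.\<close>
  have telescope: "(\<Sum>n\<in>{-int M..int M}. F a b (n + 1/2) - F a b (n - 1/2))
      = F a b (real M + 1/2) - F a b (- real M - 1/2)" for M a b
  proof -
    have "(\<Sum>n\<in>{-int M..int M}. F a b (n + 1/2) - F a b (n - 1/2))
      = (\<Sum>i<2 * M + 1. F a b (real (Suc i) - real M - 1/2) - F a b (real i - real M - 1/2))"
      by (rule sum.reindex_bij_witness[of _ "\<lambda>i. int i - int M" "\<lambda>n. nat (n + int M)"])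
        (auto simp: algebra_simps)
    also have "\<dots> = F a b (real (2 * M + 1) - real M - 1/2) - F a b (real 0 - real M - 1/2)"
      by (rule sum_lessThan_telescope)
    finally show ?thesis by (simp add: algebra_simps)
  qed
  have F_lim: "(\<lambda>M. F a b (real M + 1/2) - F a b (- real M - 1/2)) \<longlonglongrightarrow> 0" for a b
  proof -
    have 1: "(\<lambda>M. F a b (real M + 1/2)) \<longlonglongrightarrow> 0"
      using half_line_kernel_tendsto_0[of "1/2 - (a + b) / 2" "((a - b) / 2)\<^sup>2"]
      by (simp add: F_def add_diff_eq)
    have "(\<lambda>M. - ((real M + (1/2 + (a + b) / 2)) / ((real M + (1/2 + (a + b) / 2))\<^sup>2 + ((a - b) / 2)\<^sup>2)))
        \<longlonglongrightarrow> - 0"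
      by (intro tendsto_minus half_line_kernel_tendsto_0)
    also have "(\<lambda>M. - ((real M + (1/2 + (a + b) / 2)) / ((real M + (1/2 + (a + b) / 2))\<^sup>2 + ((a - b) / 2)\<^sup>2)))
        = (\<lambda>M. F a b (- real M - 1/2))"
    proof
      fix M :: nat
      have "- real M - 1/2 - (a + b) / 2 = - (real M + (1/2 + (a + b) / 2))" by simp
      then show "- ((real M + (1/2 + (a + b) / 2)) / ((real M + (1/2 + (a + b) / 2))\<^sup>2 + ((a - b) / 2)\<^sup>2))
        = F a b (- real M - 1/2)"
        unfolding F_def by (simp only: power2_minus minus_divide_left)
    qed
    finally have 2: "(\<lambda>M. F a b (- real M - 1/2)) \<longlonglongrightarrow> 0" by simp
    show ?thesis using tendsto_diff[OF 1 2] by simp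
  qed
  have main: "\<exists>\<epsilon> :: nat \<Rightarrow> real. \<epsilon> \<longlonglongrightarrow> 0 \<and>
       (\<forall>M. (\<Sum>a\<in>A. \<Sum>b\<in>A. \<phi> a * \<phi> b * (\<Sum>n\<in>{-int M..int M}. \<tau> a b n))
        \<le> 144 * C1 * C1 * (\<Sum>a\<in>A. (\<phi> a)\<^sup>2) + \<epsilon> M)" if A: "finite A" for A :: "int set" and \<phi>
  proof -
    define D where "D M a b = F a b (real M + 1/2) - F a b (- real M - 1/2)" for M :: nat and a b :: real
    define \<epsilon> where "\<epsilon> M = - 1/4 * (\<Sum>a\<in>A. \<Sum>b\<in>A. \<phi> a * \<phi> b * D M a b)" for M
    have "\<epsilon> \<longlonglongrightarrow> - 1/4 * (\<Sum>a\<in>A. \<Sum>b\<in>A. \<phi> a * \<phi> b * 0)"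
      unfolding \<epsilon>_def D_def by (intro tendsto_intros F_lim)
    then have "\<epsilon> \<longlonglongrightarrow> 0" by simp
    moreover have "(\<Sum>a\<in>A. \<Sum>b\<in>A. \<phi> a * \<phi> b * (\<Sum>n\<in>{-int M..int M}. \<tau> a b n))
        \<le> 144 * C1 * C1 * (\<Sum>a\<in>A. (\<phi> a)\<^sup>2) + \<epsilon> M" for M
    proof -
      define R where "R a b = (\<Sum>n\<in>{-int M..int M}. \<tau> a b n + 1/4 * (F a b (n + 1/2) - F a b (n - 1/2)))" for a b
      have R: "\<bar>R a b\<bar> \<le> E (a - b)" for a b
        unfolding R_def by (rule order_trans[OF sum_abs Dbound])
      have tauR: "(\<Sum>n\<in>{-int M..int M}. \<tau> a b n) = R a b - 1/4 * D M a b" for a b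
        unfolding R_def sum.distrib sum_distrib_left[symmetric] telescope D_def by simp
      have Esum: "(\<Sum>b\<in>A. E (a - b)) \<le> 144 * C1 * C1" for a
      proof -
        have "(\<Sum>b\<in>A. E (a - b)) = 144 * C1 * (\<Sum>z\<in>(\<lambda>b. a - b) ` A. 1 / (1 + (real_of_int z)\<^sup>2))"
          by (subst sum.reindex) (auto simp: inj_on_def E_def sum_distrib_left)
        also have "\<dots> \<le> 144 * C1 * C1" using A C1(1) by (intro mult_left_mono C1(2)) auto
        finally show ?thesis .
      qed
      have Esym: "E (a - b) = E (b - a)" for a b by (simp add: E_def power2_commute)
      have "\<bar>\<Sum>a\<in>A. \<Sum>b\<in>A. R a b * \<phi> a * \<phi> b\<bar> \<le> 144 * C1 * C1 / 2 * ((\<Sum>a\<in>A. (\<phi> a)\<^sup>2) + (\<Sum>a\<in>A. (\<phi> a)\<^sup>2))"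
      proof (rule schur_bound[OF A A])
        show "(\<Sum>b\<in>A. \<bar>R a b\<bar>) \<le> 144 * C1 * C1" for a
          by (rule order_trans[OF sum_mono[OF R] Esum])
        show "(\<Sum>a\<in>A. \<bar>R a b\<bar>) \<le> 144 * C1 * C1" for b
        proof -
          have "(\<Sum>a\<in>A. \<bar>R a b\<bar>) \<le> (\<Sum>a\<in>A. E (b - a))"
            using R Esym by (intro sum_mono) metis
          also have "\<dots> \<le> 144 * C1 * C1" by (rule Esum)
          finally show ?thesis .
        qed
      qed
      moreover have "(\<Sum>a\<in>A. \<Sum>b\<in>A. \<phi> a * \<phi> b * (\<Sum>n\<in>{-int M..int M}. \<tau> a b n))
          = (\<Sum>a\<in>A. \<Sum>b\<in>A. R a b * \<phi> a * \<phi> b) + \<epsilon> M"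
        unfolding tauR \<epsilon>_def sum_distrib_left sum.distrib[symmetric]
        by (intro sum.cong refl) (simp add: algebra_simps)
      moreover have "144 * C1 * C1 / 2 * ((\<Sum>a\<in>A. (\<phi> a)\<^sup>2) + (\<Sum>a\<in>A. (\<phi> a)\<^sup>2)) = 144 * C1 * C1 * (\<Sum>a\<in>A. (\<phi> a)\<^sup>2)"
        by simp
      ultimately show ?thesis by linarith
    qed
    ultimately show ?thesis by blast
  qed
  show ?thesis
    using main C1(1) by (intro that[of "144 * C1 * C1"]) (auto simp: \<tau>_def)
qed

lemma has_integral_linear_exp:
  fixes c R :: real
  assumes "c \<noteq> 0" "0 \<le> R"
  shows "((\<lambda>t. t * exp (- t * c)) has_integral (1 / c\<^sup>2 - exp (- R * c) * (R / c + 1 / c\<^sup>2))) {0..R}"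
proof -
  have "((\<lambda>t. t * exp (- t * c)) has_integral
      (- exp (- R * c) * (R / c + 1 / c\<^sup>2) - (- exp (- 0 * c) * (0 / c + 1 / c\<^sup>2)))) {0..R}"
  proof (rule fundamental_theorem_of_calculus[OF assms(2)])
    fix t assume "t \<in> {0..R}"
    show "((\<lambda>t. - exp (- t * c) * (t / c + 1 / c\<^sup>2)) has_vector_derivative t * exp (- t * c)) (at t within {0..R})"
      unfolding has_real_derivative_iff_has_vector_derivative[symmetric]
      using assms(1) by (auto intro!: derivative_eq_intros simp: field_simps power2_eq_square)
  qed
  then show ?thesis by simp
qed

lemma linear_exp_remainder_tendsto_0:
  fixes c :: real
  assumes "c > 0"
  shows "((\<lambda>R. exp (- R * c) * (R / c + 1 / c\<^sup>2)) \<longlongrightarrow> 0) at_top"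
  using assms by real_asymp

text \<open>
  A discrete Littlewood--Paley estimate, uniform in \<open>T\<close> and in the finite set \<open>A\<close>. The integrand is a
  sum of squares, hence the left-hand side grows when the outer sum is extended to an interval \<open>{-M..M}\<close>
  and the integral to \<open>{0..R}\<close>. For fixed \<open>M\<close>, everything is a finite sum and the \<open>t\<close>-integral
  tends to \<open>p q / (p\<^sup>2 + q\<^sup>2)\<^sup>2\<close> as \<open>R\<close> grows; then the preceding lemma is used with \<open>M\<close> growing. Thus
  only finite sums and compact intervals of integration occur.
\<close>

lemma gaussian_square_function_1d:
  obtains C :: real where "C \<ge> 0"
    "\<And>(A :: int set) \<phi> T. finite A \<Longrightarrow>
       integral {0..T} (\<lambda>t. t * (\<Sum>n\<in>A. (\<Sum>a\<in>A. real_of_int (n - a) * exp (- t * (real_of_int (n - a))\<^sup>2) * \<phi> a)\<^sup>2))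
       \<le> C * (\<Sum>a\<in>A. (\<phi> a)\<^sup>2)"
proof -
  obtain C :: real where C: "C \<ge> 0"
    "\<And>(A :: int set) \<phi>. finite A \<Longrightarrow> \<exists>\<epsilon> :: nat \<Rightarrow> real. \<epsilon> \<longlonglongrightarrow> 0 \<and>
       (\<forall>M. (\<Sum>a\<in>A. \<Sum>b\<in>A. \<phi> a * \<phi> b * (\<Sum>n\<in>{-int M..int M}.
          real_of_int ((n - a) * (n - b)) / (real_of_int ((n - a)\<^sup>2 + (n - b)\<^sup>2))\<^sup>2))
        \<le> C * (\<Sum>a\<in>A. (\<phi> a)\<^sup>2) + \<epsilon> M)"
    by (rule discrete_square_kernel_bound) blast
  have "integral {0..T} (\<lambda>t. t * (\<Sum>n\<in>A. (\<Sum>a\<in>A. real_of_int (n - a) * exp (- t * (real_of_int (n - a))\<^sup>2) * \<phi> a)\<^sup>2))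
       \<le> C * (\<Sum>a\<in>A. (\<phi> a)\<^sup>2)" if A: "finite A" for A :: "int set" and \<phi> :: "int \<Rightarrow> real" and T
  proof -
    define g where "g n t = (\<Sum>a\<in>A. real_of_int (n - a) * exp (- t * (real_of_int (n - a))\<^sup>2) * \<phi> a)" for n and t :: real
    define H where "H B t = t * (\<Sum>n\<in>B. (g n t)\<^sup>2)" for B :: "int set" and t
    define c where "c n a b = real_of_int ((n - a)\<^sup>2 + (n - b)\<^sup>2)" for n a b :: int
    define p where "p n a b = real_of_int ((n - a) * (n - b))" for n a b :: int
    have cont: "continuous_on X (H B)" for B X
      unfolding H_def g_def by (intro continuous_intros)
    have int: "H B integrable_on {r..s}" for B r s
      by (rule integrable_continuous_real[OF cont])
    have Heq: "H B t = (\<Sum>a\<in>A. \<Sum>b\<in>A. \<phi> a * \<phi> b * (\<Sum>n\<in>B. p n a b * (t * exp (- t * c n a b))))" for B t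
    proof -
      have "H B t = (\<Sum>n\<in>B. \<Sum>a\<in>A. \<Sum>b\<in>A. \<phi> a * \<phi> b * (p n a b * (t * exp (- t * c n a b))))"
      proof -
        have "(g n t)\<^sup>2 = (\<Sum>a\<in>A. \<Sum>b\<in>A. \<phi> a * \<phi> b * (p n a b * exp (- t * c n a b)))" for n
        proof -
          have "exp (- t * c n a b) = exp (- t * (real_of_int (n - a))\<^sup>2) * exp (- t * (real_of_int (n - b))\<^sup>2)"
            for a b by (simp add: c_def exp_add[symmetric] distrib_left)
          then show ?thesis
            unfolding g_def power2_eq_square[of "sum _ _"] sum_product
            by (intro sum.cong refl) (simp add: p_def mult_ac)
        qed
        then show ?thesis
          unfolding H_def by (simp add: sum_distrib_left mult_ac)
      qed
      also have "\<dots> = (\<Sum>a\<in>A. \<Sum>b\<in>A. \<Sum>n\<in>B. \<phi> a * \<phi> b * (p n a b * (t * exp (- t * c n a b))))"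
        by (subst sum.swap, rule sum.cong[OF refl], rule sum.swap)
      finally show ?thesis by (simp add: sum_distrib_left)
    qed
    define I where "I R x = 1 / x\<^sup>2 - exp (- R * x) * (R / x + 1 / x\<^sup>2)" for R x :: real
    \<comment> \<open>If \<open>c n a b = 0\<close>, then \<open>n = a = b\<close> and the factor \<open>p n a b\<close> vanishes.\<close>
    have term_int: "((\<lambda>t. p n a b * (t * exp (- t * c n a b))) has_integral p n a b * I R (c n a b)) {0..R}"
      if "R \<ge> 0" for n a b R
    proof (cases "c n a b = 0")
      case True
      then have "(n - a)\<^sup>2 + (n - b)\<^sup>2 = 0" by (simp only: c_def of_int_eq_0_iff)
      then have "p n a b = 0" by (simp add: p_def sum_power2_eq_zero_iff)
      then show ?thesis by simp
    next
      case False
      then show ?thesis unfolding I_def by (intro has_integral_mult_right has_integral_linear_exp that)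
    qed
    have HI: "integral {0..R} (H B) = (\<Sum>a\<in>A. \<Sum>b\<in>A. \<phi> a * \<phi> b * (\<Sum>n\<in>B. p n a b * I R (c n a b)))"
      if "R \<ge> 0" "finite B" for R B
      unfolding Heq using A that
      by (intro integral_unique has_integral_sum has_integral_mult_right term_int) auto
    have limI: "((\<lambda>R. p n a b * I R (c n a b)) \<longlongrightarrow> p n a b / (c n a b)\<^sup>2) at_top" for n a b
    proof (cases "c n a b = 0")
      case True
      then have "(n - a)\<^sup>2 + (n - b)\<^sup>2 = 0" by (simp only: c_def of_int_eq_0_iff)
      then have "p n a b = 0" by (simp add: p_def sum_power2_eq_zero_iff)
      then show ?thesis by simp
    next
      case False
      then have "c n a b > 0" by (simp add: c_def less_le)
      then have "((\<lambda>R. p n a b * I R (c n a b)) \<longlongrightarrow> p n a b * (1 / (c n a b)\<^sup>2 - 0)) at_top"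
        unfolding I_def by (intro tendsto_intros linear_exp_remainder_tendsto_0)
      then show ?thesis by simp
    qed
    have bound_B: "integral {0..T} (H A) \<le> (\<Sum>a\<in>A. \<Sum>b\<in>A. \<phi> a * \<phi> b * (\<Sum>n\<in>B. p n a b / (c n a b)\<^sup>2))"
      if "A \<subseteq> B" "finite B" for B
    proof (rule tendsto_lowerbound)
      show "((\<lambda>R. \<Sum>a\<in>A. \<Sum>b\<in>A. \<phi> a * \<phi> b * (\<Sum>n\<in>B. p n a b * I R (c n a b))) \<longlongrightarrow>
          (\<Sum>a\<in>A. \<Sum>b\<in>A. \<phi> a * \<phi> b * (\<Sum>n\<in>B. p n a b / (c n a b)\<^sup>2))) at_top"
        by (intro tendsto_intros limI)
      show "\<forall>\<^sub>F R in at_top. integral {0..T} (H A) \<le> (\<Sum>a\<in>A. \<Sum>b\<in>A. \<phi> a * \<phi> b * (\<Sum>n\<in>B. p n a b * I R (c n a b)))"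
        using eventually_ge_at_top[of "max 0 T"]
      proof eventually_elim
        case (elim R)
        have "integral {0..T} (H A) \<le> integral {0..T} (H B)"
          using that unfolding H_def
          by (intro integral_le int[unfolded H_def] mult_left_mono sum_mono2) auto
        also have "\<dots> \<le> integral {0..R} (H B)"
          using elim by (intro integral_subset_le int) (auto simp: H_def intro!: mult_nonneg_nonneg sum_nonneg)
        also have "\<dots> = (\<Sum>a\<in>A. \<Sum>b\<in>A. \<phi> a * \<phi> b * (\<Sum>n\<in>B. p n a b * I R (c n a b)))"
          using elim that by (intro HI) auto
        finally show ?case .
      qed
    qed auto
    obtain \<epsilon> :: "nat \<Rightarrow> real" where \<epsilon>: "\<epsilon> \<longlonglongrightarrow> 0"
      "\<And>M. (\<Sum>a\<in>A. \<Sum>b\<in>A. \<phi> a * \<phi> b * (\<Sum>n\<in>{-int M..int M}. p n a b / (c n a b)\<^sup>2))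
        \<le> C * (\<Sum>a\<in>A. (\<phi> a)\<^sup>2) + \<epsilon> M"
      using C(2)[OF A, of \<phi>] unfolding p_def c_def by blast
    obtain M0 :: nat where M0: "\<forall>a\<in>A. nat \<bar>a\<bar> \<le> M0"
      using finite_nat_set_iff_bounded_le[of "(\<lambda>a. nat \<bar>a\<bar>) ` A"] A by auto
    have "integral {0..T} (H A) \<le> C * (\<Sum>a\<in>A. (\<phi> a)\<^sup>2) + 0"
    proof (rule tendsto_lowerbound)
      show "(\<lambda>M. C * (\<Sum>a\<in>A. (\<phi> a)\<^sup>2) + \<epsilon> M) \<longlonglongrightarrow> C * (\<Sum>a\<in>A. (\<phi> a)\<^sup>2) + 0"
        by (intro tendsto_intros \<epsilon>)
      show "\<forall>\<^sub>F M in sequentially. integral {0..T} (H A) \<le> C * (\<Sum>a\<in>A. (\<phi> a)\<^sup>2) + \<epsilon> M"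
        using eventually_ge_at_top[of M0]
      proof eventually_elim
        case (elim M)
        have "A \<subseteq> {-int M..int M}"
        proof
          fix a assume "a \<in> A"
          then have "nat \<bar>a\<bar> \<le> M" using M0 elim le_trans by blast
          then show "a \<in> {-int M..int M}" by auto
        qed
        from order_trans[OF bound_B[OF this] \<epsilon>(2)] show ?case by simp
      qed
    qed auto
    then show ?thesis unfolding H_def g_def by (simp only: add_0_right)
  qed
  with C(1) show ?thesis by (rule that)
qed

section \<open>Gaussian sums\<close>

text \<open>
  Completing the square, \<open>(sqrt t * \<bar>a\<bar> - 1)\<^sup>2 \<ge> 0\<close>, replaces the Gaussian by a geometric sequence.
\<close>

lemma exp_neg_square_le: "exp (- t * (real_of_int a)\<^sup>2) \<le> exp 1 * exp (- 2 * sqrt t) ^ nat \<bar>a\<bar>" if "0 \<le> t"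
proof -
  have "0 \<le> (sqrt t * \<bar>real_of_int a\<bar> - 1)\<^sup>2" by simp
  also have "\<dots> = t * (real_of_int a)\<^sup>2 - 2 * sqrt t * \<bar>real_of_int a\<bar> + 1"
    using that by (simp add: power2_diff power_mult_distrib)
  finally have "- t * (real_of_int a)\<^sup>2 \<le> 1 + real (nat \<bar>a\<bar>) * (- 2 * sqrt t)"
    by (simp add: mult_ac)
  then show ?thesis
    by (simp add: exp_add[symmetric] exp_of_nat_mult[symmetric])
qed

text \<open>
  The Gaussian sum over the integers is of order \<open>1 / sqrt t\<close> for small \<open>t\<close>. One factor
  \<open>sqrt t\<close> per transverse coordinate is exactly what the power of \<open>t\<close> in the Gamma integral provides.
\<close>

lemma sqrt_times_gaussian_sum_le:
  assumes "0 \<le> t" "finite A"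
  shows "sqrt t * (\<Sum>a\<in>A. exp (- t * (real_of_int a)\<^sup>2)) \<le> 3 * (sqrt t + 1)"
proof (cases "t = 0")
  case False
  define r where "r = exp (- 2 * sqrt t)"
  have st: "sqrt t > 0" using False assms by simp
  have r: "0 \<le> r" "r < 1" using st by (simp_all add: r_def)
  have "(\<Sum>a\<in>A. exp (- t * (real_of_int a)\<^sup>2)) \<le> (\<Sum>a\<in>A. exp 1 * r ^ nat \<bar>a\<bar>)"
    unfolding r_def using assms by (intro sum_mono exp_neg_square_le)
  also have "\<dots> \<le> 3 * (1 + 2 * r / (1 - r))"
    unfolding sum_distrib_left[symmetric]
    by (intro mult_mono int_geometric_sum_le sum_nonneg assms r exp_le) (auto simp: r)
  finally have 1: "(\<Sum>a\<in>A. exp (- t * (real_of_int a)\<^sup>2)) \<le> 3 * (1 + 2 * r / (1 - r))" .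
  have "r * (1 + 2 * sqrt t) \<le> r * exp (2 * sqrt t)"
    using r(1) by (intro mult_left_mono exp_ge_add_one_self) auto
  also have "\<dots> = 1" by (simp add: r_def exp_add[symmetric])
  finally have "2 * (sqrt t * r) \<le> 1 - r" by (simp add: algebra_simps)
  then have 2: "sqrt t * (2 * r / (1 - r)) \<le> 1"
    using r(2) by (simp add: divide_le_eq)
  have "sqrt t * (\<Sum>a\<in>A. exp (- t * (real_of_int a)\<^sup>2)) \<le> sqrt t * (3 * (1 + 2 * r / (1 - r)))"
    using 1 assms(1) by (intro mult_left_mono) auto
  also have "\<dots> = 3 * (sqrt t + sqrt t * (2 * r / (1 - r)))" by (simp add: algebra_simps)
  also have "\<dots> \<le> 3 * (sqrt t + 1)" using 2 by simp
  finally show ?thesis .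
qed simp

lemma exp_5_ge_32: "exp 5 \<ge> (32 :: real)"
proof -
  have "(2::real) ^ 5 \<le> exp 1 ^ 5"
    using exp_ge_add_one_self[of "1::real"] by (intro power_mono) auto
  also have "\<dots> = exp 5" by (simp add: exp_of_nat_mult[symmetric])
  finally show ?thesis by simp
qed

lemma exp_neg_5_square_le: "exp (- 5 * (real_of_int a)\<^sup>2) \<le> (1/32) ^ nat \<bar>a\<bar>"
proof -
  have "nat \<bar>a\<bar> * 1 \<le> nat \<bar>a\<bar> * nat \<bar>a\<bar>" by (cases "nat \<bar>a\<bar>") auto
  then have "real (nat \<bar>a\<bar>) \<le> (real (nat \<bar>a\<bar>))\<^sup>2"
    unfolding power2_eq_square by (metis mult_1_right of_nat_le_iff of_nat_mult)
  then have "- 5 * (real_of_int a)\<^sup>2 \<le> real (nat \<bar>a\<bar>) * (- 5)"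
    by simp
  then have "exp (- 5 * (real_of_int a)\<^sup>2) \<le> exp (- 5) ^ nat \<bar>a\<bar>"
    by (simp add: exp_of_nat_mult[symmetric])
  also have "\<dots> \<le> (1/32) ^ nat \<bar>a\<bar>"
    using exp_5_ge_32 by (intro power_mono) (auto simp: exp_minus inverse_eq_divide field_simps)
  finally show ?thesis .
qed

text \<open>
  The bound \<open>33/31\<close> is raised to the power \<open>d\<close> below. What matters is that \<open>33/31\<close> is smaller than
  \<open>sqrt 5 / 2\<close>, so that \<open>(33/31)\<^sup>d / 5\<^bsup>d/2\<^esup>\<close> is still negligible against \<open>4\<^bsup>-d/2\<^esup>\<close>; the
  cutoff time \<open>5\<close> is large enough for this.
\<close>

lemma gaussian_sum_5_le:
  assumes "finite A"
  shows "(\<Sum>a\<in>A. exp (- 5 * (real_of_int a)\<^sup>2)) \<le> 33 / 31"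
proof -
  have "(\<Sum>a\<in>A. exp (- 5 * (real_of_int a)\<^sup>2)) \<le> (\<Sum>a\<in>A. (1/32) ^ nat \<bar>a\<bar>)"
    by (intro sum_mono exp_neg_5_square_le)
  also have "\<dots> \<le> 1 + 2 * (1/32) / (1 - 1/32)"
    by (intro int_geometric_sum_le assms) auto
  finally show ?thesis by simp
qed

lemma weighted_gaussian_sum_5_le:
  assumes "finite A"
  shows "(\<Sum>a\<in>A. \<bar>real_of_int a\<bar> * exp (- 5 * (real_of_int a)\<^sup>2)) \<le> 2"
proof -
  have "(\<Sum>a\<in>A. \<bar>real_of_int a\<bar> * exp (- 5 * (real_of_int a)\<^sup>2)) \<le> (\<Sum>a\<in>A. (1/16) ^ nat \<bar>a\<bar>)"
  proof (rule sum_mono)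
    fix a :: int
    have "real (nat \<bar>a\<bar>) \<le> 2 ^ nat \<bar>a\<bar>" by (rule of_nat_less_two_power[THEN less_imp_le])
    then have "\<bar>real_of_int a\<bar> * exp (- 5 * (real_of_int a)\<^sup>2) \<le> 2 ^ nat \<bar>a\<bar> * (1/32) ^ nat \<bar>a\<bar>"
      by (intro mult_mono exp_neg_5_square_le) auto
    then show "\<bar>real_of_int a\<bar> * exp (- 5 * (real_of_int a)\<^sup>2) \<le> (1/16) ^ nat \<bar>a\<bar>"
      by (simp add: power_mult_distrib[symmetric])
  qed
  also have "\<dots> \<le> 1 + 2 * (1/16) / (1 - 1/16)"
    by (intro int_geometric_sum_le assms) auto
  finally show ?thesis by simp
qed

section \<open>Incomplete Gamma integrals\<close>

lemma Gamma_integral_scaled: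
  fixes s q :: real
  assumes "s > 0" "q > 0"
  shows "((\<lambda>t. t powr (s - 1) * exp (- t * q)) has_integral Gamma s / q powr s) {0..}"
proof -
  define g where "g t = (if t \<in> {0..} then t powr (s - 1) / exp t else 0)" for t :: real
  have nonneg: "0 \<le> g t" for t by (simp add: g_def)
  have meas: "g \<in> borel_measurable borel" unfolding g_def by measurable
  have Gpos: "Gamma s > 0" using assms(1) by (rule Gamma_real_pos)
  have "(g has_integral Gamma s) UNIV"
    using Gamma_integral_real[OF assms(1)] unfolding g_def by (simp only: has_integral_restrict_UNIV)
  then have "ennreal (Gamma s) = (\<integral>\<^sup>+t. ennreal (g t) \<partial>lborel)"
    using nn_integral_has_integral_lborel[OF meas nonneg] by simp
  also have "\<dots> = ennreal \<bar>q\<bar> * (\<integral>\<^sup>+t. ennreal (g (0 + q * t)) \<partial>lborel)"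
    using assms(2) meas by (intro nn_integral_real_affine) auto
  finally have "ennreal q * (\<integral>\<^sup>+t. ennreal (g (q * t)) \<partial>lborel) = ennreal q * ennreal (Gamma s / q)"
    using assms(2) Gpos by (simp add: ennreal_mult[symmetric])
  then have "(\<integral>\<^sup>+t. ennreal (g (q * t)) \<partial>lborel) = ennreal (Gamma s / q)"
    using assms(2) by (simp add: ennreal_mult_cancel_left)
  then have "((\<lambda>t. g (q * t)) has_integral Gamma s / q) UNIV"
    using nonneg Gpos assms(2) meas by (intro nn_integral_has_integral) auto
  then have "((\<lambda>t. q powr (1 - s) * g (q * t)) has_integral q powr (1 - s) * (Gamma s / q)) UNIV"
    by (rule has_integral_mult_right)
  also have "(\<lambda>t. q powr (1 - s) * g (q * t)) = (\<lambda>t. if t \<in> {0..} then t powr (s - 1) * exp (- t * q) else 0)"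
  proof
    fix t
    have "q powr (1 - s) * q powr (s - 1) = 1" using assms(2) by (simp add: powr_add[symmetric])
    then show "q powr (1 - s) * g (q * t) = (if t \<in> {0..} then t powr (s - 1) * exp (- t * q) else 0)"
      using assms(2) by (simp add: g_def powr_mult exp_minus divide_simps zero_le_mult_iff mult.commute)
  qed
  also have "q powr (1 - s) * (Gamma s / q) = Gamma s / q powr s"
    using assms(2) by (simp add: powr_diff)
  finally show ?thesis by (simp only: has_integral_restrict_UNIV)
qed

text \<open>
  This is \<open>1 / q powr s\<close> times the usual lower incomplete Gamma function at \<open>T * q\<close>, as long as
  \<open>q > 0\<close>; the unscaled variable keeps the Gaussian \<open>exp (- t * q)\<close> visible.
\<close>

definition incomplete_Gamma :: "real \<Rightarrow> real \<Rightarrow> real \<Rightarrow> real" where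
  "incomplete_Gamma s T q = integral {0..T} (\<lambda>t. t powr (s - 1) * exp (- t * q))"

lemma incomplete_Gamma_integrable:
  assumes "s > 1"
  shows "(\<lambda>t. t powr (s - 1) * exp (- t * q)) integrable_on {0..T::real}"
  using assms by (intro integrable_continuous_real continuous_intros continuous_on_powr') auto

lemma incomplete_Gamma_nonneg: "0 \<le> incomplete_Gamma s T q"
  unfolding incomplete_Gamma_def by (cases "(\<lambda>t. t powr (s - 1) * exp (- t * q)) integrable_on {0..T}")
    (auto intro!: integral_nonneg simp: not_integrable_integral)

lemma incomplete_Gamma_le:
  assumes "s > 1" "q \<ge> 0" "T \<ge> 0"
  shows "incomplete_Gamma s T q \<le> T powr s"
proof -
  have "incomplete_Gamma s T q \<le> integral {0..T} (\<lambda>t. T powr (s - 1))"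
    unfolding incomplete_Gamma_def
  proof (intro integral_le incomplete_Gamma_integrable assms(1))
    fix t assume t: "t \<in> {0..T}"
    have "t powr (s - 1) * exp (- t * q) \<le> T powr (s - 1) * 1"
      using t assms by (intro mult_mono powr_mono2) auto
    then show "t powr (s - 1) * exp (- t * q) \<le> T powr (s - 1)" by simp
  qed auto
  also have "\<dots> = T powr s" using assms by (auto simp: powr_mult_base)
  finally show ?thesis .
qed

text \<open>
  Beyond time \<open>T\<close> the factor \<open>exp (- t * (q - p))\<close> is at most \<open>exp (- T * (q - p))\<close>. This trades the
  power of \<open>q\<close> for a Gaussian in the lattice vector, whose sum over the lattice factorizes.
\<close>

lemma incomplete_Gamma_remainder:
  assumes "s > 1" "q \<ge> p" "p > 0" "T \<ge> 0"
  shows "0 \<le> Gamma s / q powr s - incomplete_Gamma s T q"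
    and "Gamma s / q powr s - incomplete_Gamma s T q \<le> exp (- T * (q - p)) * (Gamma s / p powr s)"
proof -
  define f where "f q t = t powr (s - 1) * exp (- t * q)" for q t :: real
  have full: "(f q has_integral Gamma s / q powr s) {0..}" if "q > 0" for q
    unfolding f_def using assms(1) that by (intro Gamma_integral_scaled) auto
  have "(f q has_integral incomplete_Gamma s T q) {0..T}"
    unfolding f_def incomplete_Gamma_def
    by (intro integrable_integral incomplete_Gamma_integrable assms(1))
  then have part: "((\<lambda>t. if t \<in> {0..T} then f q t else 0) has_integral incomplete_Gamma s T q) {0..}"
    by (subst has_integral_restrict) auto
  have diff: "((\<lambda>t. f q t - (if t \<in> {0..T} then f q t else 0)) has_integral Gamma s / q powr s - incomplete_Gamma s T q) {0..}"
    using assms by (intro has_integral_diff full part) auto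
  show "0 \<le> Gamma s / q powr s - incomplete_Gamma s T q"
    by (rule has_integral_nonneg[OF diff]) (auto simp: f_def)
  show "Gamma s / q powr s - incomplete_Gamma s T q \<le> exp (- T * (q - p)) * (Gamma s / p powr s)"
  proof (rule has_integral_le[OF diff has_integral_mult_right[OF full[OF assms(3)]]])
    fix t :: real assume "t \<in> {0..}"
    show "f q t - (if t \<in> {0..T} then f q t else 0) \<le> exp (- T * (q - p)) * f p t"
    proof (cases "t \<le> T")
      case True
      then show ?thesis using \<open>t \<in> {0..}\<close> by (simp add: f_def)
    next
      case False
      then have "T * (q - p) \<le> t * (q - p)" using assms by (intro mult_right_mono) auto
      then have "exp (- t * q) \<le> exp (- T * (q - p)) * exp (- t * p)"
        by (simp add: exp_add[symmetric] algebra_simps)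
      then have "t powr (s - 1) * exp (- t * q) \<le> t powr (s - 1) * (exp (- T * (q - p)) * exp (- t * p))"
        by (rule mult_left_mono) simp
      then show ?thesis using False by (simp add: f_def mult_ac)
    qed
  qed
qed

text \<open>
  Bounding the Gamma integral from below by its part over \<open>{R..R + 1}\<close>. Since \<open>R\<close> is arbitrary,
  \<open>Gamma s\<close> beats every exponential in \<open>s\<close>.
\<close>

lemma Gamma_ge_power:
  fixes s R :: real
  assumes "s \<ge> 1" "R > 0"
  shows "R powr (s - 1) * exp (- (R + 1)) \<le> Gamma s"
proof -
  let ?f = "\<lambda>t. t powr (s - 1) / exp t"
  have full: "(?f has_integral Gamma s) {0..}" using assms by (intro Gamma_integral_real) auto
  have cont: "continuous_on {R..R+1} ?f" using assms by (intro continuous_intros) auto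
  have "R powr (s - 1) * exp (- (R + 1)) = integral {R..R+1} (\<lambda>t. R powr (s - 1) * exp (- (R + 1)))"
    by simp
  also have "\<dots> \<le> integral {R..R+1} ?f"
  proof (intro integral_le integrable_continuous_real[OF cont])
    fix t assume t: "t \<in> {R..R+1}"
    have "R powr (s - 1) * exp (- (R + 1)) \<le> t powr (s - 1) * exp (- t)"
      using t assms by (intro mult_mono powr_mono2) auto
    then show "R powr (s - 1) * exp (- (R + 1)) \<le> ?f t" by (simp add: exp_minus divide_inverse)
  qed auto
  also have "\<dots> \<le> integral {0..} ?f"
    using assms full by (intro integral_subset_le integrable_continuous_real[OF cont])
      (auto simp: integrable_on_def)
  also have "\<dots> = Gamma s" using full by (rule integral_unique)
  finally show ?thesis .
qed

section \<open>Sums over boxes of lattice points\<close>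

definition lattice_box :: "nat \<Rightarrow> nat \<Rightarrow> (nat \<Rightarrow> int) set" where
  "lattice_box d N = {m \<in> int_lattice d. \<forall>i. \<bar>m i\<bar> \<le> int N}"

definition sq_norm :: "nat \<Rightarrow> (nat \<Rightarrow> int) \<Rightarrow> real" where
  "sq_norm d m = (\<Sum>i\<in>{1..d}. (real_of_int (m i))\<^sup>2)"

lemma lattice_box_bij_betw:
  "bij_betw (\<lambda>g i. if i \<in> {1..d} then g i else 0) (PiE {1..d} (\<lambda>_. {- int N..int N})) (lattice_box d N)"
proof (rule bij_betw_byWitness[where f' = "\<lambda>m. restrict m {1..d}"])
  show "\<forall>a\<in>{1..d} \<rightarrow>\<^sub>E {- int N..int N}. restrict (\<lambda>i. if i \<in> {1..d} then a i else 0) {1..d} = a"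
    by (auto simp: PiE_def extensional_def fun_eq_iff restrict_def)
  show "\<forall>a'\<in>lattice_box d N. (\<lambda>i. if i \<in> {1..d} then restrict a' {1..d} i else 0) = a'"
    by (auto simp: lattice_box_def int_lattice_def fun_eq_iff)
  show "(\<lambda>g i. if i \<in> {1..d} then g i else 0) ` ({1..d} \<rightarrow>\<^sub>E {- int N..int N}) \<subseteq> lattice_box d N"
    by (auto simp: lattice_box_def int_lattice_def PiE_iff abs_le_iff) (metis atLeastAtMost_iff minus_le_iff)+
  show "(\<lambda>m. restrict m {1..d}) ` lattice_box d N \<subseteq> {1..d} \<rightarrow>\<^sub>E {- int N..int N}"
    by (auto simp: lattice_box_def PiE_iff abs_le_iff) (smt (verit))+
qed

lemma finite_lattice_box [simp]: "finite (lattice_box d N)"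
  using bij_betw_finite[OF lattice_box_bij_betw[of d N]] by (simp add: finite_PiE)

lemma card_lattice_box: "card (lattice_box d N) = (2 * N + 1) ^ d"
  using bij_betw_same_card[OF lattice_box_bij_betw[of d N]] by (simp add: card_PiE nat_add_distrib nat_mult_distrib)

text \<open>
  Fubini for products: Gaussian sums over a box factor into one-dimensional sums.
\<close>

lemma sum_lattice_box_prod:
  "(\<Sum>m\<in>lattice_box d N. \<Prod>i\<in>{1..d}. g i (m i)) = (\<Prod>i\<in>{1..d}. \<Sum>a\<in>{- int N..int N}. g i a)"
  for g :: "nat \<Rightarrow> int \<Rightarrow> 'a::comm_semiring_1"
proof -
  have "(\<Prod>i\<in>{1..d}. \<Sum>a\<in>{- int N..int N}. g i a)
      = (\<Sum>m\<in>PiE {1..d} (\<lambda>_. {- int N..int N}). \<Prod>i\<in>{1..d}. g i (m i))"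
    by (rule prod_sum_PiE) auto
  also have "\<dots> = (\<Sum>m\<in>PiE {1..d} (\<lambda>_. {- int N..int N}). \<Prod>i\<in>{1..d}. g i (if i \<in> {1..d} then m i else 0))"
    by (intro sum.cong prod.cong) auto
  also have "\<dots> = (\<Sum>m\<in>lattice_box d N. \<Prod>i\<in>{1..d}. g i (m i))"
    by (rule sum.reindex_bij_betw[OF lattice_box_bij_betw, of "\<lambda>m. \<Prod>i\<in>{1..d}. g i (m i)"])
  finally show ?thesis ..
qed

lemma prod_split_two:
  fixes F :: "nat \<Rightarrow> 'a::comm_monoid_mult"
  assumes "j \<in> {1..d}" "k \<in> {1..d}" "j \<noteq> k"
  shows "(\<Prod>i\<in>{1..d}. F i) = F j * F k * (\<Prod>i\<in>{1..d} - {j, k}. F i)"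
proof -
  have "{1..d} - {j} - {k} = {1..d} - {j, k}" by auto
  then show ?thesis
    using assms prod.remove[of "{1..d}" j F] prod.remove[of "{1..d} - {j}" k F] by (simp add: mult.assoc)
qed

lemma sum_split_two:
  fixes F :: "nat \<Rightarrow> 'a::comm_monoid_add"
  assumes "j \<in> {1..d}" "k \<in> {1..d}" "j \<noteq> k"
  shows "(\<Sum>i\<in>{1..d}. F i) = F j + F k + (\<Sum>i\<in>{1..d} - {j, k}. F i)"
proof -
  have "{1..d} - {j} - {k} = {1..d} - {j, k}" by auto
  then show ?thesis
    using assms sum.remove[of "{1..d}" j F] sum.remove[of "{1..d} - {j}" k F] by (simp add: add.assoc)
qed

lemma card_minus_two:
  assumes "j \<in> {1..d}" "k \<in> {1..d}" "j \<noteq> k"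
  shows "card ({1..d} - {j, k}) = d - 2"
  using assms by (subst card_Diff_subset) auto

lemma lattice_box_fiber_sum:
  assumes "j \<in> {1..d}"
  shows "(\<Sum>w\<in>lattice_box d N. F w) = (\<Sum>w\<in>{w \<in> lattice_box d N. w j = 0}. \<Sum>b\<in>{- int N..int N}. F (w(j := b)))"
proof -
  have "(\<Sum>w\<in>lattice_box d N. F w)
      = (\<Sum>(w, b)\<in>{w \<in> lattice_box d N. w j = 0} \<times> {- int N..int N}. F (w(j := b)))"
    by (rule sum.reindex_bij_witness[of _ "\<lambda>(w, b). w(j := b)" "\<lambda>w. (w(j := 0), w j)"])
      (use assms in \<open>auto simp: lattice_box_def int_lattice_def abs_le_iff minus_le_iff fun_eq_iff\<close>)
  then show ?thesis by (simp add: sum.cartesian_product)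
qed

section \<open>Tensor structure of the Gaussian kernel\<close>

text \<open>
  Convolution in the single coordinate \<open>j\<close> with \<open>a * exp (- t * a\<^sup>2)\<close>, which up to a factor is the derivative
  of a Gaussian.
\<close>

definition gauss_derivative_conv :: "real \<Rightarrow> nat \<Rightarrow> nat \<Rightarrow> ((nat \<Rightarrow> int) \<Rightarrow> real) \<Rightarrow> (nat \<Rightarrow> int) \<Rightarrow> real" where
  "gauss_derivative_conv t N j f w =
     (\<Sum>a\<in>{- int N..int N}. real_of_int (w j - a) * exp (- t * (real_of_int (w j - a))\<^sup>2) * f (w(j := a)))"

text \<open>
  The one-dimensional estimate applied on each line of the box in direction \<open>j\<close>. The constant depends on
  neither the dimension nor the box.
\<close>

lemma gaussian_square_function_box:
  obtains C :: real where "C \<ge> 0"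
    "\<And>d N j f T. j \<in> {1..d} \<Longrightarrow>
       integral {0..T} (\<lambda>t. t * (\<Sum>w\<in>lattice_box d N. (gauss_derivative_conv t N j f w)\<^sup>2))
       \<le> C * (\<Sum>w\<in>lattice_box d N. (f w)\<^sup>2)"
proof -
  obtain C :: real where C: "C \<ge> 0"
    "\<And>(A :: int set) \<phi> T. finite A \<Longrightarrow>
       integral {0..T} (\<lambda>t. t * (\<Sum>n\<in>A. (\<Sum>a\<in>A. real_of_int (n - a) * exp (- t * (real_of_int (n - a))\<^sup>2) * \<phi> a)\<^sup>2))
       \<le> C * (\<Sum>a\<in>A. (\<phi> a)\<^sup>2)"
    by (rule gaussian_square_function_1d) blast
  show ?thesis
  proof (rule that[OF C(1)])
    fix d N j :: nat and T :: real and f :: "(nat \<Rightarrow> int) \<Rightarrow> real"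
    assume j: "j \<in> {1..d}"
    let ?J = "{- int N..int N}" and ?Z = "{w \<in> lattice_box d N. w j = 0}"
    let ?g = "\<lambda>w t. t * (\<Sum>n\<in>?J. (\<Sum>a\<in>?J. real_of_int (n - a) * exp (- t * (real_of_int (n - a))\<^sup>2) * f (w(j := a)))\<^sup>2)"
    have "(\<lambda>t. t * (\<Sum>w\<in>lattice_box d N. (gauss_derivative_conv t N j f w)\<^sup>2)) = (\<lambda>t. \<Sum>w\<in>?Z. ?g w t)"
      unfolding lattice_box_fiber_sum[OF j] gauss_derivative_conv_def by (simp add: sum_distrib_left)
    then have "integral {0..T} (\<lambda>t. t * (\<Sum>w\<in>lattice_box d N. (gauss_derivative_conv t N j f w)\<^sup>2))
        = (\<Sum>w\<in>?Z. integral {0..T} (?g w))"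
      by (simp only:) (intro integral_sum integrable_continuous_real continuous_intros, auto)
    also have "\<dots> \<le> (\<Sum>w\<in>?Z. C * (\<Sum>a\<in>?J. (f (w(j := a)))\<^sup>2))"
      by (intro sum_mono C(2)) auto
    also have "\<dots> = C * (\<Sum>w\<in>lattice_box d N. (f w)\<^sup>2)"
      unfolding lattice_box_fiber_sum[OF j, of "\<lambda>w. (f w)\<^sup>2"] by (simp add: sum_distrib_left)
    finally show "integral {0..T} (\<lambda>t. t * (\<Sum>w\<in>lattice_box d N. (gauss_derivative_conv t N j f w)\<^sup>2))
        \<le> C * (\<Sum>w\<in>lattice_box d N. (f w)\<^sup>2)" .
  qed
qed

text \<open>
  The heat kernel in the coordinates other than \<open>j\<close> and \<open>k\<close>, acting as the identity in these two.
\<close>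

definition transverse_gauss :: "nat \<Rightarrow> nat \<Rightarrow> nat \<Rightarrow> real \<Rightarrow> (nat \<Rightarrow> int) \<Rightarrow> (nat \<Rightarrow> int) \<Rightarrow> real" where
  "transverse_gauss d j k t w w' =
     (if w j = w' j \<and> w k = w' k then exp (- t * (\<Sum>i\<in>{1..d} - {j, k}. (real_of_int (w i - w' i))\<^sup>2)) else 0)"

lemma transverse_gauss_sym: "transverse_gauss d j k t w w' = transverse_gauss d j k t w' w"
  by (simp add: transverse_gauss_def eq_commute[of "w' _"] power2_commute)

lemma transverse_gauss_nonneg: "0 \<le> transverse_gauss d j k t w w'"
  by (simp add: transverse_gauss_def)

lemma transverse_gauss_row_sum:
  assumes jk: "j \<in> {1..d}" "k \<in> {1..d}" "j \<noteq> k" and t: "0 \<le> t" "t \<le> 5"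
  shows "(\<Sum>w'\<in>lattice_box d N. sqrt t ^ (d - 2) * transverse_gauss d j k t w w') \<le> 10 ^ (d - 2)"
proof -
  let ?J = "{- int N..int N}"
  define g where "g i a = (if i = j \<or> i = k then of_bool (w i = a) else exp (- t * (real_of_int (w i - a))\<^sup>2))"
    for i a
  have "transverse_gauss d j k t w w' = (\<Prod>i\<in>{1..d}. g i (w' i))" for w'
  proof -
    have "(\<Prod>i\<in>{1..d} - {j, k}. g i (w' i)) = (\<Prod>i\<in>{1..d} - {j, k}. exp (- t * (real_of_int (w i - w' i))\<^sup>2))"
      by (intro prod.cong) (auto simp: g_def)
    also have "\<dots> = exp (- t * (\<Sum>i\<in>{1..d} - {j, k}. (real_of_int (w i - w' i))\<^sup>2))"
      by (simp add: exp_sum[symmetric] sum_distrib_left sum_negf)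
    finally show ?thesis
      unfolding prod_split_two[OF jk] by (simp add: transverse_gauss_def g_def)
  qed
  then have "(\<Sum>w'\<in>lattice_box d N. transverse_gauss d j k t w w') = (\<Prod>i\<in>{1..d}. \<Sum>a\<in>?J. g i a)"
    by (simp only: sum_lattice_box_prod)
  also have "\<dots> = (\<Sum>a\<in>?J. g j a) * (\<Sum>a\<in>?J. g k a) * (\<Prod>i\<in>{1..d} - {j, k}. \<Sum>a\<in>?J. g i a)"
    by (rule prod_split_two[OF jk])
  also have "\<dots> \<le> 1 * 1 * (\<Prod>i\<in>{1..d} - {j, k}. \<Sum>a\<in>?J. g i a)"
  proof -
    have "card (?J \<inter> {c}) \<le> Suc 0" for c using card_mono[of "{c}" "?J \<inter> {c}"] by simp
    then show ?thesis
      by (intro mult_right_mono mult_mono prod_nonneg sum_nonneg) (auto simp: g_def)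
  qed
  finally have "(\<Sum>w'\<in>lattice_box d N. sqrt t ^ (d - 2) * transverse_gauss d j k t w w')
      \<le> sqrt t ^ (d - 2) * (\<Prod>i\<in>{1..d} - {j, k}. \<Sum>a\<in>?J. g i a)"
    unfolding sum_distrib_left[symmetric] using t by (intro mult_left_mono) auto
  also have "\<dots> = (\<Prod>i\<in>{1..d} - {j, k}. sqrt t * (\<Sum>a\<in>?J. g i a))"
    by (simp only: prod.distrib prod_constant card_minus_two[OF jk])
  also have "\<dots> \<le> (\<Prod>i\<in>{1..d} - {j, k}. 10)"
  proof (intro prod_mono conjI)
    fix i assume i: "i \<in> {1..d} - {j, k}"
    show "0 \<le> sqrt t * (\<Sum>a\<in>?J. g i a)"
      using t by (intro mult_nonneg_nonneg sum_nonneg) (auto simp: g_def)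
    have "(\<Sum>a\<in>?J. g i a) = (\<Sum>a\<in>(\<lambda>a. w i - a) ` ?J. exp (- t * (real_of_int a)\<^sup>2))"
      using i by (subst sum.reindex) (auto simp: inj_on_def g_def)
    then have "sqrt t * (\<Sum>a\<in>?J. g i a) \<le> 3 * (sqrt t + 1)"
      using sqrt_times_gaussian_sum_le[of t "(\<lambda>a. w i - a) ` ?J"] t by simp
    also have "sqrt t \<le> 7/3" using t by (intro real_le_lsqrt) (auto simp: power2_eq_square)
    finally show "sqrt t * (\<Sum>a\<in>?J. g i a) \<le> 10" by simp
  qed
  also have "\<dots> = 10 ^ (d - 2)" by (simp only: prod_constant card_minus_two[OF jk])
  finally show ?thesis .
qed

text \<open>
  The Gaussian kernel \<open>m\<^sub>j m\<^sub>k exp (- t \<bar>m\<bar>\<^sup>2)\<close> is a tensor product, so the step from \<open>y\<close> to \<open>x\<close> can be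
  made in three moves: coordinate \<open>j\<close> first, leading to \<open>w = y(j := x j)\<close>; the transverse coordinates
  next, leading to \<open>w' = x(k := y k)\<close>; coordinate \<open>k\<close> last. Both intermediate points lie in the same box
  as \<open>x\<close> and \<open>y\<close>, hence the identity holds for the truncated sums. The sign arises because the
  odd kernel in coordinate \<open>k\<close> is read backwards.
\<close>

lemma gaussian_form_factorization:
  assumes jk: "j \<in> {1..d}" "k \<in> {1..d}" "j \<noteq> k"
  shows "(\<Sum>x\<in>lattice_box d N. \<Sum>y\<in>lattice_box d N.
            real_of_int ((x j - y j) * (x k - y k)) * exp (- t * sq_norm d (\<lambda>i. x i - y i)) * h x * f y)
       = - (\<Sum>w'\<in>lattice_box d N. \<Sum>w\<in>lattice_box d N.
            transverse_gauss d j k t w' w * gauss_derivative_conv t N k h w' * gauss_derivative_conv t N j f w)"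
proof -
  let ?B = "lattice_box d N" and ?J = "{- int N..int N}"
  define \<gamma> where "\<gamma> n = real_of_int n * exp (- t * (real_of_int n)\<^sup>2)" for n :: int
  have \<gamma>_minus: "\<gamma> (a - b) = - \<gamma> (b - a)" for a b by (simp add: \<gamma>_def power2_commute[of "real_of_int a"] left_diff_distrib)
  \<comment> \<open>Quadruples on which the transverse kernel does not vanish; they correspond bijectively to pairs \<open>(x, y)\<close>.\<close>
  define P where "P = {(w', w, b, a). w' \<in> ?B \<and> w \<in> ?B \<and> b \<in> ?J \<and> a \<in> ?J \<and> w' j = w j \<and> w' k = w k}"
  define tg where "tg w' w b a = transverse_gauss d j k t w' w * (\<gamma> (w' k - b) * h (w'(k := b))) * (\<gamma> (w j - a) * f (w(j := a)))"
    for w' w b a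
  have "(\<Sum>w'\<in>?B. \<Sum>w\<in>?B.
      transverse_gauss d j k t w' w * gauss_derivative_conv t N k h w' * gauss_derivative_conv t N j f w)
    = (\<Sum>w'\<in>?B. \<Sum>w\<in>?B. \<Sum>b\<in>?J. \<Sum>a\<in>?J. tg w' w b a)"
    unfolding gauss_derivative_conv_def tg_def \<gamma>_def
    by (intro sum.cong refl) (simp add: sum_distrib_left sum_distrib_right mult_ac)
  also have "\<dots> = (\<Sum>(w', w, b, a)\<in>?B \<times> ?B \<times> ?J \<times> ?J. tg w' w b a)"
    by (simp add: sum.cartesian_product)
  also have "\<dots> = (\<Sum>(w', w, b, a)\<in>P. tg w' w b a)"
    by (rule sum.mono_neutral_right) (auto simp: P_def tg_def transverse_gauss_def split: if_splits)
  also have "\<dots> = (\<Sum>(x, y)\<in>?B \<times> ?B. - (real_of_int ((x j - y j) * (x k - y k)) * exp (- t * sq_norm d (\<lambda>i. x i - y i)) * h x * f y))"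
  proof (rule sum.reindex_bij_witness[of _ "\<lambda>(x, y). (x(k := y k), y(j := x j), x k, y j)"
        "\<lambda>(w', w, b, a). (w'(k := b), w(j := a))"], goal_cases)
    case (5 p)
    obtain w' w b a where p: "p = (w', w, b, a)" by (metis prod_cases4)
    have e: "w' j = w j" "w' k = w k" using 5 by (auto simp: p P_def)
    define x y where "x = w'(k := b)" and "y = w(j := a)"
    have c: "x j = w j" "y k = w' k" "x k = b" "y j = a" using e jk by (auto simp: x_def y_def)
    have rest: "(\<Sum>i\<in>{1..d} - {j, k}. (real_of_int (x i - y i))\<^sup>2) = (\<Sum>i\<in>{1..d} - {j, k}. (real_of_int (w' i - w i))\<^sup>2)"
      by (intro sum.cong) (auto simp: x_def y_def)
    have sq: "sq_norm d (\<lambda>i. x i - y i) = (real_of_int (w j - a))\<^sup>2 + (real_of_int (b - w' k))\<^sup>2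
        + (\<Sum>i\<in>{1..d} - {j, k}. (real_of_int (w' i - w i))\<^sup>2)"
      unfolding sq_norm_def sum_split_two[OF jk] rest c ..
    have "transverse_gauss d j k t w' w = exp (- t * (\<Sum>i\<in>{1..d} - {j, k}. (real_of_int (w' i - w i))\<^sup>2))"
      using e by (simp add: transverse_gauss_def)
    then have "tg w' w b a = - (\<gamma> (b - w' k) * \<gamma> (w j - a)
        * exp (- t * (\<Sum>i\<in>{1..d} - {j, k}. (real_of_int (w' i - w i))\<^sup>2)) * h x * f y)"
      unfolding tg_def \<gamma>_minus[of "w' k"] x_def y_def by simp
    also have "\<dots> = - (real_of_int ((x j - y j) * (x k - y k)) * exp (- t * sq_norm d (\<lambda>i. x i - y i)) * h x * f y)"
      unfolding sq c \<gamma>_def distrib_left exp_add by simp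
    finally show ?case by (simp add: p x_def y_def)
  qed (use jk in \<open>auto simp: P_def lattice_box_def int_lattice_def abs_le_iff minus_le_iff fun_eq_iff\<close>)
  also have "\<dots> = - (\<Sum>x\<in>?B. \<Sum>y\<in>?B.
      real_of_int ((x j - y j) * (x k - y k)) * exp (- t * sq_norm d (\<lambda>i. x i - y i)) * h x * f y)"
    by (simp add: sum.cartesian_product sum_negf case_prod_unfold)
  finally show ?thesis by simp
qed

lemma powr_half_dimension:
  assumes "0 \<le> t" "2 \<le> d"
  shows "t powr (real d / 2) = t * sqrt t ^ (d - 2)"
proof (cases "t = 0")
  case False
  then have "t powr (real d / 2) = (t powr (1/2)) powr real d" by (simp add: powr_powr)
  also have "\<dots> = sqrt t ^ d" using assms False by (simp add: powr_half_sqrt powr_realpow)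
  also have "\<dots> = sqrt t ^ (2 + (d - 2))" using assms(2) by (simp only: le_add_diff_inverse)
  also have "\<dots> = (sqrt t)\<^sup>2 * sqrt t ^ (d - 2)" by (rule power_add)
  finally show ?thesis using assms by simp
qed (use assms in simp)

text \<open>
  The part of the Gamma integral over \<open>t \<le> 5\<close>. For fixed \<open>t\<close>, Schur's test for the transverse heat
  kernel separates the two derivative convolutions, and \<open>t\<^bsup>d/2\<^esup>\<close> supplies \<open>sqrt t\<close> for each of the \<open>d - 2\<close>
  transverse coordinates, leaving the weight \<open>t\<close>. Integrating in \<open>t\<close>, each of the two
  terms is controlled by the square function estimate. This is where the cancellation of the
  kernel, which is not absolutely summable, enters.
\<close>

lemma small_time_form_bound:
  obtains C :: real where "C \<ge> 0"
    "\<And>d N j k f h. j \<in> {1..d} \<Longrightarrow> k \<in> {1..d} \<Longrightarrow> j \<noteq> k \<Longrightarrow>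
       \<bar>\<Sum>x\<in>lattice_box d N. \<Sum>y\<in>lattice_box d N. real_of_int ((x j - y j) * (x k - y k))
           * incomplete_Gamma (real d / 2 + 1) 5 (sq_norm d (\<lambda>i. x i - y i)) * h x * f y\<bar>
       \<le> C * 10 ^ d / 2 * ((\<Sum>x\<in>lattice_box d N. (h x)\<^sup>2) + (\<Sum>y\<in>lattice_box d N. (f y)\<^sup>2))"
proof -
  obtain C :: real where C: "C \<ge> 0"
    "\<And>d N j f T. j \<in> {1..d} \<Longrightarrow>
       integral {0..T} (\<lambda>t. t * (\<Sum>w\<in>lattice_box d N. (gauss_derivative_conv t N j f w)\<^sup>2))
       \<le> C * (\<Sum>w\<in>lattice_box d N. (f w)\<^sup>2)"
    by (rule gaussian_square_function_box) blast
  show ?thesis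
  proof (rule that[OF C(1)])
    fix d N j k :: nat and f h :: "(nat \<Rightarrow> int) \<Rightarrow> real"
    assume jk: "j \<in> {1..d}" "k \<in> {1..d}" "j \<noteq> k"
    then have d: "d \<ge> 2" by auto
    let ?B = "lattice_box d N"
    let ?q = "\<lambda>x y. sq_norm d (\<lambda>i. x i - y i)"
    define Q where "Q t = (\<Sum>x\<in>?B. \<Sum>y\<in>?B. real_of_int ((x j - y j) * (x k - y k)) * exp (- t * ?q x y) * h x * f y)" for t
    define H where "H j f t = t * (\<Sum>w\<in>?B. (gauss_derivative_conv t N j f w)\<^sup>2)" for j f t
    have Hint: "H j f integrable_on {0..5}" for j f
      unfolding H_def gauss_derivative_conv_def by (intro integrable_continuous_real continuous_intros)
    have pointwise: "\<bar>t powr (real d / 2) * Q t\<bar> \<le> 10 ^ (d - 2) / 2 * (H k h t + H j f t)" if t: "t \<in> {0..5}" for t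
    proof -
      let ?T = "\<lambda>w' w. sqrt t ^ (d - 2) * transverse_gauss d j k t w' w"
      have row: "(\<Sum>w\<in>?B. \<bar>?T w' w\<bar>) \<le> 10 ^ (d - 2)" for w'
        using transverse_gauss_row_sum[OF jk, where t = t and N = N and w = w'] t
        by (simp add: abs_mult transverse_gauss_nonneg)
      then have col: "(\<Sum>w'\<in>?B. \<bar>?T w' w\<bar>) \<le> 10 ^ (d - 2)" for w
        using transverse_gauss_sym[of d j k t _ w] by simp
      have "\<bar>sqrt t ^ (d - 2) * Q t\<bar> = \<bar>\<Sum>w'\<in>?B. \<Sum>w\<in>?B. ?T w' w * gauss_derivative_conv t N k h w' * gauss_derivative_conv t N j f w\<bar>"
        unfolding Q_def gaussian_form_factorization[OF jk] by (simp add: sum_distrib_left mult_ac)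
      also have "\<dots> \<le> 10 ^ (d - 2) / 2 * ((\<Sum>w\<in>?B. (gauss_derivative_conv t N k h w)\<^sup>2) + (\<Sum>w\<in>?B. (gauss_derivative_conv t N j f w)\<^sup>2))"
        by (intro schur_bound row col) auto
      finally have "t * \<bar>sqrt t ^ (d - 2) * Q t\<bar> \<le> t * (10 ^ (d - 2) / 2 * ((\<Sum>w\<in>?B. (gauss_derivative_conv t N k h w)\<^sup>2) + (\<Sum>w\<in>?B. (gauss_derivative_conv t N j f w)\<^sup>2)))"
        using t by (intro mult_left_mono) auto
      then show ?thesis
        using t d by (simp add: powr_half_dimension abs_mult H_def algebra_simps)
    qed
    have term_int: "((\<lambda>t. t powr (real d / 2) * exp (- t * q)) has_integral incomplete_Gamma (real d / 2 + 1) 5 q) {0..5}" for q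
      using incomplete_Gamma_integrable[of "real d / 2 + 1" q 5] d
      unfolding incomplete_Gamma_def by (auto intro: integrable_integral)
    have Q_int: "((\<lambda>t. t powr (real d / 2) * Q t) has_integral
        (\<Sum>x\<in>?B. \<Sum>y\<in>?B. real_of_int ((x j - y j) * (x k - y k)) * incomplete_Gamma (real d / 2 + 1) 5 (?q x y) * h x * f y)) {0..5}"
    proof -
      have "((\<lambda>t. \<Sum>x\<in>?B. \<Sum>y\<in>?B. real_of_int ((x j - y j) * (x k - y k)) * h x * f y * (t powr (real d / 2) * exp (- t * ?q x y))) has_integral
        (\<Sum>x\<in>?B. \<Sum>y\<in>?B. real_of_int ((x j - y j) * (x k - y k)) * h x * f y * incomplete_Gamma (real d / 2 + 1) 5 (?q x y))) {0..5}"
        by (intro has_integral_sum has_integral_mult_right term_int) auto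
      then show ?thesis unfolding Q_def by (simp add: sum_distrib_left mult_ac)
    qed
    have "\<bar>\<Sum>x\<in>?B. \<Sum>y\<in>?B. real_of_int ((x j - y j) * (x k - y k)) * incomplete_Gamma (real d / 2 + 1) 5 (?q x y) * h x * f y\<bar>
        = \<bar>integral {0..5} (\<lambda>t. t powr (real d / 2) * Q t)\<bar>"
      using Q_int by (simp add: integral_unique)
    also have "\<dots> \<le> integral {0..5} (\<lambda>t. 10 ^ (d - 2) / 2 * (H k h t + H j f t))"
      unfolding real_norm_def[symmetric] using Q_int pointwise
      by (intro integral_norm_bound_integral integrable_on_mult_right integrable_add Hint) (auto simp: integrable_on_def)
    also have "\<dots> = 10 ^ (d - 2) / 2 * (integral {0..5} (H k h) + integral {0..5} (H j f))"
      by (simp add: integral_add[OF Hint Hint])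
    also have "\<dots> \<le> 10 ^ d / 2 * (C * (\<Sum>x\<in>?B. (h x)\<^sup>2) + C * (\<Sum>y\<in>?B. (f y)\<^sup>2))"
    proof (intro mult_mono add_mono divide_right_mono power_increasing)
      show "integral {0..5} (H k h) \<le> C * (\<Sum>x\<in>?B. (h x)\<^sup>2)" unfolding H_def by (rule C(2)[OF jk(2)])
      show "integral {0..5} (H j f) \<le> C * (\<Sum>x\<in>?B. (f x)\<^sup>2)" unfolding H_def by (rule C(2)[OF jk(1)])
      show "0 \<le> integral {0..5} (H k h) + integral {0..5} (H j f)"
        by (intro add_nonneg_nonneg integral_nonneg Hint) (auto simp: H_def intro!: mult_nonneg_nonneg sum_nonneg)
    qed auto
    finally show "\<bar>\<Sum>x\<in>?B. \<Sum>y\<in>?B. real_of_int ((x j - y j) * (x k - y k)) * incomplete_Gamma (real d / 2 + 1) 5 (?q x y) * h x * f y\<bar>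
       \<le> C * 10 ^ d / 2 * ((\<Sum>x\<in>?B. (h x)\<^sup>2) + (\<Sum>y\<in>?B. (f y)\<^sup>2))"
      by (simp add: algebra_simps)
  qed
qed

section \<open>Convolution operators through bilinear forms on boxes\<close>

text \<open>
  The operator norm on \<open>\<ell>\<^sup>2\<close> of convolution with \<open>k\<close> is at most \<open>M\<close>, expressed through the truncations of the
  bilinear form to finite boxes, with real arguments and with the arithmetic mean in place of the product
  of the norms. This version is additive in \<open>k\<close> and involves no infinite sums.
\<close>

definition form_bounded :: "nat \<Rightarrow> ((nat \<Rightarrow> int) \<Rightarrow> real) \<Rightarrow> real \<Rightarrow> bool" where
  "form_bounded d k M \<longleftrightarrow> (\<forall>N f h.
     \<bar>\<Sum>x\<in>lattice_box d N. \<Sum>y\<in>lattice_box d N. k (\<lambda>i. x i - y i) * h x * f y\<bar>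
     \<le> M / 2 * ((\<Sum>x\<in>lattice_box d N. (h x)\<^sup>2) + (\<Sum>y\<in>lattice_box d N. (f y)\<^sup>2)))"

lemma form_boundedD:
  assumes "form_bounded d k M"
  shows "\<bar>\<Sum>x\<in>lattice_box d N. \<Sum>y\<in>lattice_box d N. k (\<lambda>i. x i - y i) * h x * f y\<bar>
     \<le> M / 2 * ((\<Sum>x\<in>lattice_box d N. (h x)\<^sup>2) + (\<Sum>y\<in>lattice_box d N. (f y)\<^sup>2))"
  using assms unfolding form_bounded_def by blast

lemma form_bounded_mono:
  assumes "form_bounded d k M" "M \<le> M'"
  shows "form_bounded d k M'"
  unfolding form_bounded_def
proof (intro allI)
  fix N and f h :: "(nat \<Rightarrow> int) \<Rightarrow> real"
  let ?R = "(\<Sum>x\<in>lattice_box d N. (h x)\<^sup>2) + (\<Sum>y\<in>lattice_box d N. (f y)\<^sup>2)"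
  have "M / 2 * ?R \<le> M' / 2 * ?R"
    using assms(2) by (intro mult_right_mono add_nonneg_nonneg sum_nonneg) auto
  then show "\<bar>\<Sum>x\<in>lattice_box d N. \<Sum>y\<in>lattice_box d N. k (\<lambda>i. x i - y i) * h x * f y\<bar> \<le> M' / 2 * ?R"
    using form_boundedD[OF assms(1), where N = N and h = h and f = f] by linarith
qed

lemma form_bounded_add:
  assumes "form_bounded d k M" "form_bounded d k' M'"
  shows "form_bounded d (\<lambda>m. k m + k' m) (M + M')"
  unfolding form_bounded_def
proof (intro allI)
  fix N and f h :: "(nat \<Rightarrow> int) \<Rightarrow> real"
  let ?R = "(\<Sum>x\<in>lattice_box d N. (h x)\<^sup>2) + (\<Sum>y\<in>lattice_box d N. (f y)\<^sup>2)"
  have "(\<Sum>x\<in>lattice_box d N. \<Sum>y\<in>lattice_box d N. (k (\<lambda>i. x i - y i) + k' (\<lambda>i. x i - y i)) * h x * f y)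
     = (\<Sum>x\<in>lattice_box d N. \<Sum>y\<in>lattice_box d N. k (\<lambda>i. x i - y i) * h x * f y)
     + (\<Sum>x\<in>lattice_box d N. \<Sum>y\<in>lattice_box d N. k' (\<lambda>i. x i - y i) * h x * f y)"
    by (simp add: distrib_right sum.distrib)
  moreover have "(M + M') / 2 * ?R = M / 2 * ?R + M' / 2 * ?R" by (simp add: field_simps)
  ultimately show "\<bar>\<Sum>x\<in>lattice_box d N. \<Sum>y\<in>lattice_box d N. (k (\<lambda>i. x i - y i) + k' (\<lambda>i. x i - y i)) * h x * f y\<bar>
      \<le> (M + M') / 2 * ?R"
    using form_boundedD[OF assms(1), where N = N and h = h and f = f] form_boundedD[OF assms(2), where N = N and h = h and f = f] by linarith
qed

lemma form_bounded_scale: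
  assumes "form_bounded d k M" "0 \<le> c"
  shows "form_bounded d (\<lambda>m. c * k m) (c * M)"
  unfolding form_bounded_def
proof (intro allI)
  fix N and f h :: "(nat \<Rightarrow> int) \<Rightarrow> real"
  have "(\<Sum>x\<in>lattice_box d N. \<Sum>y\<in>lattice_box d N. c * k (\<lambda>i. x i - y i) * h x * f y)
     = c * (\<Sum>x\<in>lattice_box d N. \<Sum>y\<in>lattice_box d N. k (\<lambda>i. x i - y i) * h x * f y)"
    by (simp add: sum_distrib_left mult.assoc)
  then show "\<bar>\<Sum>x\<in>lattice_box d N. \<Sum>y\<in>lattice_box d N. c * k (\<lambda>i. x i - y i) * h x * f y\<bar>
     \<le> c * M / 2 * ((\<Sum>x\<in>lattice_box d N. (h x)\<^sup>2) + (\<Sum>y\<in>lattice_box d N. (f y)\<^sup>2))"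
    using mult_left_mono[OF form_boundedD[OF assms(1), where N = N and h = h and f = f] assms(2)] assms(2) by (simp add: abs_mult mult_ac)
qed

lemma lattice_box_diff:
  assumes "x \<in> lattice_box d N" "y \<in> lattice_box d N"
  shows "(\<lambda>i. x i - y i) \<in> lattice_box d (2 * N)"
proof -
  have "\<bar>x i - y i\<bar> \<le> int (2 * N)" for i
    using assms abs_triangle_ineq4[of "x i" "y i"] by (fastforce simp: lattice_box_def dest!: spec[of _ i])
  then show ?thesis using assms by (simp add: lattice_box_def int_lattice_def)
qed

lemma form_bounded_l1:
  assumes l1: "\<And>N. (\<Sum>z\<in>lattice_box d N. \<bar>k z\<bar>) \<le> M"
  shows "form_bounded d k M"
  unfolding form_bounded_def
proof (intro allI)
  fix N and f h :: "(nat \<Rightarrow> int) \<Rightarrow> real"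
  have row: "(\<Sum>y\<in>lattice_box d N. \<bar>k (\<lambda>i. x i - y i)\<bar>) \<le> M" if "x \<in> lattice_box d N" for x
  proof -
    have inj: "inj_on (\<lambda>y i. x i - y i) (lattice_box d N)" by (auto simp: inj_on_def fun_eq_iff)
    have "(\<Sum>y\<in>lattice_box d N. \<bar>k (\<lambda>i. x i - y i)\<bar>) = (\<Sum>z\<in>(\<lambda>y i. x i - y i) ` lattice_box d N. \<bar>k z\<bar>)"
      using inj by (simp add: sum.reindex)
    also have "\<dots> \<le> (\<Sum>z\<in>lattice_box d (2 * N). \<bar>k z\<bar>)"
      using that by (intro sum_mono2) (auto intro: lattice_box_diff)
    also have "\<dots> \<le> M" by (rule l1)
    finally show ?thesis .
  qed
  have col: "(\<Sum>x\<in>lattice_box d N. \<bar>k (\<lambda>i. x i - y i)\<bar>) \<le> M" if "y \<in> lattice_box d N" for y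
  proof -
    have inj: "inj_on (\<lambda>x i. x i - y i) (lattice_box d N)" by (auto simp: inj_on_def fun_eq_iff)
    have "(\<Sum>x\<in>lattice_box d N. \<bar>k (\<lambda>i. x i - y i)\<bar>) = (\<Sum>z\<in>(\<lambda>x i. x i - y i) ` lattice_box d N. \<bar>k z\<bar>)"
      using inj by (simp add: sum.reindex)
    also have "\<dots> \<le> (\<Sum>z\<in>lattice_box d (2 * N). \<bar>k z\<bar>)"
      using that by (intro sum_mono2) (auto intro: lattice_box_diff)
    also have "\<dots> \<le> M" by (rule l1)
    finally show ?thesis .
  qed
  show "\<bar>\<Sum>x\<in>lattice_box d N. \<Sum>y\<in>lattice_box d N. k (\<lambda>i. x i - y i) * h x * f y\<bar>
     \<le> M / 2 * ((\<Sum>x\<in>lattice_box d N. (h x)\<^sup>2) + (\<Sum>y\<in>lattice_box d N. (f y)\<^sup>2))"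
    by (intro schur_bound row col) auto
qed

text \<open>
  Duality: the form is tested against multiples of the convolution itself, the optimal multiple being
  \<open>1 / M\<close>. A complex function is split into real and imaginary part, which the real kernel preserves.
\<close>

lemma form_bounded_box_norm:
  fixes f :: "(nat \<Rightarrow> int) \<Rightarrow> complex"
  assumes fb: "form_bounded d k M" and M: "0 \<le> M"
  shows "(\<Sum>x\<in>lattice_box d N. (cmod (\<Sum>y\<in>lattice_box d N. of_real (k (\<lambda>i. x i - y i)) * f y))\<^sup>2)
     \<le> M\<^sup>2 * (\<Sum>y\<in>lattice_box d N. (cmod (f y))\<^sup>2)"
proof -
  let ?B = "lattice_box d N"
  have real_case: "(\<Sum>x\<in>?B. (\<Sum>y\<in>?B. k (\<lambda>i. x i - y i) * u y)\<^sup>2) \<le> M\<^sup>2 * (\<Sum>y\<in>?B. (u y)\<^sup>2)"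
    for u :: "(nat \<Rightarrow> int) \<Rightarrow> real"
  proof -
    define g where "g x = (\<Sum>y\<in>?B. k (\<lambda>i. x i - y i) * u y)" for x
    define G F where "G = (\<Sum>x\<in>?B. (g x)\<^sup>2)" and "F = (\<Sum>y\<in>?B. (u y)\<^sup>2)"
    have G0: "0 \<le> G" and F0: "0 \<le> F" by (simp_all add: G_def F_def sum_nonneg)
    have scaled: "c * G \<le> M / 2 * (c\<^sup>2 * G + F)" for c
    proof -
      have "(\<Sum>x\<in>?B. \<Sum>y\<in>?B. k (\<lambda>i. x i - y i) * (c * g x) * u y) = (\<Sum>x\<in>?B. c * g x * g x)"
        unfolding g_def by (intro sum.cong refl) (simp add: sum_distrib_left mult_ac)
      also have "\<dots> = c * G" by (simp add: G_def sum_distrib_left power2_eq_square mult.assoc)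
      finally have e: "(\<Sum>x\<in>?B. \<Sum>y\<in>?B. k (\<lambda>i. x i - y i) * (c * g x) * u y) = c * G" .
      have "(\<Sum>x\<in>?B. (c * g x)\<^sup>2) = c\<^sup>2 * G"
        by (simp add: G_def sum_distrib_left power_mult_distrib)
      then show ?thesis
        using form_boundedD[OF fb, where N = N and h = "\<lambda>x. c * g x" and f = u] e unfolding F_def by simp
    qed
    have "G \<le> M\<^sup>2 * F"
    proof (cases "M = 0")
      case True
      then show ?thesis using scaled[of 1] G0 by simp
    next
      case False
      then have "M > 0" using M by simp
      then show ?thesis using scaled[of "1 / M"] by (simp add: field_simps power2_eq_square)
    qed
    then show ?thesis by (simp add: G_def F_def g_def)
  qed
  have "(cmod (\<Sum>y\<in>?B. of_real (k (\<lambda>i. x i - y i)) * f y))\<^sup>2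
      = (\<Sum>y\<in>?B. k (\<lambda>i. x i - y i) * Re (f y))\<^sup>2 + (\<Sum>y\<in>?B. k (\<lambda>i. x i - y i) * Im (f y))\<^sup>2" for x
    by (simp add: cmod_power2)
  then show ?thesis
    using add_mono[OF real_case[of "\<lambda>y. Re (f y)"] real_case[of "\<lambda>y. Im (f y)"]]
    by (simp add: cmod_power2 sum.distrib distrib_left)
qed

section \<open>Near and far part of the Riesz kernel\<close>

definition riesz_kernel :: "nat \<Rightarrow> nat \<Rightarrow> nat \<Rightarrow> (nat \<Rightarrow> int) \<Rightarrow> real" where
  "riesz_kernel d j k m = real_of_int (m j * m k) / sq_norm d m powr (real d / 2 + 1)"

definition near_kernel :: "nat \<Rightarrow> nat \<Rightarrow> nat \<Rightarrow> (nat \<Rightarrow> int) \<Rightarrow> real" where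
  "near_kernel d j k m = (if sq_norm d m \<le> 4 then riesz_kernel d j k m else 0)"

definition far_kernel :: "nat \<Rightarrow> nat \<Rightarrow> nat \<Rightarrow> (nat \<Rightarrow> int) \<Rightarrow> real" where
  "far_kernel d j k m = (if sq_norm d m \<le> 4 then 0 else riesz_kernel d j k m)"

lemma sq_norm_of_int: "sq_norm d m = real_of_int (\<Sum>i\<in>{1..d}. (m i)\<^sup>2)"
  by (simp add: sq_norm_def)

lemma sq_norm_nonneg: "0 \<le> sq_norm d m"
  by (simp add: sq_norm_def sum_nonneg)

lemma sq_norm_ge_5:
  assumes "\<not> sq_norm d m \<le> 4"
  shows "5 \<le> sq_norm d m"
proof -
  have "5 \<le> (\<Sum>i\<in>{1..d}. (m i)\<^sup>2)"
    using assms of_int_le_iff[of "\<Sum>i\<in>{1..d}. (m i)\<^sup>2" 4, where ?'a = real] unfolding sq_norm_of_int by linarith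
  then show ?thesis
    using of_int_le_iff[of 5 "\<Sum>i\<in>{1..d}. (m i)\<^sup>2", where ?'a = real] unfolding sq_norm_of_int by linarith
qed

text \<open>
  Serves to bound sums over the lattice by exponentials with base close to one: whenever a kernel is
  dominated by \<open>\<bar>m\<^sub>j m\<^sub>k\<bar>\<close> times a multiple of this Gaussian, its \<open>\<ell>\<^sup>1\<close> norm is controlled by the product of
  one-dimensional sums.
\<close>

lemma weighted_gaussian_box_sum:
  assumes jk: "j \<in> {1..d}" "k \<in> {1..d}" "j \<noteq> k"
  shows "(\<Sum>m\<in>lattice_box d N. \<bar>real_of_int (m j * m k)\<bar> * exp (- 5 * sq_norm d m)) \<le> 4 * (33/31) ^ d"
proof -
  let ?J = "{- int N..int N}"
  define g where "g i a = (if i = j \<or> i = k then \<bar>real_of_int a\<bar> * exp (- 5 * (real_of_int a)\<^sup>2) else exp (- 5 * (real_of_int a)\<^sup>2))"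
    for i and a :: int
  have "\<bar>real_of_int (m j * m k)\<bar> * exp (- 5 * sq_norm d m) = (\<Prod>i\<in>{1..d}. g i (m i))" for m
  proof -
    have "(\<Prod>i\<in>{1..d} - {j, k}. g i (m i)) = (\<Prod>i\<in>{1..d} - {j, k}. exp (- 5 * (real_of_int (m i))\<^sup>2))"
      by (intro prod.cong) (auto simp: g_def)
    also have "\<dots> = exp (- 5 * (\<Sum>i\<in>{1..d} - {j, k}. (real_of_int (m i))\<^sup>2))"
      by (simp add: exp_sum[symmetric] sum_distrib_left sum_negf)
    finally show ?thesis
      unfolding prod_split_two[OF jk] sq_norm_def sum_split_two[OF jk] distrib_left exp_add
      by (simp add: g_def abs_mult)
  qed
  then have "(\<Sum>m\<in>lattice_box d N. \<bar>real_of_int (m j * m k)\<bar> * exp (- 5 * sq_norm d m)) = (\<Prod>i\<in>{1..d}. \<Sum>a\<in>?J. g i a)"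
    by (simp only: sum_lattice_box_prod)
  also have "\<dots> = (\<Sum>a\<in>?J. g j a) * (\<Sum>a\<in>?J. g k a) * (\<Prod>i\<in>{1..d} - {j, k}. \<Sum>a\<in>?J. g i a)"
    by (rule prod_split_two[OF jk])
  also have "\<dots> \<le> 2 * 2 * (\<Prod>i\<in>{1..d} - {j, k}. 33/31)"
  proof (intro mult_mono prod_mono conjI)
    show "sum (g j) ?J \<le> 2" "sum (g k) ?J \<le> 2"
      using weighted_gaussian_sum_5_le[of ?J] by (simp_all add: g_def)
    show "sum (g i) ?J \<le> 33/31" if "i \<in> {1..d} - {j, k}" for i
      using gaussian_sum_5_le[of ?J] that by (simp add: g_def)
  qed (auto simp: g_def intro!: sum_nonneg prod_nonneg zero_le_power)
  also have "\<dots> = 4 * (33/31) ^ (d - 2)" by (simp only: prod_constant card_minus_two[OF jk])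
  also have "\<dots> \<le> 4 * (33/31) ^ d" by (intro mult_left_mono power_increasing) auto
  finally show ?thesis .
qed

text \<open>
  The three summands bound three pieces of the far kernel. The first is the integral up to time \<open>5\<close> for all
  lattice points, where cancellation is needed; the second removes from it the points with
  \<open>\<bar>m\<bar>\<^sup>2 \<le> 4\<close>; the third is the integral beyond time \<open>5\<close> for the points with \<open>\<bar>m\<bar>\<^sup>2 \<ge> 5\<close>. The last two
  converge absolutely and are compared with the Gaussian of width fixed by \<open>t = 5\<close>.
\<close>

lemma far_kernel_form_bounded_explicit:
  obtains C :: real where "C \<ge> 0"
    "\<And>d j k. j \<in> {1..d} \<Longrightarrow> k \<in> {1..d} \<Longrightarrow> j \<noteq> k \<Longrightarrow> form_bounded d (far_kernel d j k)
       (C * 10 ^ d / Gamma (real d / 2 + 1)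
        + exp 20 * (5 powr (real d / 2 + 1) / Gamma (real d / 2 + 1)) * (4 * (33/31) ^ d)
        + exp 25 / 5 powr (real d / 2 + 1) * (4 * (33/31) ^ d))"
proof -
  obtain C :: real where C: "C \<ge> 0"
    "\<And>d N j k f h. j \<in> {1..d} \<Longrightarrow> k \<in> {1..d} \<Longrightarrow> j \<noteq> k \<Longrightarrow>
       \<bar>\<Sum>x\<in>lattice_box d N. \<Sum>y\<in>lattice_box d N. real_of_int ((x j - y j) * (x k - y k))
           * incomplete_Gamma (real d / 2 + 1) 5 (sq_norm d (\<lambda>i. x i - y i)) * h x * f y\<bar>
       \<le> C * 10 ^ d / 2 * ((\<Sum>x\<in>lattice_box d N. (h x)\<^sup>2) + (\<Sum>y\<in>lattice_box d N. (f y)\<^sup>2))"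
    by (rule small_time_form_bound) blast
  show ?thesis
  proof (rule that[OF C(1)])
    fix d j k :: nat
    assume jk: "j \<in> {1..d}" "k \<in> {1..d}" "j \<noteq> k"
    then have d: "d \<ge> 2" by auto
    define s where "s = real d / 2 + 1"
    have s: "s > 1" using d by (simp add: s_def)
    have Gpos: "Gamma s > 0" using s by (intro Gamma_real_pos) auto
    define ig where "ig m = incomplete_Gamma s 5 (sq_norm d m)" for m
    define k1 where "k1 m = 1 / Gamma s * (real_of_int (m j * m k) * ig m)" for m
    define k2 where "k2 m = (if sq_norm d m \<le> 4 then - k1 m else 0)" for m
    define k3 where "k3 m = (if sq_norm d m \<le> 4 then 0 else riesz_kernel d j k m - k1 m)" for m
    have "form_bounded d (\<lambda>m. real_of_int (m j * m k) * ig m) (C * 10 ^ d)"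
      unfolding form_bounded_def ig_def s_def using C(2)[OF jk] by blast
    then have b1: "form_bounded d k1 (C * 10 ^ d / Gamma s)"
      using form_bounded_scale[of d _ _ "1 / Gamma s"] Gpos unfolding k1_def by fastforce
    have b2: "form_bounded d k2 (exp 20 * (5 powr s / Gamma s) * (4 * (33/31) ^ d))"
    proof (rule form_bounded_l1)
      fix N
      have "\<bar>k2 m\<bar> \<le> exp 20 * (5 powr s / Gamma s) * (\<bar>real_of_int (m j * m k)\<bar> * exp (- 5 * sq_norm d m))" for m
      proof (cases "sq_norm d m \<le> 4")
        case True
        have "1 \<le> exp 20 * exp (- 5 * sq_norm d m)"
          using True by (simp add: exp_add[symmetric])
        moreover have "0 \<le> ig m" "ig m \<le> 5 powr s"
          unfolding ig_def using s by (auto intro!: incomplete_Gamma_nonneg incomplete_Gamma_le sq_norm_nonneg)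
        ultimately have "ig m * 1 \<le> 5 powr s * (exp 20 * exp (- 5 * sq_norm d m))"
          by (intro mult_mono) auto
        then have "\<bar>real_of_int (m j * m k)\<bar> / Gamma s * (ig m * 1)
            \<le> \<bar>real_of_int (m j * m k)\<bar> / Gamma s * (5 powr s * (exp 20 * exp (- 5 * sq_norm d m)))"
          using Gpos by (intro mult_left_mono) auto
        then show ?thesis
          using True Gpos \<open>0 \<le> ig m\<close> by (simp add: k2_def k1_def abs_mult mult_ac)
      next
        case False
        then show ?thesis using Gpos by (simp add: k2_def)
      qed
      then have "(\<Sum>m\<in>lattice_box d N. \<bar>k2 m\<bar>)
          \<le> (\<Sum>m\<in>lattice_box d N. exp 20 * (5 powr s / Gamma s) * (\<bar>real_of_int (m j * m k)\<bar> * exp (- 5 * sq_norm d m)))"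
        by (rule sum_mono)
      also have "\<dots> \<le> exp 20 * (5 powr s / Gamma s) * (4 * (33/31) ^ d)"
        unfolding sum_distrib_left[symmetric] using Gpos
        by (intro mult_left_mono weighted_gaussian_box_sum jk) auto
      finally show "(\<Sum>m\<in>lattice_box d N. \<bar>k2 m\<bar>) \<le> exp 20 * (5 powr s / Gamma s) * (4 * (33/31) ^ d)" .
    qed
    have b3: "form_bounded d k3 (exp 25 / 5 powr s * (4 * (33/31) ^ d))"
    proof (rule form_bounded_l1)
      fix N
      have "\<bar>k3 m\<bar> \<le> exp 25 / 5 powr s * (\<bar>real_of_int (m j * m k)\<bar> * exp (- 5 * sq_norm d m))" for m
      proof (cases "sq_norm d m \<le> 4")
        case False
        define q where "q = sq_norm d m"
        have q: "q \<ge> 5" unfolding q_def using False by (rule sq_norm_ge_5)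
        define D where "D = Gamma s / q powr s - ig m"
        have D: "0 \<le> D" "D \<le> exp (- 5 * (q - 5)) * (Gamma s / 5 powr s)"
          using incomplete_Gamma_remainder[OF s q, of 5] unfolding D_def ig_def q_def by auto
        have "k3 m = real_of_int (m j * m k) * (D / Gamma s)"
          using False Gpos by (simp add: k3_def k1_def riesz_kernel_def D_def q_def s_def[symmetric] diff_divide_distrib right_diff_distrib)
        then have "\<bar>k3 m\<bar> = \<bar>real_of_int (m j * m k)\<bar> * (D / Gamma s)"
          using D(1) Gpos by (simp only: abs_mult abs_of_nonneg[of "D / Gamma s"] divide_nonneg_pos)
        also have "\<dots> \<le> \<bar>real_of_int (m j * m k)\<bar> * (exp (- 5 * (q - 5)) * (Gamma s / 5 powr s) / Gamma s)"
          using D(2) Gpos by (intro mult_left_mono divide_right_mono) auto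
        also have "\<dots> = \<bar>real_of_int (m j * m k)\<bar> * (exp (25 + - 5 * q) / 5 powr s)"
          using Gpos by (simp add: algebra_simps)
        also have "\<dots> = exp 25 / 5 powr s * (\<bar>real_of_int (m j * m k)\<bar> * exp (- 5 * sq_norm d m))"
          unfolding exp_add by (simp add: q_def)
        finally show ?thesis .
      qed (simp add: k3_def)
      then have "(\<Sum>m\<in>lattice_box d N. \<bar>k3 m\<bar>)
          \<le> (\<Sum>m\<in>lattice_box d N. exp 25 / 5 powr s * (\<bar>real_of_int (m j * m k)\<bar> * exp (- 5 * sq_norm d m)))"
        by (rule sum_mono)
      also have "\<dots> \<le> exp 25 / 5 powr s * (4 * (33/31) ^ d)"
        unfolding sum_distrib_left[symmetric]
        by (intro mult_left_mono weighted_gaussian_box_sum jk) auto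
      finally show "(\<Sum>m\<in>lattice_box d N. \<bar>k3 m\<bar>) \<le> exp 25 / 5 powr s * (4 * (33/31) ^ d)" .
    qed
    have "far_kernel d j k = (\<lambda>m. k1 m + k2 m + k3 m)"
      by (auto simp: far_kernel_def k2_def k3_def)
    then have "form_bounded d (far_kernel d j k)
       (C * 10 ^ d / Gamma s + exp 20 * (5 powr s / Gamma s) * (4 * (33/31) ^ d) + exp 25 / 5 powr s * (4 * (33/31) ^ d))"
      using form_bounded_add[OF form_bounded_add[OF b1 b2] b3] by simp
    then show "form_bounded d (far_kernel d j k)
       (C * 10 ^ d / Gamma (real d / 2 + 1)
        + exp 20 * (5 powr (real d / 2 + 1) / Gamma (real d / 2 + 1)) * (4 * (33/31) ^ d)
        + exp 25 / 5 powr (real d / 2 + 1) * (4 * (33/31) ^ d))"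
      by (simp only: s_def)
  qed
qed

text \<open>
  The decisive point is \<open>10/21 < 1/2\<close>: lattice points with \<open>\<bar>m\<bar>\<^sup>2 \<ge> 5\<close> contribute exponentially less than
  a single point with \<open>\<bar>m\<bar>\<^sup>2 = 4\<close>, whose weight is \<open>1 / (4 * 2\<^sup>d)\<close>. The two terms divided by the Gamma
  function are superexponentially small, and the third one is of order \<open>((33/31) / sqrt 5)\<^sup>d\<close>.
\<close>

lemma far_kernel_form_bounded:
  obtains C :: real where "C \<ge> 0"
    "\<And>d j k. j \<in> {1..d} \<Longrightarrow> k \<in> {1..d} \<Longrightarrow> j \<noteq> k \<Longrightarrow> form_bounded d (far_kernel d j k) (C * (10/21) ^ d)"
proof -
  obtain C :: real where C: "C \<ge> 0"
    "\<And>d j k. j \<in> {1..d} \<Longrightarrow> k \<in> {1..d} \<Longrightarrow> j \<noteq> k \<Longrightarrow> form_bounded d (far_kernel d j k)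
       (C * 10 ^ d / Gamma (real d / 2 + 1)
        + exp 20 * (5 powr (real d / 2 + 1) / Gamma (real d / 2 + 1)) * (4 * (33/31) ^ d)
        + exp 25 / 5 powr (real d / 2 + 1) * (4 * (33/31) ^ d))"
    by (rule far_kernel_form_bounded_explicit) blast
  define E :: real where "E = exp 901"
  \<comment> \<open>\<open>R = 900\<close> makes the base \<open>1/30\<close>, which compensates \<open>10\<^sup>d\<close> and \<open>(sqrt 5 * 33/31)\<^sup>d\<close> with room to spare.\<close>
  have Gamma_inv: "1 / Gamma (real d / 2 + 1) \<le> E * (1/30) ^ d" for d
  proof -
    have "(900::real) powr (real d / 2) = (900 powr (1/2)) powr real d" by (simp only: powr_powr) simp
    also have "\<dots> = 30 ^ d"
      using real_sqrt_unique[of 30 900] by (simp add: powr_half_sqrt powr_realpow)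
    finally have "30 ^ d * exp (- 901) \<le> Gamma (real d / 2 + 1)"
      using Gamma_ge_power[of "real d / 2 + 1" 900] by simp
    then have "1 / Gamma (real d / 2 + 1) \<le> 1 / (30 ^ d * exp (- 901))"
      by (intro divide_left_mono mult_pos_pos Gamma_real_pos) auto
    also have "\<dots> = E * (1/30) ^ d"
      by (simp add: E_def exp_minus power_divide divide_simps)
    finally show ?thesis .
  qed
  have five: "(5::real) powr (real d / 2 + 1) = 5 * sqrt 5 ^ d" for d
  proof -
    have "(5::real) powr (real d / 2) = (5 powr (1/2)) powr real d" by (simp only: powr_powr) simp
    then show ?thesis by (simp add: powr_add powr_half_sqrt powr_realpow)
  qed
  \<comment> \<open>The lower bound is \<open>33/31 * 21/10\<close>, the least value for which the third term decays like \<open>(10/21)\<^sup>d\<close>.\<close>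
  have sqrt5_upper: "sqrt 5 \<le> (7/3 :: real)" by (rule real_le_lsqrt) (simp_all add: power2_eq_square)
  have sqrt5_lower: "sqrt 5 \<ge> (693/310 :: real)" by (rule real_le_rsqrt) (simp add: power2_eq_square)
  note sqrt5 = sqrt5_upper sqrt5_lower
  define C' where "C' = C * E + exp 20 * 5 * E * 4 + exp 25 / 5 * 4"
  show ?thesis
  proof (rule that[of C'])
    show "C' \<ge> 0" using C(1) by (simp add: C'_def E_def)
    fix d j k :: nat
    assume jk: "j \<in> {1..d}" "k \<in> {1..d}" "j \<noteq> k"
    let ?G = "Gamma (real d / 2 + 1)"
    have 1: "C * 10 ^ d / ?G \<le> C * E * (10/21) ^ d"
    proof -
      have "C * 10 ^ d * (1 / ?G) \<le> C * 10 ^ d * (E * (1/30) ^ d)"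
        using C(1) by (intro mult_left_mono Gamma_inv) auto
      also have "\<dots> = C * E * (10 * (1/30)) ^ d" by (simp only: power_mult_distrib mult_ac)
      also have "\<dots> \<le> C * E * (10/21) ^ d"
        using C(1) by (intro mult_left_mono power_mono) (auto simp: E_def)
      finally show ?thesis by simp
    qed
    have 2: "exp 20 * (5 powr (real d / 2 + 1) / ?G) * (4 * (33/31) ^ d) \<le> exp 20 * 5 * E * 4 * (10/21) ^ d"
    proof -
      have "exp 20 * (5 * sqrt 5 ^ d * (1 / ?G)) * (4 * (33/31) ^ d)
          \<le> exp 20 * (5 * sqrt 5 ^ d * (E * (1/30) ^ d)) * (4 * (33/31) ^ d)"
        by (intro mult_left_mono mult_right_mono Gamma_inv) auto
      also have "\<dots> = exp 20 * 5 * E * 4 * (sqrt 5 * (1/30) * (33/31)) ^ d"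
        by (simp only: power_mult_distrib mult_ac)
      also have "\<dots> \<le> exp 20 * 5 * E * 4 * (10/21) ^ d"
        using sqrt5 by (intro mult_left_mono power_mono) (auto simp: E_def)
      finally show ?thesis unfolding five by simp
    qed
    have 3: "exp 25 / 5 powr (real d / 2 + 1) * (4 * (33/31) ^ d) \<le> exp 25 / 5 * 4 * (10/21) ^ d"
    proof -
      have "exp 25 / 5 powr (real d / 2 + 1) * (4 * (33/31) ^ d) = exp 25 / 5 * 4 * ((33/31) / sqrt 5) ^ d"
        unfolding five power_divide[of "33/31"] by simp
      also have "\<dots> \<le> exp 25 / 5 * 4 * (10/21) ^ d"
        using sqrt5 by (intro mult_left_mono power_mono) (auto simp: divide_le_eq)
      finally show ?thesis .
    qed
    have "C * 10 ^ d / ?G + exp 20 * (5 powr (real d / 2 + 1) / ?G) * (4 * (33/31) ^ d)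
        + exp 25 / 5 powr (real d / 2 + 1) * (4 * (33/31) ^ d) \<le> C' * (10/21) ^ d"
      using 1 2 3 by (simp add: C'_def distrib_right)
    then show "form_bounded d (far_kernel d j k) (C' * (10/21) ^ d)"
      using form_bounded_mono[OF C(2)[OF jk]] by blast
  qed
qed

section \<open>From boxes to square-summable functions\<close>

lemma lattice_box_subset: "lattice_box d N \<subseteq> int_lattice d"
  by (auto simp: lattice_box_def)

lemma lattice_box_mono: "N \<le> N' \<Longrightarrow> lattice_box d N \<subseteq> lattice_box d N'"
  by (auto simp: lattice_box_def intro: order_trans)

lemma finite_subset_lattice_box:
  assumes "finite F" "F \<subseteq> int_lattice d"
  obtains N where "F \<subseteq> lattice_box d N"
proof
  let ?N = "\<Sum>m\<in>F. \<Sum>i\<in>{1..d}. nat \<bar>m i\<bar>"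
  show "F \<subseteq> lattice_box d ?N"
  proof
    fix m assume m: "m \<in> F"
    have "\<bar>m i\<bar> \<le> int ?N" for i
    proof (cases "i \<in> {1..d}")
      case True
      then have "nat \<bar>m i\<bar> \<le> (\<Sum>i\<in>{1..d}. nat \<bar>m i\<bar>)" by (intro member_le_sum) auto
      also have "\<dots> \<le> ?N" using m assms(1) by (intro member_le_sum) auto
      finally show ?thesis by linarith
    next
      case False
      then have "m i = 0" using assms(2) m by (auto simp: int_lattice_def)
      then show ?thesis by (simp only: abs_zero of_nat_0_le_iff)
    qed
    then show "m \<in> lattice_box d ?N" using assms(2) m by (auto simp: lattice_box_def)
  qed
qed

lemma filterlim_lattice_box: "filterlim (lattice_box d) (finite_subsets_at_top (int_lattice d)) sequentially"
  unfolding filterlim_finite_subsets_at_top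
proof (intro allI impI)
  fix F assume F: "finite F \<and> F \<subseteq> int_lattice d"
  then obtain N where "F \<subseteq> lattice_box d N" using finite_subset_lattice_box by blast
  then have "F \<subseteq> lattice_box d N'" if "N' \<ge> N" for N' using lattice_box_mono[OF that] by blast
  then show "\<forall>\<^sub>F N in sequentially. finite (lattice_box d N) \<and> F \<subseteq> lattice_box d N \<and> lattice_box d N \<subseteq> int_lattice d"
    using lattice_box_subset eventually_sequentiallyI[of N] by (metis (mono_tags, lifting) finite_lattice_box)
qed

lemma infsum_lattice_box_tendsto:
  fixes f :: "(nat \<Rightarrow> int) \<Rightarrow> 'a::{comm_monoid_add, t2_space}"
  assumes "f summable_on int_lattice d"
  shows "(\<lambda>N. sum f (lattice_box d N)) \<longlonglongrightarrow> infsum f (int_lattice d)"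
  using filterlim_compose[OF has_sum_infsum[OF assms, unfolded has_sum_def] filterlim_lattice_box] .

lemma nonneg_summable_on_int_lattice:
  fixes f :: "(nat \<Rightarrow> int) \<Rightarrow> real"
  assumes nn: "\<And>m. 0 \<le> f m" and bd: "\<And>N. sum f (lattice_box d N) \<le> B"
  shows "f summable_on int_lattice d" "infsum f (int_lattice d) \<le> B"
proof -
  have fin: "sum f F \<le> B" if "finite F" "F \<subseteq> int_lattice d" for F
  proof -
    obtain N where "F \<subseteq> lattice_box d N" using finite_subset_lattice_box[of F d] \<open>finite F\<close> \<open>F \<subseteq> int_lattice d\<close> by blast
    then have "sum f F \<le> sum f (lattice_box d N)" using nn by (intro sum_mono2) auto
    then show ?thesis using bd[of N] by linarith
  qed
  then have "bdd_above (sum f ` {F. F \<subseteq> int_lattice d \<and> finite F})" by (intro bdd_aboveI[of _ B]) auto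
  then show s: "f summable_on int_lattice d" using nn by (intro nonneg_bdd_above_summable_on) auto
  show "infsum f (int_lattice d) \<le> B" by (rule infsum_le_finite_sums[OF s fin])
qed

lemma bij_betw_reflect_int_lattice:
  assumes "n \<in> int_lattice d"
  shows "bij_betw (\<lambda>m i. n i - m i) (int_lattice d) (int_lattice d)"
  by (rule bij_betw_byWitness[where f' = "\<lambda>m i. n i - m i"]) (use assms in \<open>auto simp: int_lattice_def\<close>)

text \<open>
  Applying the bound to the unit mass at the origin returns the kernel. This gives the absolute
  convergence of the defining series on \<open>\<ell>\<^sup>2\<close> by the Cauchy--Schwarz inequality.
\<close>

lemma form_bounded_kernel_square_summable:
  assumes "form_bounded d k M" "0 \<le> M"
  shows "(\<lambda>m. (k m)\<^sup>2) summable_on int_lattice d"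
proof (rule nonneg_summable_on_int_lattice(1))
  fix N
  let ?B = "lattice_box d N"
  let ?\<delta> = "\<lambda>y. if y = (\<lambda>i. 0) then 1 else (0 :: complex)"
  have 0: "(\<lambda>i. 0) \<in> ?B" by (simp add: lattice_box_def int_lattice_def)
  have "(\<Sum>x\<in>?B. (k x)\<^sup>2) = (\<Sum>x\<in>?B. (cmod (\<Sum>y\<in>?B. of_real (k (\<lambda>i. x i - y i)) * ?\<delta> y))\<^sup>2)"
    using 0 by (intro sum.cong refl) (simp add: if_distrib sum.delta cong: if_cong)
  also have "\<dots> \<le> M\<^sup>2 * (\<Sum>y\<in>?B. (cmod (?\<delta> y))\<^sup>2)" by (rule form_bounded_box_norm[OF assms])
  also have "(\<Sum>y\<in>?B. (cmod (?\<delta> y))\<^sup>2) = (\<Sum>y\<in>?B. if y = (\<lambda>i. 0) then 1 else 0)" by (intro sum.cong) auto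
  also have "\<dots> = 1" using 0 by (simp add: sum.delta)
  finally show "(\<Sum>m\<in>?B. (k m)\<^sup>2) \<le> M\<^sup>2 * 1" .
qed auto

text \<open>
  For a fixed box of output points, the convolution is the limit of convolutions with truncations of
  \<open>f\<close>, which the box estimate controls; letting the box of output points grow afterwards is Fatou's lemma
  for sums.
\<close>

lemma form_bounded_conv_l2:
  fixes f :: "(nat \<Rightarrow> int) \<Rightarrow> complex"
  assumes fb: "form_bounded d k M" "0 \<le> M"
    and f: "(\<lambda>m. (cmod (f m))\<^sup>2) summable_on int_lattice d"
  defines "g \<equiv> \<lambda>n. \<Sum>\<^sub>\<infinity>m\<in>int_lattice d. of_real (k m) * f (\<lambda>i. n i - m i)"
  shows "(\<lambda>n. (cmod (g n))\<^sup>2) summable_on int_lattice d"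
    and "(\<Sum>\<^sub>\<infinity>n\<in>int_lattice d. (cmod (g n))\<^sup>2) \<le> M\<^sup>2 * (\<Sum>\<^sub>\<infinity>m\<in>int_lattice d. (cmod (f m))\<^sup>2)"
proof -
  let ?L = "int_lattice d"
  define F where "F = (\<Sum>\<^sub>\<infinity>m\<in>?L. (cmod (f m))\<^sup>2)"
  have g_lim: "(\<lambda>N. \<Sum>y\<in>lattice_box d N. of_real (k (\<lambda>i. n i - y i)) * f y) \<longlonglongrightarrow> g n" if n: "n \<in> ?L" for n
  proof -
    have bij: "bij_betw (\<lambda>m i. n i - m i) ?L ?L" by (rule bij_betw_reflect_int_lattice[OF n])
    have k2: "(\<lambda>y. (k (\<lambda>i. n i - y i))\<^sup>2) summable_on ?L"
      using summable_on_reindex_bij_betw[OF bij, of "\<lambda>m. (k m)\<^sup>2"] form_bounded_kernel_square_summable[OF fb] by simp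
    have "(\<lambda>y. cmod (of_real (k (\<lambda>i. n i - y i)) * f y)) summable_on ?L"
    proof (rule summable_on_comparison_test[OF summable_on_add[OF k2 f]])
      fix y
      have "0 \<le> (\<bar>k (\<lambda>i. n i - y i)\<bar> - cmod (f y))\<^sup>2" by simp
      moreover have "0 \<le> \<bar>k (\<lambda>i. n i - y i)\<bar> * cmod (f y)" by simp
      ultimately show "cmod (of_real (k (\<lambda>i. n i - y i)) * f y) \<le> (k (\<lambda>i. n i - y i))\<^sup>2 + (cmod (f y))\<^sup>2"
        unfolding norm_mult norm_of_real power2_diff power2_abs by linarith
    qed auto
    then have "(\<lambda>y. of_real (k (\<lambda>i. n i - y i)) * f y) summable_on ?L" by (rule abs_summable_summable)
    then have "(\<lambda>N. \<Sum>y\<in>lattice_box d N. of_real (k (\<lambda>i. n i - y i)) * f y)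
        \<longlonglongrightarrow> (\<Sum>\<^sub>\<infinity>y\<in>?L. of_real (k (\<lambda>i. n i - y i)) * f y)"
      by (rule infsum_lattice_box_tendsto)
    also have "(\<Sum>\<^sub>\<infinity>y\<in>?L. of_real (k (\<lambda>i. n i - y i)) * f y) = g n"
      using infsum_reindex_bij_betw[OF bij, of "\<lambda>m. of_real (k m) * f (\<lambda>i. n i - m i)"] by (simp add: g_def)
    finally show ?thesis .
  qed
  have bound: "(\<Sum>n\<in>lattice_box d N0. (cmod (g n))\<^sup>2) \<le> M\<^sup>2 * F" for N0
  proof (rule tendsto_upperbound)
    show "(\<lambda>N. \<Sum>n\<in>lattice_box d N0. (cmod (\<Sum>y\<in>lattice_box d N. of_real (k (\<lambda>i. n i - y i)) * f y))\<^sup>2)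
        \<longlonglongrightarrow> (\<Sum>n\<in>lattice_box d N0. (cmod (g n))\<^sup>2)"
      using lattice_box_subset by (intro tendsto_intros g_lim) auto
    show "\<forall>\<^sub>F N in sequentially. (\<Sum>n\<in>lattice_box d N0. (cmod (\<Sum>y\<in>lattice_box d N. of_real (k (\<lambda>i. n i - y i)) * f y))\<^sup>2) \<le> M\<^sup>2 * F"
      using eventually_ge_at_top[of N0]
    proof eventually_elim
      case (elim N)
      have "(\<Sum>n\<in>lattice_box d N0. (cmod (\<Sum>y\<in>lattice_box d N. of_real (k (\<lambda>i. n i - y i)) * f y))\<^sup>2)
          \<le> (\<Sum>n\<in>lattice_box d N. (cmod (\<Sum>y\<in>lattice_box d N. of_real (k (\<lambda>i. n i - y i)) * f y))\<^sup>2)"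
        using lattice_box_mono[OF elim] by (intro sum_mono2) auto
      also have "\<dots> \<le> M\<^sup>2 * (\<Sum>y\<in>lattice_box d N. (cmod (f y))\<^sup>2)" by (rule form_bounded_box_norm[OF fb])
      also have "\<dots> \<le> M\<^sup>2 * F"
        unfolding F_def using f lattice_box_subset by (intro mult_left_mono finite_sum_le_infsum) auto
      finally show ?case .
    qed
  qed auto
  show "(\<lambda>n. (cmod (g n))\<^sup>2) summable_on ?L" "(\<Sum>\<^sub>\<infinity>n\<in>?L. (cmod (g n))\<^sup>2) \<le> M\<^sup>2 * (\<Sum>\<^sub>\<infinity>m\<in>?L. (cmod (f m))\<^sup>2)"
    using nonneg_summable_on_int_lattice[of "\<lambda>n. (cmod (g n))\<^sup>2", OF _ bound] by (auto simp: F_def)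
qed

section \<open>The operator norm of the discrete Riesz transform\<close>

lemma lp_norm_2_le_iff:
  assumes "0 \<le> c"
  shows "lp_norm 2 A f \<le> ereal c \<longleftrightarrow>
    (\<lambda>x. (norm (f x))\<^sup>2) summable_on A \<and> (\<Sum>\<^sub>\<infinity>x\<in>A. (norm (f x))\<^sup>2) \<le> c\<^sup>2"
proof -
  let ?S = "\<Sum>\<^sub>\<infinity>x\<in>A. (norm (f x))\<^sup>2"
  have p: "norm (f x) powr 2 = (norm (f x))\<^sup>2" for x by (simp add: powr_numeral)
  have "0 \<le> ?S" by (intro infsum_nonneg) auto
  then have "?S powr (1/2) \<le> c \<longleftrightarrow> ?S \<le> c\<^sup>2"
    using assms by (metis powr_half_sqrt real_le_lsqrt real_sqrt_le_iff real_sqrt_unique sqrt_le_D)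
  then show ?thesis unfolding lp_norm_def p by simp
qed

lemma eucl_norm_power: "eucl_norm d m ^ (d + 2) = sq_norm d m powr (real d / 2 + 1)"
proof -
  have e: "eucl_norm d m = sqrt (sq_norm d m)" by (simp add: eucl_norm_def sq_norm_def L2_set_def)
  show ?thesis
  proof (cases "sq_norm d m = 0")
    case False
    then have q: "sq_norm d m > 0" using sq_norm_nonneg[of d m] by simp
    have "sq_norm d m powr (real d / 2 + 1) = (sq_norm d m powr (1/2)) powr real (d + 2)"
      by (simp add: powr_powr add_divide_distrib add.commute)
    also have "\<dots> = sqrt (sq_norm d m) ^ (d + 2)" using q by (subst powr_realpow) (auto simp: powr_half_sqrt)
    finally show ?thesis by (simp add: e)
  qed (simp add: e)
qed

lemma discrete_riesz2_eq:
  "discrete_riesz2 d j k f n = of_real (riesz_const d) *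
     (\<Sum>\<^sub>\<infinity>m\<in>int_lattice d. of_real (riesz_kernel d j k m) * f (\<lambda>i. n i - m i))"
proof -
  have "(\<Sum>\<^sub>\<infinity>m\<in>int_lattice d - {\<lambda>i. 0}. of_real (riesz_kernel d j k m) * f (\<lambda>i. n i - m i))
      = (\<Sum>\<^sub>\<infinity>m\<in>int_lattice d. of_real (riesz_kernel d j k m) * f (\<lambda>i. n i - m i))"
    by (rule infsum_cong_neutral) (auto simp: riesz_kernel_def)
  then show ?thesis unfolding discrete_riesz2_def eucl_norm_power riesz_kernel_def[symmetric] by simp
qed

lemma riesz_const_pos: "riesz_const d > 0"
  by (simp add: riesz_const_def Gamma_real_pos add_nonneg_pos)

lemma lp_opnorm_riesz_le:
  assumes fb: "form_bounded d (riesz_kernel d j k) M" "0 \<le> M"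
  shows "lp_opnorm 2 (int_lattice d) (discrete_riesz2 d j k) \<le> ereal (riesz_const d * M)"
  unfolding lp_opnorm_def
proof (rule SUP_least)
  fix f assume "f \<in> {f. lp_norm 2 (int_lattice d) f \<le> 1}"
  then have f: "(\<lambda>m. (cmod (f m))\<^sup>2) summable_on int_lattice d" "(\<Sum>\<^sub>\<infinity>m\<in>int_lattice d. (cmod (f m))\<^sup>2) \<le> 1"
    using lp_norm_2_le_iff[of 1 "int_lattice d" f] by (auto simp: one_ereal_def)
  let ?c = "riesz_const d"
  let ?g = "\<lambda>n. \<Sum>\<^sub>\<infinity>m\<in>int_lattice d. of_real (riesz_kernel d j k m) * f (\<lambda>i. n i - m i)"
  have c: "?c > 0" by (rule riesz_const_pos)
  note g = form_bounded_conv_l2[OF fb f(1)]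
  have sq: "(cmod (discrete_riesz2 d j k f n))\<^sup>2 = ?c\<^sup>2 * (cmod (?g n))\<^sup>2" for n
    by (simp add: discrete_riesz2_eq norm_mult power_mult_distrib)
  have "(\<Sum>\<^sub>\<infinity>n\<in>int_lattice d. (cmod (?g n))\<^sup>2) \<le> M\<^sup>2 * 1"
    using g(2) f(2) by (meson mult_left_mono order_trans zero_le_power2)
  then have "?c\<^sup>2 * (\<Sum>\<^sub>\<infinity>n\<in>int_lattice d. (cmod (?g n))\<^sup>2) \<le> ?c\<^sup>2 * M\<^sup>2"
    by (intro mult_left_mono) auto
  then show "lp_norm 2 (int_lattice d) (discrete_riesz2 d j k f) \<le> ereal (?c * M)"
    using c fb(2) g(1)
    by (subst lp_norm_2_le_iff) (auto simp: sq infsum_cmult_right' power_mult_distrib summable_on_cmult_right)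
qed

text \<open>
  Conversely, a bound for the operator norm passes to the truncated convolution on every box, by
  extending \<open>f\<close> by zero and normalizing it.
\<close>

lemma lp_opnorm_riesz_box:
  fixes f :: "(nat \<Rightarrow> int) \<Rightarrow> complex"
  assumes op: "lp_opnorm 2 (int_lattice d) (discrete_riesz2 d j k) \<le> ereal (riesz_const d * \<nu>)" and \<nu>: "0 \<le> \<nu>"
  shows "(\<Sum>x\<in>lattice_box d N. (cmod (\<Sum>y\<in>lattice_box d N. of_real (riesz_kernel d j k (\<lambda>i. x i - y i)) * f y))\<^sup>2)
      \<le> \<nu>\<^sup>2 * (\<Sum>y\<in>lattice_box d N. (cmod (f y))\<^sup>2)"
proof (cases "(\<Sum>y\<in>lattice_box d N. (cmod (f y))\<^sup>2) = 0")
  case True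
  then have "\<forall>y\<in>lattice_box d N. f y = 0" by (simp add: sum_nonneg_eq_0_iff)
  then show ?thesis using True by simp
next
  case False
  let ?L = "int_lattice d" and ?B = "lattice_box d N" and ?K = "riesz_kernel d j k" and ?c = "riesz_const d"
  define A where "A = sqrt (\<Sum>y\<in>?B. (cmod (f y))\<^sup>2)"
  have "(\<Sum>y\<in>?B. (cmod (f y))\<^sup>2) \<ge> 0" by (intro sum_nonneg) auto
  then have A: "A > 0" "A\<^sup>2 = (\<Sum>y\<in>?B. (cmod (f y))\<^sup>2)" using False by (auto simp: A_def less_le)
  define f' where "f' y = (if y \<in> ?B then f y / of_real A else 0)" for y
  have c: "?c > 0" by (rule riesz_const_pos)
  have supp: "(h has_sum sum h ?B) ?L" if "\<And>y. y \<in> ?L - ?B \<Longrightarrow> h y = 0" for h :: "(nat \<Rightarrow> int) \<Rightarrow> 'z :: {comm_monoid_add, topological_space}"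
    using has_sum_finite[of ?B h] has_sum_cong_neutral[of ?B ?L h h "sum h ?B"] that lattice_box_subset by auto
  have "((\<lambda>y. (cmod (f' y))\<^sup>2) has_sum (\<Sum>y\<in>?B. (cmod (f' y))\<^sup>2)) ?L"
    by (rule supp) (auto simp: f'_def)
  moreover have "(\<Sum>y\<in>?B. (cmod (f' y))\<^sup>2) = 1"
    using A False by (simp add: f'_def norm_divide power_divide flip: sum_divide_distrib)
  ultimately have "lp_norm 2 ?L f' \<le> ereal 1"
    by (subst lp_norm_2_le_iff) (auto simp: has_sum_imp_summable infsumI)
  then have "lp_norm 2 ?L (discrete_riesz2 d j k f') \<le> lp_opnorm 2 ?L (discrete_riesz2 d j k)"
    unfolding lp_opnorm_def by (intro SUP_upper) (auto simp: one_ereal_def)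
  then have "lp_norm 2 ?L (discrete_riesz2 d j k f') \<le> ereal (?c * \<nu>)" using op by (rule order_trans)
  then have T: "(\<lambda>x. (cmod (discrete_riesz2 d j k f' x))\<^sup>2) summable_on ?L"
    "(\<Sum>\<^sub>\<infinity>x\<in>?L. (cmod (discrete_riesz2 d j k f' x))\<^sup>2) \<le> (?c * \<nu>)\<^sup>2"
    using \<nu> c by (subst (asm) lp_norm_2_le_iff; auto)+
  have val: "discrete_riesz2 d j k f' x = of_real (?c / A) * (\<Sum>y\<in>?B. of_real (?K (\<lambda>i. x i - y i)) * f y)"
    if "x \<in> ?B" for x
  proof -
    have x: "x \<in> ?L" using that lattice_box_subset by auto
    have "(\<Sum>\<^sub>\<infinity>m\<in>?L. of_real (?K m) * f' (\<lambda>i. x i - m i)) = (\<Sum>\<^sub>\<infinity>y\<in>?L. of_real (?K (\<lambda>i. x i - y i)) * f' y)"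
      using infsum_reindex_bij_betw[OF bij_betw_reflect_int_lattice[OF x], of "\<lambda>m. of_real (?K m) * f' (\<lambda>i. x i - m i)"] by simp
    also have "\<dots> = (\<Sum>y\<in>?B. of_real (?K (\<lambda>i. x i - y i)) * f' y)"
      by (rule infsumI[OF supp]) (auto simp: f'_def)
    also have "\<dots> = (\<Sum>y\<in>?B. of_real (?K (\<lambda>i. x i - y i)) * f y) / of_real A"
      by (simp add: f'_def sum_divide_distrib)
    finally show ?thesis by (simp add: discrete_riesz2_eq)
  qed
  have "(\<Sum>x\<in>?B. (cmod (discrete_riesz2 d j k f' x))\<^sup>2) \<le> (?c * \<nu>)\<^sup>2"
    using finite_sum_le_infsum[OF T(1), of ?B] T(2) lattice_box_subset by fastforce
  moreover have "(\<Sum>x\<in>?B. (cmod (discrete_riesz2 d j k f' x))\<^sup>2)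
      = (?c / A)\<^sup>2 * (\<Sum>x\<in>?B. (cmod (\<Sum>y\<in>?B. of_real (?K (\<lambda>i. x i - y i)) * f y))\<^sup>2)"
    unfolding sum_distrib_left
    by (intro sum.cong refl) (simp only: val norm_mult norm_of_real power_mult_distrib power2_abs)
  ultimately have "(?c / A)\<^sup>2 * (\<Sum>x\<in>?B. (cmod (\<Sum>y\<in>?B. of_real (?K (\<lambda>i. x i - y i)) * f y))\<^sup>2) \<le> (?c * \<nu>)\<^sup>2"
    by simp
  then have "(A / ?c)\<^sup>2 * ((?c / A)\<^sup>2 * (\<Sum>x\<in>?B. (cmod (\<Sum>y\<in>?B. of_real (?K (\<lambda>i. x i - y i)) * f y))\<^sup>2))
      \<le> (A / ?c)\<^sup>2 * (?c * \<nu>)\<^sup>2"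
    by (rule mult_left_mono) simp
  moreover have "(A / ?c)\<^sup>2 * ((?c / A)\<^sup>2 * w) = w" for w
    using c A(1) by (simp add: power_divide)
  moreover have "(A / ?c)\<^sup>2 * (?c * \<nu>)\<^sup>2 = \<nu>\<^sup>2 * A\<^sup>2"
    using c by (simp add: power_divide power_mult_distrib)
  ultimately show ?thesis unfolding A(2) by (simp only:)
qed

section \<open>A character on which the near part attains its norm\<close>

text \<open>
  On the support of the near kernel \<open>m\<^sub>j\<close> and \<open>m\<^sub>k\<close> are units, since \<open>2\<^sup>2 + 1\<^sup>2 > 4\<close>. This is why
  one character makes all near terms add up, see below.
\<close>

lemma near_kernel_nonzeroD:
  assumes jk: "j \<in> {1..d}" "k \<in> {1..d}" "j \<noteq> k" and nz: "near_kernel d j k m \<noteq> 0"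
  shows "m j = 1 \<or> m j = - 1" "m k = 1 \<or> m k = - 1"
proof -
  have le: "sq_norm d m \<le> 4" and "riesz_kernel d j k m \<noteq> 0"
    using nz by (auto simp: near_kernel_def split: if_splits)
  then have "m j \<noteq> 0" "m k \<noteq> 0" by (auto simp: riesz_kernel_def)
  then have pos: "1 \<le> \<bar>m j\<bar>" "1 \<le> \<bar>m k\<bar>" by auto
  have "real_of_int ((m j)\<^sup>2 + (m k)\<^sup>2) \<le> sq_norm d m"
    unfolding sq_norm_def sum_split_two[OF jk] by (simp add: sum_nonneg)
  then have "real_of_int ((m j)\<^sup>2 + (m k)\<^sup>2) \<le> real_of_int 4" using le by simp
  then have le': "(m j)\<^sup>2 + (m k)\<^sup>2 \<le> 4" by (simp only: of_int_le_iff)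
  have sq: "1 \<le> (m j)\<^sup>2" "1 \<le> (m k)\<^sup>2"
    using pos abs_le_square_iff[of 1 "m j"] abs_le_square_iff[of 1 "m k"] by simp_all
  have "\<bar>m j\<bar> < 2" "\<bar>m k\<bar> < 2"
    using le' sq power2_less_imp_less[of "\<bar>m j\<bar>" 2] power2_less_imp_less[of "\<bar>m k\<bar>" 2] by simp_all
  then show "m j = 1 \<or> m j = - 1" "m k = 1 \<or> m k = - 1" using pos by linarith+
qed

lemma sq_norm_le_4_box:
  assumes "m \<in> int_lattice d" "sq_norm d m \<le> 4"
  shows "m \<in> lattice_box d 2"
proof -
  have "\<bar>m i\<bar> \<le> 2" for i
  proof (cases "i \<in> {1..d}")
    case True
    then have "(real_of_int (m i))\<^sup>2 \<le> sq_norm d m" unfolding sq_norm_def by (intro member_le_sum) auto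
    then have "(real_of_int (m i))\<^sup>2 \<le> 2\<^sup>2" using assms(2) by simp
    then have "\<bar>real_of_int (m i)\<bar> \<le> 2" by (subst (asm) abs_le_square_iff[symmetric]) simp
    then show ?thesis by linarith
  qed (use assms(1) in \<open>simp add: int_lattice_def\<close>)
  then show ?thesis using assms(1) by (simp add: lattice_box_def)
qed

lemma near_kernel_support:
  assumes "m \<in> int_lattice d" "m \<notin> lattice_box d 2"
  shows "near_kernel d j k m = 0"
  using assms sq_norm_le_4_box by (auto simp: near_kernel_def)

text \<open>
  The \<open>\<ell>\<^sup>1\<close> norm of the near kernel, whose support lies in the box of radius \<open>2\<close>.
\<close>

definition near_mass :: "nat \<Rightarrow> nat \<Rightarrow> nat \<Rightarrow> real" where
  "near_mass d j k = (\<Sum>m\<in>lattice_box d 2. \<bar>near_kernel d j k m\<bar>)"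

lemma near_mass_nonneg: "0 \<le> near_mass d j k"
  by (simp add: near_mass_def sum_nonneg)

lemma near_kernel_form_bounded: "form_bounded d (near_kernel d j k) (near_mass d j k)"
proof (rule form_bounded_l1)
  fix N
  have "(\<Sum>z\<in>lattice_box d N. \<bar>near_kernel d j k z\<bar>) \<le> (\<Sum>z\<in>lattice_box d (max N 2). \<bar>near_kernel d j k z\<bar>)"
    by (intro sum_mono2 lattice_box_mono) auto
  also have "\<dots> = near_mass d j k"
    unfolding near_mass_def using lattice_box_subset
    by (intro sum.mono_neutral_right lattice_box_mono) (auto intro!: near_kernel_support)
  finally show "(\<Sum>z\<in>lattice_box d N. \<bar>near_kernel d j k z\<bar>) \<le> near_mass d j k" .
qed

text \<open>
  The character with frequency \<open>1/4\<close> in the coordinates \<open>j\<close> and \<open>k\<close> satisfies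
  \<open>m\<^sub>j m\<^sub>k \<i>\<^bsup>-(m j + m k)\<^esup> = -1\<close> for all four choices of signs, so convolution with the near kernel multiplies it by
  \<open>- near_mass d j k\<close>: the trivial \<open>\<ell>\<^sup>1\<close> bound for the near part is attained.
\<close>

lemma near_kernel_character:
  assumes jk: "j \<in> {1..d}" "k \<in> {1..d}" "j \<noteq> k" and x: "x \<in> lattice_box d N"
  shows "cmod (\<Sum>y\<in>lattice_box d (N + 2). of_real (near_kernel d j k (\<lambda>i. x i - y i)) * \<i> powi (y j + y k)) = near_mass d j k"
proof -
  let ?K = "near_kernel d j k" and ?r = "\<lambda>m i. x i - m i"
  have inj: "inj_on ?r A" for A by (auto simp: inj_on_def fun_eq_iff)
  have xL: "x \<in> int_lattice d" using x lattice_box_subset by auto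
  have sub: "?r ` lattice_box d 2 \<subseteq> lattice_box d (N + 2)"
  proof (rule image_subsetI)
    fix m assume m: "m \<in> lattice_box d 2"
    have "\<bar>x i - m i\<bar> \<le> int (N + 2)" for i
      using x m abs_triangle_ineq4[of "x i" "m i"] by (fastforce simp: lattice_box_def dest!: spec[of _ i])
    then show "?r m \<in> lattice_box d (N + 2)" using x m by (simp add: lattice_box_def int_lattice_def)
  qed
  have zero: "?K (?r y) = 0" if "y \<in> lattice_box d (N + 2) - ?r ` lattice_box d 2" for y
  proof (rule near_kernel_support)
    show "?r y \<in> int_lattice d" using that xL subsetD[OF lattice_box_subset[of d "N + 2"], of y] by (auto simp: int_lattice_def)
    have "y = ?r (?r y)" by simp
    then show "?r y \<notin> lattice_box d 2" using that by (metis DiffD2 imageI)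
  qed
  \<comment> \<open>Each of the four sign patterns of \<open>(m j, m k)\<close> yields the factor \<open>- 1\<close>.\<close>
  have shift: "of_real (?K m) * \<i> powi (x j - m j + (x k - m k)) = - (\<i> powi (x j + x k)) * of_real \<bar>?K m\<bar>" for m
  proof (cases "?K m = 0")
    case False
    note v = near_kernel_nonzeroD[OF jk False]
    have K: "?K m = real_of_int (m j * m k) / sq_norm d m powr (real d / 2 + 1)"
      using False by (auto simp: near_kernel_def riesz_kernel_def split: if_splits)
    have p: "\<i> powi (x j - m j + (x k - m k)) = \<i> powi (x j + x k) * \<i> powi (- m j - m k)"
      by (simp add: algebra_simps flip: power_int_add)
    show ?thesis using v unfolding p K
      by (elim disjE) (simp_all add: power_int_def nat_add_distrib power2_eq_square flip: numeral_2_eq_2)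
  qed simp
  have "(\<Sum>y\<in>lattice_box d (N + 2). of_real (?K (?r y)) * \<i> powi (y j + y k))
      = (\<Sum>y\<in>?r ` lattice_box d 2. of_real (?K (?r y)) * \<i> powi (y j + y k))"
    using sub zero by (intro sum.mono_neutral_right) auto
  also have "\<dots> = (\<Sum>m\<in>lattice_box d 2. of_real (?K m) * \<i> powi (x j - m j + (x k - m k)))"
    by (subst sum.reindex[OF inj]) simp
  also have "\<dots> = - (\<i> powi (x j + x k)) * of_real (near_mass d j k)"
    unfolding shift near_mass_def by (simp add: sum_distrib_left)
  finally show ?thesis
    using near_mass_nonneg[of d j k] by (simp add: norm_mult norm_power_int)
qed

text \<open>
  Testing the operator on the character of the preceding lemma, cut off to a box. Inside the box shrunk by \<open>2\<close> the
  near part acts as on the full character, and the boxes have asymptotically equal size.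
\<close>

lemma near_mass_le:
  assumes jk: "j \<in> {1..d}" "k \<in> {1..d}" "j \<noteq> k"
    and op: "lp_opnorm 2 (int_lattice d) (discrete_riesz2 d j k) \<le> ereal (riesz_const d * \<nu>)" and \<nu>: "0 \<le> \<nu>"
    and far: "form_bounded d (far_kernel d j k) P" and P: "0 \<le> P"
  shows "near_mass d j k \<le> \<nu> + P"
proof -
  define \<phi> :: "(nat \<Rightarrow> int) \<Rightarrow> complex" where "\<phi> y = \<i> powi (y j + y k)" for y
  let ?S = "near_mass d j k"
  have step: "?S * sqrt (((2 * real N + 1) / (2 * real N + 5)) ^ d) \<le> \<nu> + P" for N
  proof -
    let ?B = "lattice_box d (N + 2)"
    define C where "C k x = (\<Sum>y\<in>?B. of_real (k (\<lambda>i. x i - y i)) * \<phi> y)" for k x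
    define A where "A = real (card ?B)"
    have Apos: "A > 0" by (simp add: A_def card_lattice_box)
    have \<phi>1: "cmod (\<phi> y) = 1" for y by (simp add: \<phi>_def norm_power_int)
    have normA: "(\<Sum>y\<in>?B. (cmod (\<phi> y))\<^sup>2) = A" by (simp add: \<phi>1 A_def)
    have L2_le: "L2_set (\<lambda>x. cmod (C k' x)) ?B \<le> M * sqrt A"
      if "(\<Sum>x\<in>?B. (cmod (C k' x))\<^sup>2) \<le> M\<^sup>2 * A" "0 \<le> M" for k' M
    proof -
      have "L2_set (\<lambda>x. cmod (C k' x)) ?B \<le> sqrt (M\<^sup>2 * A)"
        unfolding L2_set_def using that(1) by (rule real_sqrt_le_mono)
      then show ?thesis using that(2) by (simp add: real_sqrt_mult)
    qed
    have full: "L2_set (\<lambda>x. cmod (C (riesz_kernel d j k) x)) ?B \<le> \<nu> * sqrt A"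
    proof (rule L2_le[OF _ \<nu>])
      show "(\<Sum>x\<in>?B. (cmod (C (riesz_kernel d j k) x))\<^sup>2) \<le> \<nu>\<^sup>2 * A"
        unfolding C_def normA[symmetric] by (rule lp_opnorm_riesz_box[OF op \<nu>])
    qed
    have tail: "L2_set (\<lambda>x. cmod (C (far_kernel d j k) x)) ?B \<le> P * sqrt A"
    proof (rule L2_le[OF _ P])
      show "(\<Sum>x\<in>?B. (cmod (C (far_kernel d j k) x))\<^sup>2) \<le> P\<^sup>2 * A"
        unfolding C_def normA[symmetric] by (rule form_bounded_box_norm[OF far P])
    qed
    have split: "C (near_kernel d j k) x = C (riesz_kernel d j k) x - C (far_kernel d j k) x" for x
    proof -
      have "near_kernel d j k m = riesz_kernel d j k m - far_kernel d j k m" for m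
        by (simp add: near_kernel_def far_kernel_def)
      then show ?thesis unfolding C_def by (simp add: sum_subtractf left_diff_distrib)
    qed
    have "?S * sqrt (real (card (lattice_box d N))) = sqrt (\<Sum>x\<in>lattice_box d N. ?S\<^sup>2)"
      using near_mass_nonneg[of d j k] by (simp add: real_sqrt_mult)
    also have "\<dots> = L2_set (\<lambda>x. cmod (C (near_kernel d j k) x)) (lattice_box d N)"
      unfolding L2_set_def C_def \<phi>_def
      by (intro arg_cong[of _ _ sqrt] sum.cong refl) (simp only: near_kernel_character[OF jk])
    also have "\<dots> \<le> L2_set (\<lambda>x. cmod (C (near_kernel d j k) x)) ?B"
      unfolding L2_set_def by (intro real_sqrt_le_mono sum_mono2 lattice_box_mono) auto
    also have "\<dots> \<le> L2_set (\<lambda>x. cmod (C (riesz_kernel d j k) x) + cmod (C (far_kernel d j k) x)) ?B"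
      unfolding split by (intro L2_set_mono norm_triangle_ineq4) auto
    also have "\<dots> \<le> L2_set (\<lambda>x. cmod (C (riesz_kernel d j k) x)) ?B + L2_set (\<lambda>x. cmod (C (far_kernel d j k) x)) ?B"
      by (rule L2_set_triangle_ineq)
    also have "\<dots> \<le> (\<nu> + P) * sqrt A" using full tail by (simp add: distrib_right)
    finally have "?S * sqrt (real (card (lattice_box d N))) / sqrt A \<le> \<nu> + P"
      using Apos by (simp add: divide_le_eq)
    moreover have "sqrt (real (card (lattice_box d N))) / sqrt A = sqrt (((2 * real N + 1) / (2 * real N + 5)) ^ d)"
      by (simp add: A_def card_lattice_box real_sqrt_divide power_divide add.commute)
    ultimately show ?thesis by (simp only: times_divide_eq_right[symmetric])
  qed
  have "(\<lambda>N::nat. (2 * real N + 1) / (2 * real N + 5)) \<longlonglongrightarrow> 1" by real_asymp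
  then have "(\<lambda>N. ?S * sqrt (((2 * real N + 1) / (2 * real N + 5)) ^ d)) \<longlonglongrightarrow> ?S * sqrt (1 ^ d)"
    by (intro tendsto_intros)
  then have "?S * sqrt (1 ^ d) \<le> \<nu> + P"
    by (rule tendsto_upperbound) (use step in auto)
  then show ?thesis by simp
qed

text \<open>
  The operator norm is real, so it can be written as the constant times \<open>\<nu>\<close>; the far part is a perturbation of
  size \<open>P\<close> on either side.
\<close>

lemma lp_opnorm_riesz_near_mass:
  assumes jk: "j \<in> {1..d}" "k \<in> {1..d}" "j \<noteq> k"
    and far: "form_bounded d (far_kernel d j k) P" and P: "0 \<le> P"
  obtains \<nu> where "lp_opnorm 2 (int_lattice d) (discrete_riesz2 d j k) = ereal (riesz_const d * \<nu>)"
    "0 \<le> \<nu>" "near_mass d j k - P \<le> \<nu>" "\<nu> \<le> near_mass d j k + P"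
proof -
  let ?op = "lp_opnorm 2 (int_lattice d) (discrete_riesz2 d j k)" and ?S = "near_mass d j k"
  have c: "riesz_const d > 0" by (rule riesz_const_pos)
  have "riesz_kernel d j k = (\<lambda>m. near_kernel d j k m + far_kernel d j k m)"
    by (auto simp: near_kernel_def far_kernel_def)
  then have "form_bounded d (riesz_kernel d j k) (?S + P)"
    using form_bounded_add[OF near_kernel_form_bounded far] by simp
  then have upper: "?op \<le> ereal (riesz_const d * (?S + P))"
    using P near_mass_nonneg[of d j k] by (intro lp_opnorm_riesz_le) auto
  have "lp_norm 2 (int_lattice d) (\<lambda>_. 0) \<le> 1" by (simp add: lp_norm_def)
  then have "lp_norm 2 (int_lattice d) (discrete_riesz2 d j k (\<lambda>_. 0)) \<le> ?op"
    unfolding lp_opnorm_def by (intro SUP_upper) auto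
  moreover have "0 \<le> lp_norm 2 (int_lattice d) (discrete_riesz2 d j k (\<lambda>_. 0))"
    by (simp add: lp_norm_def)
  ultimately have nonneg: "0 \<le> ?op" by (rule order_trans[rotated])
  obtain r where r: "?op = ereal r" "0 \<le> r"
    using upper nonneg by (cases ?op) auto
  define \<nu> where "\<nu> = r / riesz_const d"
  have op: "?op = ereal (riesz_const d * \<nu>)" using r c by (simp add: \<nu>_def)
  have \<nu>0: "0 \<le> \<nu>" using r c by (simp add: \<nu>_def)
  have "\<nu> \<le> ?S + P" using upper c unfolding op by simp
  moreover have "?S \<le> \<nu> + P" by (rule near_mass_le[OF jk _ \<nu>0 far P]) (simp add: op)
  ultimately show ?thesis using op \<nu>0 by (intro that[of \<nu>]) auto
qed

section \<open>Counting lattice points on small spheres\<close>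

definition near_shell :: "nat \<Rightarrow> nat \<Rightarrow> nat \<Rightarrow> int \<Rightarrow> (nat \<Rightarrow> int) set" where
  "near_shell d j k n = {m \<in> lattice_box d 2. m j \<noteq> 0 \<and> m k \<noteq> 0 \<and> (\<Sum>i\<in>{1..d}. (m i)\<^sup>2) = n}"

lemma finite_near_shell: "finite (near_shell d j k n)"
  by (rule finite_subset[OF _ finite_lattice_box]) (auto simp: near_shell_def)

lemma near_shell_units:
  assumes jk: "j \<in> {1..d}" "k \<in> {1..d}" "j \<noteq> k" and m: "m \<in> near_shell d j k n" and n: "n \<le> 4"
  shows "m j = 1 \<or> m j = - 1" "m k = 1 \<or> m k = - 1" "(\<Sum>i\<in>{1..d} - {j, k}. (m i)\<^sup>2) = n - 2" "n \<ge> 2"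
proof -
  have sq: "sq_norm d m = real_of_int n" using m by (simp add: sq_norm_of_int near_shell_def)
  have "m j * m k \<noteq> 0" using m by (simp add: near_shell_def)
  have "(m j)\<^sup>2 > 0" using m by (simp add: near_shell_def)
  have npos: "n > 0"
  proof -
    have "n = (m j)\<^sup>2 + (m k)\<^sup>2 + (\<Sum>i\<in>{1..d} - {j, k}. (m i)\<^sup>2)"
      using m sum_split_two[OF jk, of "\<lambda>i. (m i)\<^sup>2"] by (simp only: near_shell_def mem_Collect_eq)
    moreover have "0 \<le> (\<Sum>i\<in>{1..d} - {j, k}. (m i)\<^sup>2)" by (rule sum_nonneg) simp
    ultimately show ?thesis using \<open>(m j)\<^sup>2 > 0\<close> zero_le_power2[of "m k"] by linarith
  qed
  have "near_kernel d j k m \<noteq> 0"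
    using \<open>m j * m k \<noteq> 0\<close> npos n by (simp add: near_kernel_def riesz_kernel_def sq)
  note v = near_kernel_nonzeroD[OF jk this]
  then show "m j = 1 \<or> m j = - 1" "m k = 1 \<or> m k = - 1" .
  have "(m j)\<^sup>2 = 1" "(m k)\<^sup>2 = 1" using v by auto
  then show rest: "(\<Sum>i\<in>{1..d} - {j, k}. (m i)\<^sup>2) = n - 2"
    using m sum_split_two[OF jk, of "\<lambda>i. (m i)\<^sup>2"] by (auto simp: near_shell_def)
  have "0 \<le> (\<Sum>i\<in>{1..d} - {j, k}. (m i)\<^sup>2)" by (rule sum_nonneg) simp
  then show "n \<ge> 2" using rest by linarith
qed

lemma near_mass_shells:
  assumes jk: "j \<in> {1..d}" "k \<in> {1..d}" "j \<noteq> k"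
  shows "near_mass d j k = (\<Sum>n\<in>{2,3,4}. real (card (near_shell d j k n)) / real_of_int n powr (real d / 2 + 1))"
proof -
  let ?s = "real d / 2 + 1"
  have on_shell: "\<bar>near_kernel d j k m\<bar> = 1 / real_of_int n powr ?s" if "m \<in> near_shell d j k n" "n \<in> {2,3,4}" for m n
  proof -
    have n: "n \<le> 4" using that by auto
    note v = near_shell_units[OF jk that(1) n]
    have "\<bar>m j * m k\<bar> = 1" using v(1,2) by auto
    then have "\<bar>real_of_int (m j * m k)\<bar> = 1" by linarith
    moreover have "sq_norm d m = real_of_int n" using that by (simp add: sq_norm_of_int near_shell_def)
    ultimately show ?thesis using n by (simp add: near_kernel_def riesz_kernel_def abs_mult)
  qed
  have off: "near_kernel d j k m = 0" if "m \<in> lattice_box d 2 - (\<Union>n\<in>{2,3,4}. near_shell d j k n)" for m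
  proof (rule ccontr)
    assume nz: "near_kernel d j k m \<noteq> 0"
    let ?n = "\<Sum>i\<in>{1..d}. (m i)\<^sup>2"
    have "sq_norm d m \<le> 4" using nz by (auto simp: near_kernel_def split: if_splits)
    then have "real_of_int ?n \<le> real_of_int 4" by (simp only: sq_norm_of_int of_int_numeral)
    then have n: "?n \<le> 4" by (simp only: of_int_le_iff)
    have "m \<in> near_shell d j k ?n"
      using that near_kernel_nonzeroD[OF jk nz] by (auto simp: near_shell_def)
    moreover have "?n \<in> {2,3,4}" using near_shell_units(4)[OF jk calculation n] n by auto
    ultimately show False using that by blast
  qed
  have "near_mass d j k = (\<Sum>m\<in>(\<Union>n\<in>{2,3,4}. near_shell d j k n). \<bar>near_kernel d j k m\<bar>)"
    unfolding near_mass_def using off by (intro sum.mono_neutral_right) (auto simp: near_shell_def)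
  also have "\<dots> = (\<Sum>n\<in>{2,3,4}. \<Sum>m\<in>near_shell d j k n. \<bar>near_kernel d j k m\<bar>)"
    by (intro sum.UNION_disjoint) (auto simp: finite_near_shell, auto simp: near_shell_def)
  also have "\<dots> = (\<Sum>n\<in>{2,3,4}. \<Sum>m\<in>near_shell d j k n. 1 / real_of_int n powr ?s)"
    by (intro sum.cong refl on_shell)
  finally show ?thesis by simp
qed

lemma sum_fun_upd_squares:
  fixes d j k l :: nat
  assumes jk: "j \<in> {1..d}" "k \<in> {1..d}" "j \<noteq> k" and l: "l \<in> {1..d} - {j, k}"
  shows "(\<Sum>i\<in>{1..d}. (((\<lambda>_. 0 :: int)(j := a, k := b, l := c)) i)\<^sup>2) = a\<^sup>2 + b\<^sup>2 + c\<^sup>2"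
proof -
  have "(\<Sum>i\<in>{1..d} - {j, k}. (((\<lambda>_. 0 :: int)(j := a, k := b, l := c)) i)\<^sup>2) = (\<Sum>i\<in>{1..d} - {j, k}. if i = l then c\<^sup>2 else 0)"
    by (intro sum.cong) auto
  also have "\<dots> = c\<^sup>2" using l by (subst sum.delta) auto
  finally show ?thesis using l jk unfolding sum_split_two[OF jk] by auto
qed

lemma card_near_shell_2:
  assumes jk: "j \<in> {1..d}" "k \<in> {1..d}" "j \<noteq> k"
  shows "card (near_shell d j k 2) = 4"
proof -
  let ?f = "\<lambda>(a, b). (\<lambda>_. 0 :: int)(j := a, k := b)"
  let ?X = "{1, - 1} \<times> {1, - 1} :: (int \<times> int) set"
  have "near_shell d j k 2 = ?f ` ?X"
  proof (intro equalityI subsetI)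
    fix m assume m: "m \<in> near_shell d j k 2"
    note v = near_shell_units[OF jk m]
    have "(\<Sum>i\<in>{1..d} - {j, k}. (m i)\<^sup>2) = 0" using v(3) by simp
    then have "\<forall>i\<in>{1..d} - {j, k}. (m i)\<^sup>2 = 0" by (subst (asm) sum_nonneg_eq_0_iff) auto
    moreover have "m i = 0" if "i \<notin> {1..d}" for i using m that by (auto simp: near_shell_def lattice_box_def int_lattice_def)
    ultimately have "m i = 0" if "i \<noteq> j" "i \<noteq> k" for i using that by (cases "i \<in> {1..d}") auto
    then have "m = ?f (m j, m k)" by (auto simp: fun_eq_iff)
    moreover have "(m j, m k) \<in> ?X" using v(1,2) by auto
    ultimately show "m \<in> ?f ` ?X" by blast
  next
    fix m assume "m \<in> ?f ` ?X"
    then obtain a b where ab: "a \<in> {1, - 1}" "b \<in> {1, - 1}" "m = (\<lambda>_. 0 :: int)(j := a, k := b)" by auto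
    have "(\<Sum>i\<in>{1..d} - {j, k}. (m i)\<^sup>2) = 0" by (intro sum.neutral) (auto simp: ab)
    then have "(\<Sum>i\<in>{1..d}. (m i)\<^sup>2) = 2" unfolding sum_split_two[OF jk] using ab jk by auto
    then show "m \<in> near_shell d j k 2" using ab jk by (auto simp: near_shell_def lattice_box_def int_lattice_def)
  qed
  moreover have "inj_on ?f ?X" using jk by (auto simp: inj_on_def fun_eq_iff)
  ultimately show ?thesis by (simp add: card_image card_cartesian_product)
qed

lemma card_near_shell_3:
  assumes jk: "j \<in> {1..d}" "k \<in> {1..d}" "j \<noteq> k"
  shows "card (near_shell d j k 3) = 8 * (d - 2)"
proof -
  let ?f = "\<lambda>((a, b), l, c). (\<lambda>_. 0 :: int)(j := a, k := b, l := c)"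
  let ?U = "{1, - 1} :: int set" and ?I = "{1..d} - {j, k}"
  let ?X = "(?U \<times> ?U) \<times> (?I \<times> ?U)"
  have "near_shell d j k 3 = ?f ` ?X"
  proof (intro equalityI subsetI)
    fix m assume m: "m \<in> near_shell d j k 3"
    note v = near_shell_units[OF jk m]
    have sum1: "(\<Sum>i\<in>?I. (m i)\<^sup>2) = 1" using v(3) by simp
    obtain l where l: "l \<in> ?I" "m l \<noteq> 0"
    proof (rule ccontr)
      assume "\<not> thesis"
      then have "\<forall>i\<in>?I. m i = 0" using that by blast
      then show False using sum1 by simp
    qed
    have split: "(m l)\<^sup>2 + (\<Sum>i\<in>?I - {l}. (m i)\<^sup>2) = 1" using sum1 l by (subst (asm) sum.remove[of _ l]) auto
    have rest: "0 \<le> (\<Sum>i\<in>?I - {l}. (m i)\<^sup>2)" by (rule sum_nonneg) simp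
    have "1 \<le> (m l)\<^sup>2" using l(2) by (simp add: int_one_le_iff_zero_less)
    then have ml: "(m l)\<^sup>2 = 1" and "(\<Sum>i\<in>?I - {l}. (m i)\<^sup>2) = 0" using split rest by linarith+
    then have "\<forall>i\<in>?I - {l}. (m i)\<^sup>2 = 0" by (subst (asm) sum_nonneg_eq_0_iff) auto
    moreover have "m i = 0" if "i \<notin> {1..d}" for i using m that by (auto simp: near_shell_def lattice_box_def int_lattice_def)
    ultimately have "m i = 0" if "i \<noteq> j" "i \<noteq> k" "i \<noteq> l" for i using that by (cases "i \<in> {1..d}") auto
    then have "m = ?f ((m j, m k), l, m l)" by (auto simp: fun_eq_iff)
    moreover have "m l \<in> ?U" using ml by (auto simp: power2_eq_1_iff)
    then have "((m j, m k), l, m l) \<in> ?X" using v(1,2) l by auto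
    ultimately show "m \<in> ?f ` ?X" by blast
  next
    fix m assume "m \<in> ?f ` ?X"
    then obtain p where p: "p \<in> ?X" "m = ?f p" by blast
    obtain a b l c where "p = ((a, b), l, c)" by (metis surj_pair)
    with p have ab: "a \<in> ?U" "b \<in> ?U" "l \<in> ?I" "c \<in> ?U" "m = (\<lambda>_. 0 :: int)(j := a, k := b, l := c)" by auto
    have "(\<Sum>i\<in>{1..d}. (m i)\<^sup>2) = 3" unfolding ab(5) sum_fun_upd_squares[OF jk ab(3)] using ab by auto
    then show "m \<in> near_shell d j k 3" using ab jk by (auto simp: near_shell_def lattice_box_def int_lattice_def)
  qed
  moreover have "inj_on ?f ?X"
  proof (rule inj_onI)
    fix p q assume pq: "p \<in> ?X" "q \<in> ?X" "?f p = ?f q"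
    obtain a b l c a' b' l' c' where e: "p = ((a, b), l, c)" "q = ((a', b'), l', c')" by (metis surj_pair)
    have E: "((\<lambda>_. 0 :: int)(j := a, k := b, l := c)) i = ((\<lambda>_. 0 :: int)(j := a', k := b', l' := c')) i" for i
      using pq(3) unfolding e prod.case by (rule fun_cong)
    have "l = l'" using E[of l] pq(1,2) unfolding e by (auto split: if_splits)
    then show "p = q" using E[of j] E[of k] E[of l] pq(1,2) jk unfolding e by (auto split: if_splits)
  qed
  ultimately have "card (near_shell d j k 3) = card ?X" by (simp only: card_image)
  then show ?thesis by (simp add: card_cartesian_product card_minus_two[OF jk, simplified])
qed

text \<open>
  A Chebyshev-type bound: on the shell the Gaussian weight is \<open>exp (- 20)\<close>, and its sum over the whole lattice
  is known. The true cardinality is quadratic in \<open>d\<close>; a base smaller than \<open>2 / sqrt 3\<close> suffices.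
\<close>

lemma card_near_shell_4_le:
  assumes jk: "j \<in> {1..d}" "k \<in> {1..d}" "j \<noteq> k"
  shows "real (card (near_shell d j k 4)) \<le> exp 20 * (4 * (33/31) ^ d)"
proof -
  have "real (card (near_shell d j k 4)) * exp (- 20) = (\<Sum>m\<in>near_shell d j k 4. exp (- 20))" by simp
  also have "\<dots> = (\<Sum>m\<in>near_shell d j k 4. \<bar>real_of_int (m j * m k)\<bar> * exp (- 5 * sq_norm d m))"
  proof (intro sum.cong refl)
    fix m assume m: "m \<in> near_shell d j k 4"
    have "\<bar>m j * m k\<bar> = 1" using near_shell_units(1,2)[OF jk m] by auto
    then have "\<bar>real_of_int (m j * m k)\<bar> = 1" by linarith
    moreover have "sq_norm d m = 4" using m by (simp add: sq_norm_of_int near_shell_def)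
    ultimately show "exp (- 20) = \<bar>real_of_int (m j * m k)\<bar> * exp (- 5 * sq_norm d m)" by (simp only:) simp
  qed
  also have "\<dots> \<le> (\<Sum>m\<in>lattice_box d 2. \<bar>real_of_int (m j * m k)\<bar> * exp (- 5 * sq_norm d m))"
    by (intro sum_mono2) (auto simp: near_shell_def)
  also have "\<dots> \<le> 4 * (33/31) ^ d" by (rule weighted_gaussian_box_sum[OF jk])
  finally show ?thesis by (simp add: exp_minus field_simps)
qed

lemma card_near_shell_4_ge:
  assumes jk: "j \<in> {1..d}" "k \<in> {1..d}" "j \<noteq> k" and d: "4 \<le> d"
  shows "1 \<le> card (near_shell d j k 4)"
proof -
  have "card ({1..d} - {j, k}) \<ge> 2" using d by (simp only: card_minus_two[OF jk])
  then obtain l l' where l: "l \<in> {1..d} - {j, k}" "l' \<in> {1..d} - {j, k}" "l \<noteq> l'"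
    by (metis card_2_iff' card_le_Suc0_iff_eq finite_Diff finite_atLeastAtMost not_less_eq_eq numeral_2_eq_2)
  define m where "m = (\<lambda>_. 0 :: int)(j := 1, k := 1, l := 1, l' := 1)"
  have "(\<Sum>i\<in>{1..d}. (m i)\<^sup>2) = (\<Sum>i\<in>{j, k, l, l'}. 1)"
    using l jk by (intro sum.mono_neutral_cong_right) (auto simp: m_def)
  also have "\<dots> = 4" using l jk by simp
  finally have "m \<in> near_shell d j k 4"
    using l jk by (auto simp: near_shell_def m_def lattice_box_def int_lattice_def)
  then show ?thesis using finite_near_shell by (metis One_nat_def Suc_leI card_gt_0_iff empty_iff)
qed

text \<open>
  The shells \<open>\<bar>m\<bar>\<^sup>2 = 2\<close> and \<open>\<bar>m\<bar>\<^sup>2 = 3\<close> give the two main terms of the theorem, through \<open>4 / 2\<^bsup>d/2 + 1\<^esup>\<close>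
  and \<open>8 (d - 2) / 3\<^bsup>d/2 + 1\<^esup>\<close>. The shell \<open>\<bar>m\<bar>\<^sup>2 = 4\<close> is the remainder \<open>r\<close>: it is
  negligible against \<open>3\<^bsup>-d/2\<^esup>\<close>, and it contains at least one point once \<open>d \<ge> 4\<close>.
\<close>

lemma near_mass_expansion:
  assumes jk: "j \<in> {1..d}" "k \<in> {1..d}" "j \<noteq> k"
  obtains r where "near_mass d j k = 2 / 2 powr (real d / 2) + (8/3 * (real d - 2)) / 3 powr (real d / 2) + r"
    "0 \<le> r" "r \<le> exp 20 * (33/62) ^ d" "4 \<le> d \<longrightarrow> (1/2) ^ d / 4 \<le> r"
proof -
  have d: "d \<ge> 2" using jk by auto
  define r where "r = real (card (near_shell d j k 4)) / 4 powr (real d / 2 + 1)"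
  have "(4::real) powr (real d / 2) = (4 powr (1/2)) powr real d" by (simp only: powr_powr) simp
  also have "\<dots> = 2 ^ d" using real_sqrt_unique[of 2 4] by (simp add: powr_half_sqrt powr_realpow)
  finally have four: "(4::real) powr (real d / 2 + 1) = 4 * 2 ^ d" by (simp add: powr_add)
  show ?thesis
  proof (rule that[of r])
    show "near_mass d j k = 2 / 2 powr (real d / 2) + (8/3 * (real d - 2)) / 3 powr (real d / 2) + r"
      unfolding near_mass_shells[OF jk] r_def using d
      by (simp add: card_near_shell_2[OF jk] card_near_shell_3[OF jk] powr_add of_nat_diff)
    show "0 \<le> r" by (simp add: r_def)
    have "r \<le> exp 20 * (4 * (33/31) ^ d) / (4 * 2 ^ d)"
      unfolding r_def four by (intro divide_right_mono card_near_shell_4_le[OF jk]) auto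
    also have "\<dots> = exp 20 * ((33/31) / 2) ^ d" unfolding power_divide[of "33/31"] by simp
    finally show "r \<le> exp 20 * (33/62) ^ d" by simp
    show "4 \<le> d \<longrightarrow> (1/2) ^ d / 4 \<le> r"
    proof
      assume "4 \<le> d"
      then have "1 / (4 * 2 ^ d) \<le> r"
        unfolding r_def four using card_near_shell_4_ge[OF jk] by (intro divide_right_mono) auto
      then show "(1/2) ^ d / 4 \<le> r" by (simp add: power_divide)
    qed
  qed
qed

section \<open>Asymptotics of the operator norm\<close>

text \<open>
  For \<open>d \<ge> D\<close> the error is one-sided, because the shell \<open>\<bar>m\<bar>\<^sup>2 = 4\<close>, which enters with a positive sign,
  outweighs the far part.
\<close>

lemma lp_opnorm_riesz_asymptotics:
  obtains e :: "nat \<Rightarrow> real" and D :: nat where "\<And>d. 0 \<le> e d" "(\<lambda>d. e d * 3 powr (real d / 2)) \<longlonglongrightarrow> 0"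
    "\<And>d j k. j \<in> {1..d} \<Longrightarrow> k \<in> {1..d} \<Longrightarrow> j \<noteq> k \<Longrightarrow>
       \<exists>\<nu>\<ge>0. lp_opnorm 2 (int_lattice d) (discrete_riesz2 d j k) = ereal (riesz_const d * \<nu>)
         \<and> \<bar>\<nu> - (2 / 2 powr (real d / 2) + (8/3 * (real d - 2)) / 3 powr (real d / 2))\<bar> \<le> e d
         \<and> (D \<le> d \<longrightarrow> 2 / 2 powr (real d / 2) + (8/3 * (real d - 2)) / 3 powr (real d / 2) \<le> \<nu>)"
proof -
  obtain C :: real where C: "C \<ge> 0"
    "\<And>d j k. j \<in> {1..d} \<Longrightarrow> k \<in> {1..d} \<Longrightarrow> j \<noteq> k \<Longrightarrow> form_bounded d (far_kernel d j k) (C * (10/21) ^ d)"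
    by (rule far_kernel_form_bounded) blast
  define e where "e d = exp 20 * (33/62) ^ d + C * (10/21) ^ d" for d :: nat
  have three: "3 powr (real d / 2) = sqrt 3 ^ d" for d
  proof -
    have "(3::real) powr (real d / 2) = (3 powr (1/2)) powr real d" by (simp only: powr_powr) simp
    then show ?thesis by (simp add: powr_half_sqrt powr_realpow)
  qed
  have sqrt3: "sqrt 3 \<le> (7/4 :: real)" by (rule real_le_lsqrt) (simp_all add: power2_eq_square)
  have "(\<lambda>d. exp 20 * (33/62 * sqrt 3) ^ d + C * (10/21 * sqrt 3) ^ d) \<longlonglongrightarrow> exp 20 * 0 + C * 0"
    using sqrt3 by (intro tendsto_intros LIMSEQ_realpow_zero) auto
  moreover have "e d * 3 powr (real d / 2) = exp 20 * (33/62 * sqrt 3) ^ d + C * (10/21 * sqrt 3) ^ d" for d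
    by (simp only: e_def three distrib_right power_mult_distrib mult.assoc)
  ultimately have lim: "(\<lambda>d. e d * 3 powr (real d / 2)) \<longlonglongrightarrow> 0" by simp
  have "(\<lambda>d. C * (20/21) ^ d) \<longlonglongrightarrow> C * 0" by (intro tendsto_intros LIMSEQ_realpow_zero) auto
  then have "\<forall>\<^sub>F d in sequentially. C * (20/21) ^ d < 1/4" by (rule order_tendstoD(2)) simp
  then obtain D0 where D0: "\<And>d. d \<ge> D0 \<Longrightarrow> C * (20/21) ^ d < 1/4" by (auto simp: eventually_sequentially)
  show ?thesis
  proof (rule that[of e "max D0 4", OF _ lim])
    show "0 \<le> e d" for d using C(1) by (simp add: e_def)
    fix d j k :: nat
    assume jk: "j \<in> {1..d}" "k \<in> {1..d}" "j \<noteq> k"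
    let ?m = "2 / 2 powr (real d / 2) + (8/3 * (real d - 2)) / 3 powr (real d / 2)"
    obtain r where r: "near_mass d j k = ?m + r" "0 \<le> r" "r \<le> exp 20 * (33/62) ^ d" "4 \<le> d \<longrightarrow> (1/2) ^ d / 4 \<le> r"
      by (rule near_mass_expansion[OF jk])
    obtain \<nu> where \<nu>: "lp_opnorm 2 (int_lattice d) (discrete_riesz2 d j k) = ereal (riesz_const d * \<nu>)"
      "0 \<le> \<nu>" "near_mass d j k - C * (10/21) ^ d \<le> \<nu>" "\<nu> \<le> near_mass d j k + C * (10/21) ^ d"
      by (rule lp_opnorm_riesz_near_mass[OF jk C(2)[OF jk]]) (use C(1) in simp)
    have "\<bar>\<nu> - ?m\<bar> \<le> e d" using \<nu> r by (simp add: e_def)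
    moreover have "?m \<le> \<nu>" if "max D0 4 \<le> d"
    proof -
      \<comment> \<open>The far part is \<open>C (20/21)\<^sup>d\<close> times \<open>2\<^sup>-\<^sup>d\<close>, eventually below the contribution \<open>2\<^sup>-\<^sup>d / 4\<close> of one point with \<open>\<bar>m\<bar>\<^sup>2 = 4\<close>.\<close>
      have "C * (10/21) ^ d = C * (20/21) ^ d * (1/2) ^ d" by (simp add: mult.assoc flip: power_mult_distrib)
      also have "\<dots> \<le> 1/4 * (1/2) ^ d" using D0[of d] that by (intro mult_right_mono) auto
      also have "\<dots> \<le> r" using r(4) that by simp
      finally show ?thesis using \<nu>(3) r(1) by linarith
    qed
    ultimately show "\<exists>\<nu>\<ge>0. lp_opnorm 2 (int_lattice d) (discrete_riesz2 d j k) = ereal (riesz_const d * \<nu>)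
         \<and> \<bar>\<nu> - ?m\<bar> \<le> e d \<and> (max D0 4 \<le> d \<longrightarrow> ?m \<le> \<nu>)"
      using \<nu>(1,2) by blast
  qed
qed

theorem theorem1p1:
  shows "(\<exists>\<alpha>>0::real. \<exists>\<beta>>0::real. \<forall>d\<ge>2. \<forall>j\<in>{1..d}. \<forall>k\<in>{1..d}. j \<noteq> k \<longrightarrow>
            ereal (riesz_const d *
                (2 / 2 powr (real d / 2) + (8/3 * (real d - 2)) / 3 powr (real d / 2)
                 - \<beta> / 10 powr (real d / 2) - (48/11 * (real d - 2)) / 11 powr (real d / 2)))
              \<le> lp_opnorm 2 (int_lattice d) (discrete_riesz2 d j k)
            \<and> lp_opnorm 2 (int_lattice d) (discrete_riesz2 d j k)
              \<le> ereal (riesz_const d *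
                  (2 / 2 powr (real d / 2) + \<alpha> * real d / 3 powr (real d / 2))))
       \<and> (\<exists>\<epsilon> :: nat \<Rightarrow> nat \<Rightarrow> nat \<Rightarrow> real.
            (\<forall>\<eta>>0. \<forall>\<^sub>F d in sequentially. \<forall>j\<in>{1..d}. \<forall>k\<in>{1..d}. j \<noteq> k \<longrightarrow> \<bar>\<epsilon> d j k\<bar> < \<eta>)
            \<and> (\<forall>d\<ge>2. \<forall>j\<in>{1..d}. \<forall>k\<in>{1..d}. j \<noteq> k \<longrightarrow>
                 lp_opnorm 2 (int_lattice d) (discrete_riesz2 d j k)
                 = ereal (riesz_const d *
                     (2 / 2 powr (real d / 2) + (8/3 + \<epsilon> d j k) * real d / 3 powr (real d / 2)))))"
proof -
  let ?op = "\<lambda>d j k. lp_opnorm 2 (int_lattice d) (discrete_riesz2 d j k)"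
  define m where "m d = 2 / 2 powr (real d / 2) + (8/3 * (real d - 2)) / 3 powr (real d / 2)" for d
  obtain e D where e: "\<And>d. 0 \<le> e d" "(\<lambda>d. e d * 3 powr (real d / 2)) \<longlonglongrightarrow> 0"
    and asym: "\<And>d j k. j \<in> {1..d} \<Longrightarrow> k \<in> {1..d} \<Longrightarrow> j \<noteq> k \<Longrightarrow>
       \<exists>\<nu>\<ge>0. ?op d j k = ereal (riesz_const d * \<nu>) \<and> \<bar>\<nu> - m d\<bar> \<le> e d \<and> (D \<le> d \<longrightarrow> m d \<le> \<nu>)"
    unfolding m_def by (rule lp_opnorm_riesz_asymptotics) blast
  have "Bseq (\<lambda>d. e d * 3 powr (real d / 2))" using e(2) by (intro convergent_imp_Bseq convergentI)
  then obtain B where B: "0 < B" "\<And>d. norm (e d * 3 powr (real d / 2)) \<le> B" by (rule BseqE) blast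
  have e_le: "e d \<le> B / 3 powr (real d / 2)" for d
    using B(2)[of d] e(1)[of d] by (simp add: le_divide_eq)
  define \<alpha> where "\<alpha> = 8/3 + B"
  \<comment> \<open>Below \<open>D\<close> this \<open>\<beta>\<close> makes the left-hand side nonpositive, since the main terms are at most \<open>2 + 3 D\<close> there.\<close>
  define \<beta> where "\<beta> = (2 + 3 * real D) * 10 powr (real D / 2)"
  have part1: "ereal (riesz_const d * (m d - \<beta> / 10 powr (real d / 2) - (48/11 * (real d - 2)) / 11 powr (real d / 2))) \<le> ?op d j k
      \<and> ?op d j k \<le> ereal (riesz_const d * (2 / 2 powr (real d / 2) + \<alpha> * real d / 3 powr (real d / 2)))"
    if d: "d \<ge> 2" and jk: "j \<in> {1..d}" "k \<in> {1..d}" "j \<noteq> k" for d j k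
  proof -
    obtain \<nu> where \<nu>: "0 \<le> \<nu>" "?op d j k = ereal (riesz_const d * \<nu>)" "\<bar>\<nu> - m d\<bar> \<le> e d" "D \<le> d \<longrightarrow> m d \<le> \<nu>"
      using asym[OF jk] by blast
    have low: "m d - \<beta> / 10 powr (real d / 2) - (48/11 * (real d - 2)) / 11 powr (real d / 2) \<le> \<nu>"
    proof -
      have 11: "0 \<le> (48/11 * (real d - 2)) / 11 powr (real d / 2)" using d by simp
      have 10: "0 \<le> \<beta> / 10 powr (real d / 2)" by (simp add: \<beta>_def)
      show ?thesis
      proof (cases "D \<le> d")
        case True
        then show ?thesis using \<nu>(4) 10 11 by linarith
      next
        case False
        have div: "x / b powr (real d / 2) \<le> x" if "0 \<le> x" "1 \<le> b" for x b :: real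
          using divide_left_mono[of 1 "b powr (real d / 2)" x] that ge_one_powr_ge_zero[of b "real d / 2"] by simp
        have "2 / 2 powr (real d / 2) \<le> (2::real)" "(8/3 * (real d - 2)) / 3 powr (real d / 2) \<le> 8/3 * (real d - 2)"
          using d by (intro div; simp)+
        then have "m d \<le> 2 + 8/3 * (real d - 2)" unfolding m_def by linarith
        moreover have "8/3 * (real d - 2) \<le> 3 * real D"
          using False of_nat_less_iff[of d D, where ?'a = real] unfolding not_le by simp
        ultimately have "m d \<le> 2 + 3 * real D" by linarith
        also have "\<dots> = \<beta> / 10 powr (real D / 2)" by (simp add: \<beta>_def)
        also have "\<dots> \<le> \<beta> / 10 powr (real d / 2)"
          using False by (intro divide_left_mono powr_mono) (auto simp: \<beta>_def)
        finally show ?thesis using \<nu>(1) 11 by linarith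
      qed
    qed
    have "\<nu> \<le> m d + B / 3 powr (real d / 2)" using \<nu>(3) e_le[of d] by linarith
    also have "\<dots> = 2 / 2 powr (real d / 2) + (8/3 * (real d - 2) + B) / 3 powr (real d / 2)"
      by (simp add: m_def add_divide_distrib)
    also have "\<dots> \<le> 2 / 2 powr (real d / 2) + \<alpha> * real d / 3 powr (real d / 2)"
    proof -
      have "B * 1 \<le> B * real d" using B(1) d by (intro mult_left_mono) auto
      then have "8/3 * (real d - 2) + B \<le> \<alpha> * real d"
        unfolding \<alpha>_def distrib_right by (intro add_mono mult_left_mono) auto
      then show ?thesis by (intro add_left_mono divide_right_mono) auto
    qed
    finally show ?thesis
      using low riesz_const_pos[of d] unfolding \<nu>(2) by (auto intro: mult_left_mono)
  qed
  define \<epsilon> where "\<epsilon> d j k = (real_of_ereal (?op d j k) / riesz_const d - 2 / 2 powr (real d / 2)) * 3 powr (real d / 2) / real d - 8/3"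
    for d j k
  have eps_bound: "\<bar>\<epsilon> d j k\<bar> \<le> (16/3 + e d * 3 powr (real d / 2)) / real d"
    if d: "d \<ge> 2" and jk: "j \<in> {1..d}" "k \<in> {1..d}" "j \<noteq> k" for d j k
  proof -
    obtain \<nu> where \<nu>: "?op d j k = ereal (riesz_const d * \<nu>)" "\<bar>\<nu> - m d\<bar> \<le> e d"
      using asym[OF jk] by blast
    have cancel: "(x + (8/3 * (y - 2)) / z) * z / y - 8/3 = (x * z - 16/3) / y"
      if "0 < y" "0 < z" for x y z :: real
      using that by (simp add: field_simps)
    have \<nu>_split: "\<nu> - 2 / 2 powr (real d / 2) = (\<nu> - m d) + (8/3 * (real d - 2)) / 3 powr (real d / 2)"
      by (simp add: m_def)
    have "real_of_ereal (?op d j k) / riesz_const d = \<nu>"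
      using riesz_const_pos[of d] by (simp add: \<nu>(1))
    then have "\<epsilon> d j k = (\<nu> - 2 / 2 powr (real d / 2)) * 3 powr (real d / 2) / real d - 8/3"
      by (simp only: \<epsilon>_def)
    then have "\<epsilon> d j k = ((\<nu> - m d) * 3 powr (real d / 2) - 16/3) / real d"
      unfolding \<nu>_split using d by (subst (asm) cancel) auto
    then have "\<bar>\<epsilon> d j k\<bar> = \<bar>(\<nu> - m d) * 3 powr (real d / 2) - 16/3\<bar> / real d" by simp
    also have "\<dots> \<le> (\<bar>\<nu> - m d\<bar> * 3 powr (real d / 2) + 16/3) / real d"
      using abs_triangle_ineq4[of "(\<nu> - m d) * 3 powr (real d / 2)" "16/3"]
      by (intro divide_right_mono) (auto simp: abs_mult)
    also have "\<dots> \<le> (e d * 3 powr (real d / 2) + 16/3) / real d"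
      using \<nu>(2) by (intro divide_right_mono add_right_mono mult_right_mono) auto
    finally show ?thesis by (simp add: add.commute)
  qed
  have eps_eq: "?op d j k = ereal (riesz_const d * (2 / 2 powr (real d / 2) + (8/3 + \<epsilon> d j k) * real d / 3 powr (real d / 2)))"
    if d: "d \<ge> 2" and jk: "j \<in> {1..d}" "k \<in> {1..d}" "j \<noteq> k" for d j k
  proof -
    obtain \<nu> where \<nu>: "?op d j k = ereal (riesz_const d * \<nu>)" using asym[OF jk] by blast
    have "real_of_ereal (?op d j k) / riesz_const d = \<nu>"
      using riesz_const_pos[of d] by (simp add: \<nu>)
    then have "(8/3 + \<epsilon> d j k) * real d = (\<nu> - 2 / 2 powr (real d / 2)) * 3 powr (real d / 2)"
      using d by (simp only: \<epsilon>_def) simp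
    then have "(8/3 + \<epsilon> d j k) * real d / 3 powr (real d / 2) = \<nu> - 2 / 2 powr (real d / 2)" by simp
    then show ?thesis by (simp add: \<nu>)
  qed
  have lim0: "(\<lambda>d. (16/3 + e d * 3 powr (real d / 2)) / real d) \<longlonglongrightarrow> 0"
    by (rule real_tendsto_divide_at_top[OF tendsto_add[OF tendsto_const e(2)] filterlim_real_sequentially])
  have eps_small: "\<forall>\<^sub>F d in sequentially. \<forall>j\<in>{1..d}. \<forall>k\<in>{1..d}. j \<noteq> k \<longrightarrow> \<bar>\<epsilon> d j k\<bar> < \<eta>" if "\<eta> > 0" for \<eta>
    using order_tendstoD(2)[OF lim0 that] eventually_ge_at_top[of 2]
  proof eventually_elim
    case (elim d)
    show ?case
    proof (intro ballI impI)
      fix j k assume "j \<in> {1..d}" "k \<in> {1..d}" "j \<noteq> k"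
      then show "\<bar>\<epsilon> d j k\<bar> < \<eta>" using eps_bound[of d j k] elim by linarith
    qed
  qed
  have pos: "\<alpha> > 0" "\<beta> > 0" using B(1) by (auto simp: \<alpha>_def \<beta>_def intro!: mult_pos_pos)
  show ?thesis
  proof (rule conjI)
    show "\<exists>\<alpha>>0::real. \<exists>\<beta>>0::real. \<forall>d\<ge>2. \<forall>j\<in>{1..d}. \<forall>k\<in>{1..d}. j \<noteq> k \<longrightarrow>
            ereal (riesz_const d *
                (2 / 2 powr (real d / 2) + (8/3 * (real d - 2)) / 3 powr (real d / 2)
                 - \<beta> / 10 powr (real d / 2) - (48/11 * (real d - 2)) / 11 powr (real d / 2)))
              \<le> ?op d j k
            \<and> ?op d j k
              \<le> ereal (riesz_const d *
                  (2 / 2 powr (real d / 2) + \<alpha> * real d / 3 powr (real d / 2)))"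
      by (rule exI[of _ \<alpha>], rule conjI[OF pos(1)], rule exI[of _ \<beta>], rule conjI[OF pos(2)],
          rule allI, rule impI, rule ballI, rule ballI, rule impI, rule part1[unfolded m_def])
    show "\<exists>\<epsilon> :: nat \<Rightarrow> nat \<Rightarrow> nat \<Rightarrow> real.
            (\<forall>\<eta>>0. \<forall>\<^sub>F d in sequentially. \<forall>j\<in>{1..d}. \<forall>k\<in>{1..d}. j \<noteq> k \<longrightarrow> \<bar>\<epsilon> d j k\<bar> < \<eta>)
            \<and> (\<forall>d\<ge>2. \<forall>j\<in>{1..d}. \<forall>k\<in>{1..d}. j \<noteq> k \<longrightarrow>
                 ?op d j k = ereal (riesz_const d *
                     (2 / 2 powr (real d / 2) + (8/3 + \<epsilon> d j k) * real d / 3 powr (real d / 2))))"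
    proof (rule exI[of _ \<epsilon>], rule conjI)
      show "\<forall>\<eta>>0. \<forall>\<^sub>F d in sequentially. \<forall>j\<in>{1..d}. \<forall>k\<in>{1..d}. j \<noteq> k \<longrightarrow> \<bar>\<epsilon> d j k\<bar> < \<eta>"
        by (rule allI, rule impI, rule eps_small)
      show "\<forall>d\<ge>2. \<forall>j\<in>{1..d}. \<forall>k\<in>{1..d}. j \<noteq> k \<longrightarrow>
          ?op d j k = ereal (riesz_const d * (2 / 2 powr (real d / 2) + (8/3 + \<epsilon> d j k) * real d / 3 powr (real d / 2)))"
        by (rule allI, rule impI, rule ballI, rule ballI, rule impI, rule eps_eq)
    qed
  qed
qed

end
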